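(* Let $r,n$ be positive integers, let $H$ be the rational Cherednik algebra of type $G(r,1,n)$ over the polynomial ring $R=\mathbf{C}[c_0,d_1,\dots,d_{r-1}]$, and let $H_{\mathrm{gr}}\subseteq H$ be the subalgebra generated by $\mathfrak{t}$ and $W=G(r,1,n)$. Let $A$ be the $R$-algebra generated by $H_{\mathrm{gr}}$ together with two elements $\Phi$ and $\Psi$ subject to the relations $$\Phi s_i=s_{i-1}\Phi\ (2\le i\le n-1),\qquad \Phi^2s_1=s_{n-1}\Phi^2,$$ $$\Psi s_i=s_{i+1}\Psi\ (1\le i\le n-2),\qquad \Psi^2s_{n-1}=s_1\Psi^2,$$ $$\zeta_i\Phi=\Phi\,\phi(\zeta_i),\qquad \zeta_i\Psi=\Psi\,\phi^{-1}(\zeta_i)\qquad(1\le i\le n),$$ $$\Psi\Phi=z_1,\qquad \Phi\Psi=z_n-1+\sum_{j=0}^{r-1}(d_j-d_{j-1})e_{nj},\qquad \Psi s_{n-1}\Phi=\Phi s_1\Psi+c_0\sum_{l=0}^{r-1}\zeta^{-l}\zeta_1^l\zeta_n^{-l}$$ (relations involving some $s_i$ being void when $n=1$). Then the natural map $A\to H$, which is the inclusion on $H_{\mathrm{gr}}$ and sends $\Phi\mapsto x_ns_{n-1}\cdots s_1$ and $\Psi\mapsto y_1s_1\cdots s_{n-1}$, is an isomorphism.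
   Context: $\zeta=e^{2\pi\sqrt{-1}/r}$. $W=G(r,1,n)$ is the group of $n\times n$ monomial matrices whose nonzero entries are powers of $\zeta$, acting on $V=\mathbf{C}^n$ with standard basis $y_1,\dots,y_n$; $x_1,\dots,x_n$ is the dual basis of $V^*$. $s_{ij}$ is the transposition matrix, $s_i=s_{i,i+1}$, $\zeta_i$ multiplies the $i$th coordinate by $\zeta$ and fixes the others, $e_{ij}=\frac1r\sum_{l=0}^{r-1}\zeta^{-lj}\zeta_i^l$. Here $c_0,d_1,\dots,d_{r-1}$ are indeterminates, $d_0$ is defined by $d_0+d_1+\cdots+d_{r-1}=0$, and indices of $d_i$ are read modulo $r$. $H$ is the $R$-algebra generated by $R[x_1,\dots,x_n]$, $R[y_1,\dots,y_n]$ and $RW$ with relations $wfw^{-1}=w(f)$ for $w\in W$ and $f$ in either polynomial ring, $$y_ix_i=x_iy_i+1-c_0\sum_{j\ne i}\sum_{l=0}^{r-1}\zeta_i^ls_{ij}\zeta_i^{-l}-\sum_{l=0}^{r-1}(d_l-d_{l-1})e_{il},\qquad y_ix_j=x_jy_i+c_0\sum_{l=0}^{r-1}\zeta^{-l}\zeta_i^ls_{ij}\zeta_i^{-l}\ (i\ne j).$$ Put $\phi_i=\sum_{1\le j<i}\sum_{l=0}^{r-1}\zeta_i^ls_{ij}\zeta_i^{-l}$ and $z_i=y_ix_i+c_0\phi_i$ for $1\le i\le n$. The Dunkl-Opdam subalgebra $\mathfrak{t}$ is the commutative subalgebra of $H$ generated by $z_1,\dots,z_n,\zeta_1,\dots,\zeta_n$;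 it is the polynomial ring in $z_1,\dots,z_n$ tensored with the group algebra of $(\mathbf{Z}/r\mathbf{Z})^n$. The subalgebra $H_{\mathrm{gr}}$ generated by $\mathfrak{t}$ and $W$ is the generalized graded affine Hecke algebra, with relations $z_is_j=s_jz_i$ for $i\ne j,j+1$ and $z_is_i=s_iz_{i+1}-c_0\pi_i$, where $\pi_i=\sum_{l=0}^{r-1}\zeta_i^l\zeta_{i+1}^{-l}$ (together with the relations of $W$ and of $\mathfrak{t}$). The map $\phi$ on the $\zeta_i$ is the restriction of an automorphism of $\mathfrak{t}$ given by $\phi(\zeta_i)=\zeta_{i+1}$ for $1\le i\le n-1$ and $\phi(\zeta_n)=\zeta^{-1}\zeta_1$. *)

theory Defs
  imports
    Complex_Main
    "HOL-Library.Poly_Mapping"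
    "HOL-Combinatorics.Transposition"
    "HOL-Algebra.QuotRing"
    "HOL-Algebra.Generated_Rings"
    "Jordan_Normal_Form.Matrix"
begin

section \<open>Associative algebras given by generators and relations\<close>

text \<open>A separate type of words keeps the free monoid apart from the type of lists, so that the
  multiplication of finitely supported functions on words (concatenation of words, extended
  bilinearly) comes from \<^theory>\<open>HOL-Library.Poly_Mapping\<close>.\<close>

datatype 'g word = Word (letters: "'g list")

instantiation word :: (type) monoid_add
begin

definition zero_word :: "'g word" where
  "zero_word = Word []"

definition plus_word :: "'g word \<Rightarrow> 'g word \<Rightarrow> 'g word" where
  "plus_word u v = Word (letters u @ letters v)"

instance
  by standard (simp_all add: zero_word_def plus_word_def)

end

type_synonym ('g, 'k) free_algebra = "'g word \<Rightarrow>\<^sub>0 'k"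

definition gen :: "'g \<Rightarrow> ('g, 'k::comm_ring_1) free_algebra" where
  "gen g = Poly_Mapping.single (Word [g]) 1"

definition scal :: "'k \<Rightarrow> ('g, 'k::comm_ring_1) free_algebra" where
  "scal c = Poly_Mapping.single 0 c"

text \<open>The free algebra on the set \<open>S\<close> over the subring \<open>K\<close> of a commutative ring.\<close>

definition free_alg :: "'k::comm_ring_1 set \<Rightarrow> 'g set \<Rightarrow> ('g, 'k) free_algebra ring" where
  "free_alg K S =
    \<lparr>carrier = {f. \<forall>w \<in> Poly_Mapping.keys f. set (letters w) \<subseteq> S \<and> Poly_Mapping.lookup f w \<in> K},
     monoid.mult = (*), one = 1, zero = 0, add = (+)\<rparr>"

text \<open>A relation \<open>a = b\<close> is given as the pair \<open>(a, b)\<close>. The ideal is two-sided, and the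
  image of \<open>a\<close> in the quotient is its coset.\<close>

definition rel_ideal ::
    "'k::comm_ring_1 set \<Rightarrow> 'g set \<Rightarrow> (('g, 'k) free_algebra \<times> ('g, 'k) free_algebra) set
      \<Rightarrow> ('g, 'k) free_algebra set" where
  "rel_ideal K S rels = Idl\<^bsub>free_alg K S\<^esub> {a - b |a b. (a, b) \<in> rels}"

definition presented_alg ::
    "'k::comm_ring_1 set \<Rightarrow> 'g set \<Rightarrow> (('g, 'k) free_algebra \<times> ('g, 'k) free_algebra) set
      \<Rightarrow> ('g, 'k) free_algebra set ring" where
  "presented_alg K S rels = free_alg K S Quot rel_ideal K S rels"

definition presented_class ::
    "'k::comm_ring_1 set \<Rightarrow> 'g set \<Rightarrow> (('g, 'k) free_algebra \<times> ('g, 'k) free_algebra) set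
      \<Rightarrow> ('g, 'k) free_algebra \<Rightarrow> ('g, 'k) free_algebra set" where
  "presented_class K S rels a = rel_ideal K S rels +>\<^bsub>free_alg K S\<^esub> a"


section \<open>The ring of parameters\<close>

text \<open>Complex polynomials in countably many variables. The ring \<open>R = \<complex>[c\<^sub>0, d\<^sub>1, \<dots>, d\<^bsub>r-1\<^esub>]\<close> is the
  subring of those involving only the variables \<open>0, \<dots>, r - 1\<close>: variable \<open>0\<close> is \<open>c\<^sub>0\<close>, and
  variable \<open>i\<close> is \<open>d\<^sub>i\<close> for \<open>0 < i < r\<close>.\<close>

type_synonym cpoly = "(nat \<Rightarrow>\<^sub>0 nat) \<Rightarrow>\<^sub>0 complex"

definition param_ring :: "nat \<Rightarrow> cpoly set" where
  "param_ring r = {p. \<forall>m \<in> Poly_Mapping.keys p. Poly_Mapping.keys m \<subseteq> {..<r}}"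

definition cst :: "complex \<Rightarrow> cpoly" where
  "cst a = Poly_Mapping.single 0 a"

definition indet :: "nat \<Rightarrow> cpoly" where
  "indet i = Poly_Mapping.single (Poly_Mapping.single i 1) 1"

definition c0 :: cpoly where
  "c0 = indet 0"

text \<open>The index of \<open>d\<close> is read modulo \<open>r\<close>, and \<open>d\<^sub>0 = - (d\<^sub>1 + \<dots> + d\<^bsub>r-1\<^esub>)\<close>.\<close>

definition dpar :: "nat \<Rightarrow> int \<Rightarrow> cpoly" where
  "dpar r j = (let k = nat (j mod int r) in if k = 0 then - (\<Sum>i=1..<r. indet i) else indet k)"


section \<open>The group \<open>G(r,1,n)\<close>\<close>

definition zeta :: "nat \<Rightarrow> complex" where
  "zeta r = exp (2 * of_real pi * \<i> / of_nat r)"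

definition G_r1n :: "nat \<Rightarrow> nat \<Rightarrow> complex mat monoid" where
  "G_r1n r n =
    \<lparr>carrier = {A \<in> carrier_mat n n.
        (\<forall>a<n. \<exists>!b. b < n \<and> A $$ (a, b) \<noteq> 0) \<and>
        (\<forall>b<n. \<exists>!a. a < n \<and> A $$ (a, b) \<noteq> 0) \<and>
        (\<forall>a<n. \<forall>b<n. A $$ (a, b) \<noteq> 0 \<longrightarrow> (\<exists>k::nat. A $$ (a, b) = zeta r ^ k))},
     monoid.mult = (*), one = 1\<^sub>m n\<rparr>"

text \<open>Coordinates are numbered \<open>1, \<dots>, n\<close> below, but matrix entries start at index \<open>0\<close>.\<close>

definition transp_mat :: "nat \<Rightarrow> nat \<Rightarrow> nat \<Rightarrow> complex mat" where
  "transp_mat n i j = mat n n (\<lambda>(a, b). if a + 1 = Transposition.transpose i j (b + 1) then 1 else 0)"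

definition zeta_mat :: "nat \<Rightarrow> nat \<Rightarrow> nat \<Rightarrow> complex mat" where
  "zeta_mat r n i = mat n n (\<lambda>(a, b). if a = b then (if a + 1 = i then zeta r else 1) else 0)"


section \<open>The rational Cherednik algebra\<close>

datatype cher_gen = Xgen nat | Ygen nat | Wgen "complex mat"

type_synonym cher_free = "(cher_gen, cpoly) free_algebra"

definition cher_gens :: "nat \<Rightarrow> nat \<Rightarrow> cher_gen set" where
  "cher_gens r n = Xgen ` {1..n} \<union> Ygen ` {1..n} \<union> Wgen ` carrier (G_r1n r n)"

definition xel :: "nat \<Rightarrow> cher_free" where "xel i = gen (Xgen i)"
definition yel :: "nat \<Rightarrow> cher_free" where "yel i = gen (Ygen i)"
definition grp :: "complex mat \<Rightarrow> cher_free" where "grp w = gen (Wgen w)"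

definition transpn :: "nat \<Rightarrow> nat \<Rightarrow> nat \<Rightarrow> cher_free" where  \<comment> \<open>\<open>s\<^bsub>ij\<^esub>\<close>\<close>
  "transpn n i j = grp (transp_mat n i j)"

definition simple :: "nat \<Rightarrow> nat \<Rightarrow> cher_free" where  \<comment> \<open>\<open>s\<^sub>i\<close>\<close>
  "simple n i = transpn n i (i + 1)"

definition zpow :: "nat \<Rightarrow> nat \<Rightarrow> nat \<Rightarrow> int \<Rightarrow> cher_free" where  \<comment> \<open>\<open>\<zeta>\<^sub>i\<^sup>k\<close>\<close>
  "zpow r n i k = grp (zeta_mat r n i [^]\<^bsub>G_r1n r n\<^esub> k)"

definition eps :: "nat \<Rightarrow> nat \<Rightarrow> nat \<Rightarrow> nat \<Rightarrow> cher_free" where  \<comment> \<open>\<open>e\<^bsub>ij\<^esub>\<close>\<close>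
  "eps r n i j = scal (cst (1 / of_nat r)) *
     (\<Sum>l<r. scal (cst (zeta r powi (- (int l * int j)))) * zpow r n i (int l))"

text \<open>The commuting generators \<open>x\<^sub>i\<close>, respectively \<open>y\<^sub>i\<close>, present the two polynomial rings, and all
  elements of \<open>W = G(r,1,n)\<close> with their products present \<open>RW\<close>. The relations \<open>w f w\<^sup>-\<^sup>1 = w(f)\<close> are
  imposed for \<open>f = x\<^sub>j\<close> and \<open>f = y\<^sub>j\<close>, which gives them for all polynomials \<open>f\<close>, both sides being
  algebra homomorphisms in \<open>f\<close>. On \<open>V\<close>, \<open>w(y\<^sub>j) = \<Sum>\<^sub>k w\<^bsub>kj\<^esub> y\<^sub>k\<close>; on the dual space,
  \<open>w(x\<^sub>j) = x\<^sub>j \<circ> w\<^sup>-\<^sup>1 = \<Sum>\<^sub>k (w\<^sup>-\<^sup>1)\<^bsub>jk\<^esub> x\<^sub>k\<close>.\<close>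

inductive_set cher_rels :: "nat \<Rightarrow> nat \<Rightarrow> (cher_free \<times> cher_free) set" for r n :: nat where
  xx: "\<lbrakk>i \<in> {1..n}; j \<in> {1..n}\<rbrakk> \<Longrightarrow> (xel i * xel j, xel j * xel i) \<in> cher_rels r n"
| yy: "\<lbrakk>i \<in> {1..n}; j \<in> {1..n}\<rbrakk> \<Longrightarrow> (yel i * yel j, yel j * yel i) \<in> cher_rels r n"
| w_one: "(grp \<one>\<^bsub>G_r1n r n\<^esub>, 1) \<in> cher_rels r n"
| w_mult: "\<lbrakk>v \<in> carrier (G_r1n r n); w \<in> carrier (G_r1n r n)\<rbrakk>
    \<Longrightarrow> (grp v * grp w, grp (v \<otimes>\<^bsub>G_r1n r n\<^esub> w)) \<in> cher_rels r n"
| wx: "\<lbrakk>w \<in> carrier (G_r1n r n); j \<in> {1..n}\<rbrakk>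
    \<Longrightarrow> (grp w * xel j * grp (inv\<^bsub>G_r1n r n\<^esub> w),
         \<Sum>k=1..n. scal (cst ((inv\<^bsub>G_r1n r n\<^esub> w) $$ (j - 1, k - 1))) * xel k) \<in> cher_rels r n"
| wy: "\<lbrakk>w \<in> carrier (G_r1n r n); j \<in> {1..n}\<rbrakk>
    \<Longrightarrow> (grp w * yel j * grp (inv\<^bsub>G_r1n r n\<^esub> w),
         \<Sum>k=1..n. scal (cst (w $$ (k - 1, j - 1))) * yel k) \<in> cher_rels r n"
| yx_same: "i \<in> {1..n}
    \<Longrightarrow> (yel i * xel i,
         xel i * yel i + 1
         - scal c0 * (\<Sum>j\<in>{1..n} - {i}. \<Sum>l<r. zpow r n i (int l) * transpn n i j * zpow r n i (- int l))
         - (\<Sum>l<r. scal (dpar r (int l) - dpar r (int l - 1)) * eps r n i l)) \<in> cher_rels r n"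
| yx_diff: "\<lbrakk>i \<in> {1..n}; j \<in> {1..n}; i \<noteq> j\<rbrakk>
    \<Longrightarrow> (yel i * xel j,
         xel j * yel i + scal c0 * (\<Sum>l<r. scal (cst (zeta r powi (- int l))) *
            (zpow r n i (int l) * transpn n i j * zpow r n i (- int l)))) \<in> cher_rels r n"

definition cherednik :: "nat \<Rightarrow> nat \<Rightarrow> cher_free set ring" where
  "cherednik r n = presented_alg (param_ring r) (cher_gens r n) (cher_rels r n)"

definition cher_class :: "nat \<Rightarrow> nat \<Rightarrow> cher_free \<Rightarrow> cher_free set" where
  "cher_class r n = presented_class (param_ring r) (cher_gens r n) (cher_rels r n)"


section \<open>The subalgebras \<open>\<tt>\<close> and \<open>H\<^bsub>gr\<^esub>\<close>\<close>

definition phi_sum :: "nat \<Rightarrow> nat \<Rightarrow> nat \<Rightarrow> cher_free" where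
  "phi_sum r n i = (\<Sum>j\<in>{1..<i}. \<Sum>l<r. zpow r n i (int l) * transpn n i j * zpow r n i (- int l))"

definition zel :: "nat \<Rightarrow> nat \<Rightarrow> nat \<Rightarrow> cher_free" where
  "zel r n i = yel i * xel i + scal c0 * phi_sum r n i"

definition subalgebra_generated :: "nat \<Rightarrow> nat \<Rightarrow> cher_free set set \<Rightarrow> cher_free set set" where
  "subalgebra_generated r n B =
     generate_ring (cherednik r n) ((\<lambda>c. cher_class r n (scal c)) ` param_ring r \<union> B)"

definition dunkl_opdam :: "nat \<Rightarrow> nat \<Rightarrow> cher_free set set" where
  "dunkl_opdam r n = subalgebra_generated r n
     ((\<lambda>i. cher_class r n (zel r n i)) ` {1..n} \<union> (\<lambda>i. cher_class r n (zpow r n i 1)) ` {1..n})"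

definition H_gr :: "nat \<Rightarrow> nat \<Rightarrow> cher_free set set" where
  "H_gr r n = subalgebra_generated r n
     (dunkl_opdam r n \<union> (\<lambda>w. cher_class r n (grp w)) ` carrier (G_r1n r n))"


section \<open>The algebra generated by \<open>H\<^bsub>gr\<^esub>\<close>, \<open>\<Phi>\<close> and \<open>\<Psi>\<close>\<close>

text \<open>The algebra has one generator for each element of \<open>H\<^bsub>gr\<^esub>\<close>; the relations \<open>inc_add\<close>, \<open>inc_mult\<close> and
  \<open>inc_scal\<close> below say exactly that \<open>H\<^bsub>gr\<^esub>\<close> maps to it by a homomorphism of unital \<open>R\<close>-algebras.\<close>

datatype A_gen = Inc "cher_free set" | PhiGen | PsiGen

type_synonym A_free = "(A_gen, cpoly) free_algebra"

definition A_gens :: "nat \<Rightarrow> nat \<Rightarrow> A_gen set" where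
  "A_gens r n = Inc ` H_gr r n \<union> {PhiGen, PsiGen}"

definition \<Phi> :: A_free where "\<Phi> = gen PhiGen"
definition \<Psi> :: A_free where "\<Psi> = gen PsiGen"

definition inc :: "nat \<Rightarrow> nat \<Rightarrow> cher_free \<Rightarrow> A_free" where
  "inc r n h = gen (Inc (cher_class r n h))"

text \<open>The values of the \<open>R\<close>-linear automorphism \<open>\<phi>\<close> of \<open>\<tt>\<close> and of its inverse on \<open>\<zeta>\<^sub>i\<close>. As
  \<open>\<phi>(\<zeta>\<^sub>n) = \<zeta>\<^sup>-\<^sup>1 \<zeta>\<^sub>1\<close>, the inverse sends \<open>\<zeta>\<^sub>1\<close> to \<open>\<zeta> \<zeta>\<^sub>n\<close>.\<close>

definition phi_zeta :: "nat \<Rightarrow> nat \<Rightarrow> nat \<Rightarrow> cher_free" where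
  "phi_zeta r n i = (if i < n then zpow r n (i + 1) 1 else scal (cst (inverse (zeta r))) * zpow r n 1 1)"

definition phi_inv_zeta :: "nat \<Rightarrow> nat \<Rightarrow> nat \<Rightarrow> cher_free" where
  "phi_inv_zeta r n i = (if 1 < i then zpow r n (i - 1) 1 else scal (cst (zeta r)) * zpow r n n 1)"

inductive_set A_rels :: "nat \<Rightarrow> nat \<Rightarrow> (A_free \<times> A_free) set" for r n :: nat where
  inc_add: "\<lbrakk>a \<in> H_gr r n; b \<in> H_gr r n\<rbrakk>
    \<Longrightarrow> (gen (Inc (a \<oplus>\<^bsub>cherednik r n\<^esub> b)), gen (Inc a) + gen (Inc b)) \<in> A_rels r n"
| inc_mult: "\<lbrakk>a \<in> H_gr r n; b \<in> H_gr r n\<rbrakk>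
    \<Longrightarrow> (gen (Inc (a \<otimes>\<^bsub>cherednik r n\<^esub> b)), gen (Inc a) * gen (Inc b)) \<in> A_rels r n"
| inc_scal: "c \<in> param_ring r \<Longrightarrow> (inc r n (scal c), scal c) \<in> A_rels r n"
| Phi_s: "\<lbrakk>2 \<le> i; i + 1 \<le> n\<rbrakk> \<Longrightarrow> (\<Phi> * inc r n (simple n i), inc r n (simple n (i - 1)) * \<Phi>) \<in> A_rels r n"
| Phi2_s: "2 \<le> n \<Longrightarrow> (\<Phi>^2 * inc r n (simple n 1), inc r n (simple n (n - 1)) * \<Phi>^2) \<in> A_rels r n"
| Psi_s: "\<lbrakk>1 \<le> i; i + 2 \<le> n\<rbrakk> \<Longrightarrow> (\<Psi> * inc r n (simple n i), inc r n (simple n (i + 1)) * \<Psi>) \<in> A_rels r n"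
| Psi2_s: "2 \<le> n \<Longrightarrow> (\<Psi>^2 * inc r n (simple n (n - 1)), inc r n (simple n 1) * \<Psi>^2) \<in> A_rels r n"
| zeta_Phi: "i \<in> {1..n} \<Longrightarrow> (inc r n (zpow r n i 1) * \<Phi>, \<Phi> * inc r n (phi_zeta r n i)) \<in> A_rels r n"
| zeta_Psi: "i \<in> {1..n} \<Longrightarrow> (inc r n (zpow r n i 1) * \<Psi>, \<Psi> * inc r n (phi_inv_zeta r n i)) \<in> A_rels r n"
| Psi_Phi: "(\<Psi> * \<Phi>, inc r n (zel r n 1)) \<in> A_rels r n"
| Phi_Psi: "(\<Phi> * \<Psi>,
      inc r n (zel r n n - 1 + (\<Sum>j<r. scal (dpar r (int j) - dpar r (int j - 1)) * eps r n n j))) \<in> A_rels r n"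
| Psi_s_Phi: "2 \<le> n
    \<Longrightarrow> (\<Psi> * inc r n (simple n (n - 1)) * \<Phi>,
         \<Phi> * inc r n (simple n 1) * \<Psi>
         + scal c0 * inc r n (\<Sum>l<r. scal (cst (zeta r powi (- int l))) *
             (zpow r n 1 (int l) * zpow r n n (- int l)))) \<in> A_rels r n"

definition A_alg :: "nat \<Rightarrow> nat \<Rightarrow> A_free set ring" where
  "A_alg r n = presented_alg (param_ring r) (A_gens r n) (A_rels r n)"

definition A_class :: "nat \<Rightarrow> nat \<Rightarrow> A_free \<Rightarrow> A_free set" where
  "A_class r n = presented_class (param_ring r) (A_gens r n) (A_rels r n)"

text \<open>The natural map, as the \<open>R\<close>-algebra homomorphism with the prescribed values on the generators;
  \<open>extensional\<close> only fixes its irrelevant values outside the carrier.\<close>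

definition natural_map :: "nat \<Rightarrow> nat \<Rightarrow> (A_free set \<Rightarrow> cher_free set) \<Rightarrow> bool" where
  "natural_map r n f \<longleftrightarrow>
     f \<in> extensional (carrier (A_alg r n)) \<and>
     f \<in> Ring.ring_hom (A_alg r n) (cherednik r n) \<and>
     (\<forall>c \<in> param_ring r. f (A_class r n (scal c)) = cher_class r n (scal c)) \<and>
     (\<forall>a \<in> H_gr r n. f (A_class r n (gen (Inc a))) = a) \<and>
     f (A_class r n \<Phi>) = cher_class r n (xel n * prod_list (map (simple n) (rev [1..<n]))) \<and>
     f (A_class r n \<Psi>) = cher_class r n (yel 1 * prod_list (map (simple n) [1..<n]))"

end

theory Submission
  imports Defs
begin

text \<open>Let \<open>c = s\<^sub>1 \<dots> s\<^bsub>n-1\<^esub>\<close>, so that \<open>\<Phi> = x\<^sub>n c\<^sup>-\<^sup>1\<close> and \<open>\<Psi> = y\<^sub>1 c\<close> in \<open>H\<close>. No basis theorem for \<open>H\<close> is needed: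
  an inverse of the natural map is obtained from the presentation of \<open>H\<close> by sending \<open>x\<^sub>n\<close> to \<open>\<Phi> c\<close>, \<open>y\<^sub>1\<close> to
  \<open>\<Psi> c\<^sup>-\<^sup>1\<close>, and the other \<open>x\<^sub>j\<close>, \<open>y\<^sub>j\<close> to their conjugates under transpositions. The relations between
  \<open>\<Phi>\<close>, \<open>\<Psi>\<close> and the \<open>s\<^sub>i\<close>, \<open>\<zeta>\<^sub>i\<close> say that \<open>\<Phi> c\<close> and \<open>\<Psi> c\<^sup>-\<^sup>1\<close> transform under the stabilizers in \<open>W\<close> of the
  coordinate lines \<open>n\<close> and \<open>1\<close> as \<open>x\<^sub>n\<close> and \<open>y\<^sub>1\<close> do, which makes the conjugates well defined and
  \<open>W\<close>-equivariant. The remaining relations of \<open>A\<close> translate into single instances of the relations of \<open>H\<close>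
  (\<open>\<Phi>\<^sup>2 s\<^sub>1 = s\<^bsub>n-1\<^esub> \<Phi>\<^sup>2\<close> into \<open>x\<^sub>n x\<^bsub>n-1\<^esub> = x\<^bsub>n-1\<^esub> x\<^sub>n\<close>, the one for \<open>\<Phi> \<Psi>\<close> into the one for \<open>y\<^sub>n x\<^sub>n\<close>, the one for
  \<open>\<Psi> s\<^bsub>n-1\<^esub> \<Phi>\<close> into the one for \<open>y\<^sub>1 x\<^sub>n\<close>), and conjugation by permutations gives all the others. On \<open>H\<^bsub>gr\<^esub>\<close> the two
  maps are mutually inverse because \<open>z\<^sub>1 = \<Psi> \<Phi>\<close> and \<open>z\<^sub>i = s\<^bsub>1i\<^esub> z\<^sub>1 s\<^bsub>1i\<^esub> + c\<^sub>0 \<phi>\<^sub>i\<close>.\<close>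

section \<open>Homomorphisms between presented algebras\<close>

text \<open>This is the universal property of the free algebra made explicit: the homomorphism that
  fixes the scalars and takes prescribed values \<open>h\<close> on the generators.\<close>

definition subst :: "('g \<Rightarrow> ('h, 'k::comm_ring_1) free_algebra) \<Rightarrow> ('g, 'k) free_algebra \<Rightarrow> ('h, 'k) free_algebra"
  where "subst h f = (\<Sum>w\<in>Poly_Mapping.keys f. scal (Poly_Mapping.lookup f w) * prod_list (map h (letters w)))"

lemma scal_simps:
  "scal 0 = 0" "scal 1 = 1" "scal (a + b) = scal a + scal b" "scal (a * b) = scal a * scal b"
  "scal (- a) = - scal a" "scal (a - b) = scal a - scal b"
  by (simp_all add: scal_def single_add mult_single single_uminus single_diff)

lemma sum_singles: "f = (\<Sum>w\<in>Poly_Mapping.keys f. Poly_Mapping.single w (Poly_Mapping.lookup f w))"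
  by (rule poly_mapping_eqI) (auto simp: lookup_sum lookup_single when_def in_keys_iff)

text \<open>Writes a basis vector of the free algebra as a scalar times a product of generators, the
  form used in the word case of \<open>F_induct\<close>.\<close>

lemma single_eq_scal_mult:
  fixes w :: "'g word" and c :: "'k::comm_ring_1"
  shows "Poly_Mapping.single w c = scal c * prod_list (map gen (letters w))"
proof -
  have "prod_list (map gen (letters w)) = (Poly_Mapping.single w 1 :: ('g, 'k) free_algebra)" for w :: "'g word"
  proof (cases w)
    case (Word l)
    have "prod_list (map gen l) = (Poly_Mapping.single (Word l) 1 :: ('g, 'k) free_algebra)"
    proof (induction l)
      case Nil
      show ?case by (simp flip: zero_word_def)
    next
      case (Cons a l)
      then show ?case by (simp add: gen_def mult_single plus_word_def)
    qed
    with Word show ?thesis by simp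
  qed
  then show ?thesis by (simp add: scal_def mult_single)
qed

lemma scal_commute: "scal c * f = f * scal c"
proof -
  have "scal c * Poly_Mapping.single w d = Poly_Mapping.single w d * scal c" for w :: "'a word" and d
    by (simp add: scal_def mult_single mult.commute)
  then show ?thesis
    by (subst (1 2) sum_singles[of f]) (simp add: sum_distrib_left sum_distrib_right)
qed

text \<open>Words outside the support contribute zero. Additivity relies on this: cancellation can
  shrink the support of a sum, so all three sums are taken over one common finite set.\<close>

lemma subst_superset:
  assumes "finite A" "Poly_Mapping.keys f \<subseteq> A"
  shows "subst h f = (\<Sum>w\<in>A. scal (Poly_Mapping.lookup f w) * prod_list (map h (letters w)))"
  unfolding subst_def by (rule sum.mono_neutral_left) (use assms in \<open>auto simp: in_keys_iff scal_simps\<close>)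

lemma subst_zero [simp]: "subst h 0 = 0"
  by (simp add: subst_def)

lemma subst_add [simp]: "subst h (f + g) = subst h f + subst h g"
proof -
  define A where "A = Poly_Mapping.keys f \<union> Poly_Mapping.keys g"
  have "finite A" "Poly_Mapping.keys f \<subseteq> A" "Poly_Mapping.keys g \<subseteq> A" "Poly_Mapping.keys (f + g) \<subseteq> A"
    by (auto simp: A_def in_keys_iff lookup_add)
  then show ?thesis
    by (simp add: subst_superset[of A] lookup_add scal_simps distrib_right sum.distrib)
qed

lemma subst_uminus [simp]: "subst h (- f) = - subst h f"
  using subst_add[of h f "- f"] by (simp add: eq_neg_iff_add_eq_0 add.commute)

lemma subst_diff [simp]: "subst h (f - g) = subst h f - subst h g"
  using subst_add[of h f "- g"] by simp

lemma subst_sum [simp]: "subst h (sum f A) = (\<Sum>a\<in>A. subst h (f a))"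
  by (induction A rule: infinite_finite_induct) auto

lemma subst_single: "subst h (Poly_Mapping.single w c) = scal c * prod_list (map h (letters w))"
  by (cases "c = 0") (simp_all add: subst_def scal_simps)

lemma subst_scal [simp]: "subst h (scal c) = scal c"
  unfolding scal_def by (subst subst_single) (simp add: zero_word_def scal_def)

lemma subst_one [simp]: "subst h 1 = 1"
  using subst_scal[of h 1] by (simp add: scal_simps)

lemma subst_gen [simp]: "subst h (gen g) = h g"
  unfolding gen_def by (subst subst_single) (simp add: scal_simps)

lemma subst_mult [simp]: "subst h (f * g) = subst h f * subst h g"
proof -
  \<comment> \<open>Both sides are bilinear, so monomials suffice; there the product concatenates
    words, and \<open>d\<close> has to be moved past the image of the first word.\<close>
  have *: "subst h (Poly_Mapping.single u c * Poly_Mapping.single v d) =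
      subst h (Poly_Mapping.single u c) * subst h (Poly_Mapping.single v d)" for u v c d
    by (simp add: mult_single subst_single plus_word_def scal_simps mult.assoc)
       (simp add: scal_commute[of d] mult.assoc)
  have "subst h (f * g) = (\<Sum>u\<in>Poly_Mapping.keys f. \<Sum>v\<in>Poly_Mapping.keys g.
      subst h (Poly_Mapping.single u (Poly_Mapping.lookup f u) * Poly_Mapping.single v (Poly_Mapping.lookup g v)))"
    by (subst sum_singles[of f], subst sum_singles[of g])
       (simp only: sum_distrib_left sum_distrib_right subst_sum, rule sum.swap)
  also have "\<dots> = subst h (\<Sum>u\<in>Poly_Mapping.keys f. Poly_Mapping.single u (Poly_Mapping.lookup f u)) *
      subst h (\<Sum>v\<in>Poly_Mapping.keys g. Poly_Mapping.single v (Poly_Mapping.lookup g v))"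
    by (simp only: * subst_sum sum_product)
  finally show ?thesis by (simp flip: sum_singles)
qed

lemma subst_prod_list [simp]: "subst h (prod_list l) = prod_list (map (subst h) l)"
  by (induction l) auto

section \<open>Free algebras over a subring of scalars\<close>

locale scalar_ring =
  fixes K :: "'k::comm_ring_1 set"
  assumes one_mem [simp]: "1 \<in> K"
    and uminus_mem [simp]: "a \<in> K \<Longrightarrow> - a \<in> K"
    and add_mem [simp]: "a \<in> K \<Longrightarrow> b \<in> K \<Longrightarrow> a + b \<in> K"
    and mult_mem [simp]: "a \<in> K \<Longrightarrow> b \<in> K \<Longrightarrow> a * b \<in> K"
begin

lemma zero_mem [simp]: "0 \<in> K"
  using add_mem[of 1 "- 1"] by simp

lemma diff_mem [simp]: "a \<in> K \<Longrightarrow> b \<in> K \<Longrightarrow> a - b \<in> K"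
  using add_mem[of a "- b"] by simp

abbreviation F :: "'g set \<Rightarrow> ('g, 'k) free_algebra set" where
  "F S \<equiv> carrier (free_alg K S)"

lemma free_alg_sel [simp]:
  "monoid.mult (free_alg K S) = (*)" "one (free_alg K S) = 1" "zero (free_alg K S) = 0" "add (free_alg K S) = (+)"
  by (simp_all add: free_alg_def)

text \<open>As \<open>0 \<in> K\<close>, the condition on the coefficients may be imposed on all
  words. This pointwise form spares the computation of supports of sums.\<close>

lemma F_iff: "f \<in> F S \<longleftrightarrow>
    (\<forall>w. Poly_Mapping.lookup f w \<in> K \<and> (Poly_Mapping.lookup f w \<noteq> 0 \<longrightarrow> set (letters w) \<subseteq> S))"
  by (force simp: free_alg_def in_keys_iff)

lemma F_add [simp]: "f \<in> F S \<Longrightarrow> g \<in> F S \<Longrightarrow> f + g \<in> F S"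
  unfolding F_iff lookup_add by (metis add_mem add.right_neutral)

lemma F_uminus [simp]: "f \<in> F S \<Longrightarrow> - f \<in> F S"
  unfolding F_iff by simp

lemma F_diff [simp]: "f \<in> F S \<Longrightarrow> g \<in> F S \<Longrightarrow> f - g \<in> F S"
  using F_add[of f S "- g"] by simp

lemma F_zero [simp]: "0 \<in> F S"
  unfolding F_iff by simp

lemma F_sum [simp]: "(\<And>a. a \<in> A \<Longrightarrow> f a \<in> F S) \<Longrightarrow> sum f A \<in> F S"
  by (induction A rule: infinite_finite_induct) auto

lemma F_single: "c \<in> K \<Longrightarrow> set (letters w) \<subseteq> S \<Longrightarrow> Poly_Mapping.single w c \<in> F S"
  unfolding F_iff lookup_single when_def by auto

lemma F_scal [simp]: "c \<in> K \<Longrightarrow> scal c \<in> F S"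
  unfolding scal_def by (rule F_single) (auto simp: zero_word_def)

lemma F_gen [simp]: "g \<in> S \<Longrightarrow> gen g \<in> F S"
  unfolding gen_def by (rule F_single) auto

lemma F_one [simp]: "1 \<in> F S"
  using F_scal[of 1 S] by (simp add: scal_simps)

lemma F_mult [simp]:
  assumes "f \<in> F S" "g \<in> F S"
  shows "f * g \<in> F S"
proof -
  have "f * g = (\<Sum>u\<in>Poly_Mapping.keys f. \<Sum>v\<in>Poly_Mapping.keys g.
      Poly_Mapping.single (u + v) (Poly_Mapping.lookup f u * Poly_Mapping.lookup g v))"
    by (subst sum_singles[of f], subst sum_singles[of g]) (simp only: sum_product mult_single)
  also have "\<dots> \<in> F S"
    by (intro F_sum F_single) (use assms in \<open>auto simp: F_iff in_keys_iff plus_word_def\<close>)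
  finally show ?thesis .
qed

lemma F_prod_list [simp]: "(\<And>a. a \<in> set l \<Longrightarrow> a \<in> F S) \<Longrightarrow> prod_list l \<in> F S"
  by (induction l) auto

lemma F_mono: "S \<subseteq> S' \<Longrightarrow> F S \<subseteq> F S'"
  unfolding F_iff subset_iff by blast

text \<open>An element is the finite sum of its monomials. The induction runs over subsets of the
  support, and each partial sum stays in \<open>F S\<close> because its terms do.\<close>

lemma F_induct [consumes 1, case_names zero add word]:
  assumes "f \<in> F S" and "P 0"
    and "\<And>f g. f \<in> F S \<Longrightarrow> g \<in> F S \<Longrightarrow> P f \<Longrightarrow> P g \<Longrightarrow> P (f + g)"
    and "\<And>c w. c \<in> K \<Longrightarrow> set w \<subseteq> S \<Longrightarrow> P (scal c * prod_list (map gen w))"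
  shows "P f"
proof -
  let ?s = "\<lambda>w. Poly_Mapping.single w (Poly_Mapping.lookup f w)"
  have "P (sum ?s A)" if "A \<subseteq> Poly_Mapping.keys f" for A
  proof -
    have "finite A" using that finite_keys by (rule finite_subset)
    then show ?thesis using that
    proof (induction A)
      case empty
      then show ?case using assms(2) by simp
    next
      case (insert w A)
      have A: "?s u \<in> F S" if "u \<in> insert w A" for u
        by (rule F_single) (use that insert.prems assms(1) in \<open>auto simp: F_iff in_keys_iff\<close>)
      have "P (?s w)"
        unfolding single_eq_scal_mult
        by (rule assms(4)) (use insert.prems assms(1) in \<open>auto simp: F_iff in_keys_iff\<close>)
      then have "P (?s w + sum ?s A)"
        using A insert.IH insert.prems by (intro assms(3)) auto
      then show ?case using insert.hyps by simp
    qed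
  qed
  from this[OF order_refl] show ?thesis by (simp flip: sum_singles)
qed

lemma subst_mem [simp]:
  assumes "\<And>g. g \<in> S \<Longrightarrow> h g \<in> F S'" "f \<in> F S"
  shows "subst h f \<in> F S'"
  using assms(2)
  by (induction f rule: F_induct) (auto intro!: F_mult F_prod_list assms(1))

lemma free_alg_ring: "ring (free_alg K S)"
proof (intro ringI abelian_groupI monoidI)
  fix x assume "x \<in> F S"
  then show "\<exists>y\<in>F S. y \<oplus>\<^bsub>free_alg K S\<^esub> x = \<zero>\<^bsub>free_alg K S\<^esub>"
    by (intro bexI[of _ "- x"]) auto
qed (auto simp: algebra_simps)

end

section \<open>Quotients of free algebras by relations\<close>

locale presentation = scalar_ring K for K :: "'k::comm_ring_1 set" +
  fixes S :: "'g set" and rels :: "(('g, 'k) free_algebra \<times> ('g, 'k) free_algebra) set"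
  assumes rels_mem: "(a, b) \<in> rels \<Longrightarrow> a \<in> F S \<and> b \<in> F S"
begin

abbreviation I where "I \<equiv> rel_ideal K S rels"
abbreviation cls where "cls \<equiv> presented_class K S rels"
abbreviation Q where "Q \<equiv> presented_alg K S rels"

lemma I_ideal: "ideal I (free_alg K S)"
  unfolding rel_ideal_def
  by (rule ring.genideal_ideal[OF free_alg_ring]) (auto dest: rels_mem)

lemma I_least: "ideal J (free_alg K S) \<Longrightarrow> (\<And>a b. (a, b) \<in> rels \<Longrightarrow> a - b \<in> J) \<Longrightarrow> I \<subseteq> J"
  unfolding rel_ideal_def by (rule ring.genideal_minimal[OF free_alg_ring]) auto

lemma rels_I: "(a, b) \<in> rels \<Longrightarrow> a - b \<in> I"
  unfolding rel_ideal_def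
  by (rule subsetD[OF ring.genideal_self[OF free_alg_ring]]) (auto dest: rels_mem)

sublocale Q: ring Q
  unfolding presented_alg_def by (rule ideal.quotient_is_ring[OF I_ideal])

lemma cls_hom: "cls \<in> Ring.ring_hom (free_alg K S) Q"
  unfolding presented_alg_def presented_class_def by (rule ideal.rcos_ring_hom[OF I_ideal])

lemma cls_closed [simp]: "a \<in> F S \<Longrightarrow> cls a \<in> carrier Q"
  using ring_hom_closed[OF cls_hom] .

lemma cls_add: "a \<in> F S \<Longrightarrow> b \<in> F S \<Longrightarrow> cls (a + b) = cls a \<oplus>\<^bsub>Q\<^esub> cls b"
  using ring_hom_add[OF cls_hom] by simp

lemma cls_mult: "a \<in> F S \<Longrightarrow> b \<in> F S \<Longrightarrow> cls (a * b) = cls a \<otimes>\<^bsub>Q\<^esub> cls b"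
  using ring_hom_mult[OF cls_hom] by simp

lemma cls_one: "cls 1 = \<one>\<^bsub>Q\<^esub>"
  using ring_hom_one[OF cls_hom] by simp

lemma cls_zero: "cls 0 = \<zero>\<^bsub>Q\<^esub>"
  using ring_hom_zero[OF cls_hom free_alg_ring Q.ring_axioms] by simp

lemma cls_uminus: "a \<in> F S \<Longrightarrow> cls (- a) = \<ominus>\<^bsub>Q\<^esub> cls a"
  using cls_add[of "- a" a] by (intro Q.minus_equality[symmetric]) (simp_all add: cls_zero)

lemma cls_diff: "a \<in> F S \<Longrightarrow> b \<in> F S \<Longrightarrow> cls (a - b) = cls a \<ominus>\<^bsub>Q\<^esub> cls b"
  using cls_add[of a "- b"] by (simp add: cls_uminus a_minus_def)

lemma Q_carrier: "carrier Q = cls ` F S"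
  unfolding presented_alg_def presented_class_def FactRing_def A_RCOSETS_def' by auto

lemma cls_eq_iff:
  assumes "a \<in> F S" "b \<in> F S"
  shows "cls a = cls b \<longleftrightarrow> a - b \<in> I"
proof -
  interpret ring "free_alg K S" by (rule free_alg_ring)
  have "\<ominus>\<^bsub>free_alg K S\<^esub> b = - b"
    using assms by (intro minus_equality) auto
  then have "a \<ominus>\<^bsub>free_alg K S\<^esub> b = a - b"
    by (simp add: a_minus_def)
  then show ?thesis
    unfolding presented_class_def
    using quotient_eq_iff_same_a_r_cos[OF I_ideal, of a b] assms by auto
qed

lemma cls_rel: "(a, b) \<in> rels \<Longrightarrow> cls a = cls b"
  using rels_mem rels_I by (simp add: cls_eq_iff)

lemma cls_sum_cong:
  assumes "\<And>a. a \<in> A \<Longrightarrow> f a \<in> F S" "\<And>a. a \<in> A \<Longrightarrow> g a \<in> F S" "\<And>a. a \<in> A \<Longrightarrow> cls (f a) = cls (g a)"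
  shows "cls (sum f A) = cls (sum g A)"
  using assms by (induction A rule: infinite_finite_induct) (auto simp: cls_add)

text \<open>The quotient is generated as a ring by the scalars and the generators. A ring
  homomorphism carries no linearity over \<open>K\<close>, hence the separate hypothesis on
  scalars.\<close>

lemma hom_eqI:
  assumes "ring T" "f \<in> Ring.ring_hom Q T" "g \<in> Ring.ring_hom Q T"
    and scal: "\<And>c. c \<in> K \<Longrightarrow> f (cls (scal c)) = g (cls (scal c))"
    and gen: "\<And>s. s \<in> S \<Longrightarrow> f (cls (gen s)) = g (cls (gen s))"
    and "q \<in> carrier Q"
  shows "f q = g q"
proof -
  interpret T: ring T by fact
  note hom = ring_hom_zero[OF _ Q.ring_axioms T.ring_axioms] ring_hom_one ring_hom_add ring_hom_mult
  obtain a where a: "a \<in> F S" "q = cls a" using \<open>q \<in> carrier Q\<close> by (auto simp: Q_carrier)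
  have word: "f (cls (prod_list (map gen w))) = g (cls (prod_list (map gen w)))" if "set w \<subseteq> S" for w
    using that
  proof (induction w)
    case Nil
    then show ?case using hom(2)[OF assms(2)] hom(2)[OF assms(3)] by (simp add: cls_one)
  next
    case (Cons s w)
    have "gen s \<in> F S" "prod_list (map gen w) \<in> F S" using Cons.prems by (auto intro!: F_prod_list F_gen)
    with Cons show ?case by (simp add: cls_mult hom(4)[OF assms(2)] hom(4)[OF assms(3)] gen)
  qed
  from a(1) have "f (cls a) = g (cls a)"
  proof (induction a rule: F_induct)
    case zero
    then show ?case using hom(1)[OF assms(2)] hom(1)[OF assms(3)] by (simp add: cls_zero)
  next
    case (add a b)
    then show ?case by (simp add: cls_add hom(3)[OF assms(2)] hom(3)[OF assms(3)])
  next
    case (word c w)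
    have "prod_list (map gen w) \<in> F S" using word(2) by (auto intro!: F_prod_list F_gen)
    then show ?case using word
      by (simp add: cls_mult hom(4)[OF assms(2)] hom(4)[OF assms(3)] scal \<open>\<And>w. set w \<subseteq> S \<Longrightarrow> _ w\<close>)
  qed
  then show ?thesis by (simp add: a(2))
qed

end

text \<open>The preimage of the target ideal under \<open>subst h\<close> is a two-sided ideal
  containing the defining relations, hence the whole source ideal; so \<open>subst h\<close>
  descends to the quotients.\<close>

lemma presentation_hom:
  assumes P: "presentation K S rels" and P': "presentation K S' rels'"
    and h: "\<And>g. g \<in> S \<Longrightarrow> h g \<in> carrier (free_alg K S')"
    and rels: "\<And>a b. (a, b) \<in> rels \<Longrightarrow>
      presented_class K S' rels' (subst h a) = presented_class K S' rels' (subst h b)"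
  obtains f where "f \<in> Ring.ring_hom (presented_alg K S rels) (presented_alg K S' rels')"
    and "\<And>a. a \<in> carrier (free_alg K S) \<Longrightarrow>
      f (presented_class K S rels a) = presented_class K S' rels' (subst h a)"
proof -
  interpret P: presentation K S rels by fact
  interpret P': presentation K S' rels' by fact
  note [simp] = P.subst_mem[OF h]
  let ?J = "{a \<in> P.F S. subst h a \<in> P'.I}"
  interpret I': ideal P'.I "free_alg K S'" by (rule P'.I_ideal)
  have add_I: "a + b \<in> P'.I" if "a \<in> P'.I" "b \<in> P'.I" for a b
    using additive_subgroup.a_closed[OF I'.additive_subgroup_axioms that] by simp
  have zero_I: "0 \<in> P'.I"
    using additive_subgroup.zero_closed[OF I'.additive_subgroup_axioms] by simp
  have uminus: "- a \<in> P'.I" if "a \<in> P'.I" for a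
  proof -
    have "a \<in> P.F S'" using that I'.a_subset by auto
    then have "- 1 * a \<in> P'.I"
      using I'.I_l_closed[OF that, of "- 1"] by simp
    then show ?thesis by simp
  qed
  have "ideal ?J (free_alg K S)"
  proof (intro idealI P.free_alg_ring)
    show "subgroup ?J (add_monoid (free_alg K S))"
    proof
      fix a assume a: "a \<in> ?J"
      interpret ring "free_alg K S" by (rule P.free_alg_ring)
      have "inv\<^bsub>add_monoid (free_alg K S)\<^esub> a = - a"
        using minus_equality[of "- a" a] a unfolding a_inv_def by auto
      with a show "inv\<^bsub>add_monoid (free_alg K S)\<^esub> a \<in> ?J"
        by (auto simp: uminus)
    qed (auto simp: add_I zero_I)
  qed (use I'.I_l_closed I'.I_r_closed in auto)
  then have "P.I \<subseteq> ?J"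
    by (rule P.I_least) (use rels P.rels_mem in \<open>auto simp: P'.cls_eq_iff\<close>)
  then have eq: "P'.cls (subst h a) = P'.cls (subst h b)"
    if "a \<in> P.F S" "b \<in> P.F S" "P.cls a = P.cls b" for a b
    using that by (auto simp: P.cls_eq_iff P'.cls_eq_iff)
  \<comment> \<open>A representative of each class is chosen; by \<open>eq\<close> the class of its
    image depends only on the class itself.\<close>
  define f where "f q = P'.cls (subst h (SOME a. a \<in> P.F S \<and> P.cls a = q))" for q
  have f: "f (P.cls a) = P'.cls (subst h a)" if "a \<in> P.F S" for a
  proof -
    have "(SOME b. b \<in> P.F S \<and> P.cls b = P.cls a) \<in> P.F S \<and> P.cls (SOME b. b \<in> P.F S \<and> P.cls b = P.cls a) = P.cls a"
      by (rule someI[of _ a]) (use that in auto)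
    with that show ?thesis unfolding f_def by (intro eq) auto
  qed
  have "f \<in> Ring.ring_hom P.Q P'.Q"
  proof (rule ring_hom_memI)
    fix x y assume "x \<in> carrier P.Q" "y \<in> carrier P.Q"
    then obtain a b where ab: "a \<in> P.F S" "x = P.cls a" "b \<in> P.F S" "y = P.cls b"
      by (auto simp: P.Q_carrier)
    then show "f x \<in> carrier P'.Q" by (simp add: f)
    show "f (x \<otimes>\<^bsub>P.Q\<^esub> y) = f x \<otimes>\<^bsub>P'.Q\<^esub> f y"
      using ab by (simp add: f P'.cls_mult flip: P.cls_mult)
    show "f (x \<oplus>\<^bsub>P.Q\<^esub> y) = f x \<oplus>\<^bsub>P'.Q\<^esub> f y"
      using ab by (simp add: f P'.cls_add flip: P.cls_add)
  next
    show "f \<one>\<^bsub>P.Q\<^esub> = \<one>\<^bsub>P'.Q\<^esub>"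
      by (simp add: f P'.cls_one flip: P.cls_one)
  qed
  with f that show ?thesis by blast
qed

section \<open>Monomial matrices\<close>

text \<open>Coordinates are numbered from 1, so that \<open>mono_mat r n \<sigma> k\<close> sends \<open>y\<^sub>b\<close> to \<open>\<zeta>\<^bsup>k b\<^esup> y\<^bsub>\<sigma> b\<^esub>\<close>.\<close>

definition mono_mat :: "nat \<Rightarrow> nat \<Rightarrow> (nat \<Rightarrow> nat) \<Rightarrow> (nat \<Rightarrow> int) \<Rightarrow> complex mat" where
  "mono_mat r n \<sigma> k = mat n n (\<lambda>(a, b). if a + 1 = \<sigma> (b + 1) then zeta r powi k (b + 1) else 0)"

lemma mono_cong:
  assumes "\<And>b. b \<in> {1..n} \<Longrightarrow> \<sigma> b = \<tau> b" "\<And>b. b \<in> {1..n} \<Longrightarrow> k b = l b"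
  shows "mono_mat r n \<sigma> k = mono_mat r n \<tau> l"
  unfolding mono_mat_def by (rule cong_mat) (use assms in auto)

lemma zeta_nonzero [simp]: "zeta r \<noteq> 0"
  by (simp add: zeta_def)

lemma zeta_power: "r \<ge> 1 \<Longrightarrow> zeta r ^ r = 1"
  by (simp add: zeta_def flip: exp_of_nat_mult)

text \<open>Since \<zeta> has order dividing \<open>r\<close>, an integer exponent may be replaced
  by its remainder modulo \<open>r\<close>. \<open>G_r1n\<close> asks for natural exponents, while
  inverses in \<open>mono_mat\<close> produce negative ones.\<close>

lemma zeta_powi_nat:
  assumes "r \<ge> 1"
  shows "\<exists>m::nat. zeta r powi k = zeta r ^ m"
proof
  have "zeta r powi k = zeta r powi (int r * (k div int r) + k mod int r)"
    by simp
  also have "\<dots> = (zeta r ^ r) powi (k div int r) * zeta r powi (k mod int r)"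
    by (subst power_int_add) (auto simp: power_int_mult)
  also have "\<dots> = zeta r powi int (nat (k mod int r))"
    using assms by (simp add: zeta_power)
  also have "\<dots> = zeta r ^ nat (k mod int r)"
    by (simp only: power_int_of_nat)
  finally show "zeta r powi k = zeta r ^ nat (k mod int r)" .
qed

lemma mono_carrier [simp]: "mono_mat r n \<sigma> k \<in> carrier_mat n n"
  and mono_dim [simp]: "dim_row (mono_mat r n \<sigma> k) = n" "dim_col (mono_mat r n \<sigma> k) = n"
  by (simp_all add: mono_mat_def)

lemma mono_entry:
  "i \<in> {1..n} \<Longrightarrow> j \<in> {1..n} \<Longrightarrow>
    mono_mat r n \<sigma> k $$ (i - 1, j - 1) = (if i = \<sigma> j then zeta r powi k j else 0)"
  by (auto simp: mono_mat_def)

lemma permutes_range: "\<sigma> permutes {1..n} \<Longrightarrow> 1 \<le> \<sigma> b \<and> \<sigma> b \<le> n \<longleftrightarrow> 1 \<le> b \<and> b \<le> n"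
  using permutes_in_image[of \<sigma> "{1..n}" b] by simp

lemma mono_mult:
  assumes \<tau>: "\<tau> permutes {1..n}"
  shows "mono_mat r n \<sigma> k * mono_mat r n \<tau> l = mono_mat r n (\<sigma> \<circ> \<tau>) (\<lambda>b. k (\<tau> b) + l b)"
proof (rule eq_matI)
  fix a b assume ab: "a < dim_row (mono_mat r n (\<sigma> \<circ> \<tau>) (\<lambda>b. k (\<tau> b) + l b))"
    "b < dim_col (mono_mat r n (\<sigma> \<circ> \<tau>) (\<lambda>b. k (\<tau> b) + l b))"
  \<comment> \<open>Row \<open>m\<close> holds the only nonzero entry of column \<open>b\<close> of
    the right factor, so the sum over the inner index collapses. The shift by one passes from
    coordinates to matrix indices.\<close>
  define m where "m = \<tau> (Suc b) - 1"
  have m: "\<tau> (Suc b) = Suc m" "m < n"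
    using permutes_range[OF \<tau>, of "Suc b"] ab by (auto simp: m_def)
  have "(mono_mat r n \<sigma> k * mono_mat r n \<tau> l) $$ (a, b) =
      (\<Sum>i<n. mono_mat r n \<sigma> k $$ (a, i) * mono_mat r n \<tau> l $$ (i, b))"
    using ab by (simp add: scalar_prod_def lessThan_atLeast0)
  also have "\<dots> = (\<Sum>i<n. if i = m then mono_mat r n \<sigma> k $$ (a, m) * mono_mat r n \<tau> l $$ (m, b) else 0)"
    by (rule sum.cong) (use ab m in \<open>auto simp: mono_mat_def\<close>)
  also have "\<dots> = mono_mat r n \<sigma> k $$ (a, m) * mono_mat r n \<tau> l $$ (m, b)"
    using m by simp
  also have "\<dots> = mono_mat r n (\<sigma> \<circ> \<tau>) (\<lambda>b. k (\<tau> b) + l b) $$ (a, b)"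
    using ab m by (simp add: mono_mat_def power_int_add)
  finally show "(mono_mat r n \<sigma> k * mono_mat r n \<tau> l) $$ (a, b) = mono_mat r n (\<sigma> \<circ> \<tau>) (\<lambda>b. k (\<tau> b) + l b) $$ (a, b)" .
qed auto

lemma one_mat_mono: "1\<^sub>m n = mono_mat r n id (\<lambda>_. 0)"
  by (rule eq_matI) (auto simp: mono_mat_def)

lemma transp_mat_mono: "transp_mat n i j = mono_mat r n (Transposition.transpose i j) (\<lambda>_. 0)"
  by (rule eq_matI) (auto simp: mono_mat_def transp_mat_def)

lemma zeta_mat_mono: "zeta_mat r n i = mono_mat r n id (\<lambda>b. if b = i then 1 else 0)"
  by (rule eq_matI) (auto simp: mono_mat_def zeta_mat_def)

text \<open>A surjective self-map of a finite set is injective by counting. Extending by the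
  identity gives a permutation in the sense of \<open>permutes\<close>.\<close>

lemma permutesI_mono:
  fixes n :: nat
  assumes "\<And>b. b \<in> {1..n} \<Longrightarrow> f b \<in> {1..n}" "\<And>a. a \<in> {1..n} \<Longrightarrow> \<exists>b\<in>{1..n}. f b = a"
  shows "(\<lambda>b. if b \<in> {1..n} then f b else b) permutes {1..n}"
proof (rule bij_imp_permutes)
  have *: "f ` {1..n} = {1..n}"
  proof (intro equalityI image_subsetI)
    show "{1..n} \<subseteq> f ` {1..n}"
    proof
      fix a assume "a \<in> {1..n}"
      from assms(2)[OF this] show "a \<in> f ` {1..n}" by (auto simp only: image_iff)
    qed
  qed (rule assms(1))
  then have "inj_on f {1..n}" by (intro eq_card_imp_inj_on) simp_all
  with * have "bij_betw f {1..n} {1..n}" by (simp add: bij_betw_def)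
  then show "bij_betw (\<lambda>b. if b \<in> {1..n} then f b else b) {1..n} {1..n}"
    by (rule bij_betw_cong[THEN iffD1, rotated]) simp
qed auto

text \<open>The nonzero entry of each column defines \<sigma>, and the row condition makes \<sigma>
  surjective. Conversely, the row condition for \<open>mono_mat\<close> is bijectivity of
  \<sigma>.\<close>

lemma G_carrier:
  assumes "r \<ge> 1"
  shows "carrier (G_r1n r n) = {mono_mat r n \<sigma> k | \<sigma> k. \<sigma> permutes {1..n}}"
proof (intro equalityI subsetI)
  fix A assume "A \<in> carrier (G_r1n r n)"
  then have A: "A \<in> carrier_mat n n"
    and row: "\<And>a. a < n \<Longrightarrow> \<exists>!b. b < n \<and> A $$ (a, b) \<noteq> 0"
    and col: "\<And>b. b < n \<Longrightarrow> \<exists>!a. a < n \<and> A $$ (a, b) \<noteq> 0"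
    and val: "\<And>a b. a < n \<Longrightarrow> b < n \<Longrightarrow> A $$ (a, b) \<noteq> 0 \<Longrightarrow> \<exists>k::nat. A $$ (a, b) = zeta r ^ k"
    by (auto simp: G_r1n_def)
  define f where "f b = (THE a. a < n \<and> A $$ (a, b) \<noteq> 0)" for b
  have f: "f b < n" "A $$ (f b, b) \<noteq> 0" if "b < n" for b
    using theI'[OF col[OF that]] unfolding f_def by auto
  have f_eq: "a = f b" if "a < n" "b < n" "A $$ (a, b) \<noteq> 0" for a b
    using col[OF that(2)] f[OF that(2)] that by blast
  obtain k where k: "\<And>b. b < n \<Longrightarrow> A $$ (f b, b) = zeta r ^ k b"
    using val[OF f(1) _ f(2)] by metis
  define \<sigma> where "\<sigma> b = (if b \<in> {1..n} then Suc (f (b - 1)) else b)" for b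
  have "\<sigma> permutes {1..n}"
    unfolding \<sigma>_def
  proof (rule permutesI_mono)
    fix b assume "b \<in> {1..n}"
    then have "b - 1 < n" by auto
    from f(1)[OF this] show "Suc (f (b - 1)) \<in> {1..n}" by auto
  next
    fix a assume "a \<in> {1..n}"
    then have "a - 1 < n" by auto
    then obtain b where "b < n" "A $$ (a - 1, b) \<noteq> 0" using row by blast
    with f_eq[of "a - 1" b] \<open>a - 1 < n\<close> \<open>a \<in> {1..n}\<close> show "\<exists>b\<in>{1..n}. Suc (f (b - 1)) = a"
      by (intro bexI[of _ "Suc b"]) auto
  qed
  moreover have "A = mono_mat r n \<sigma> (\<lambda>b. int (k (b - 1)))"
  proof (rule eq_matI)
    fix a b assume "a < dim_row (mono_mat r n \<sigma> (\<lambda>b. int (k (b - 1))))"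
      "b < dim_col (mono_mat r n \<sigma> (\<lambda>b. int (k (b - 1))))"
    then have ab: "a < n" "b < n" by auto
    have "A $$ (a, b) = (if a = f b then zeta r ^ k b else 0)"
      using k[OF ab(2)] f_eq[OF ab] by (cases "a = f b") auto
    then show "A $$ (a, b) = mono_mat r n \<sigma> (\<lambda>b. int (k (b - 1))) $$ (a, b)"
      using ab by (simp add: mono_mat_def \<sigma>_def)
  qed (use A in auto)
  ultimately show "A \<in> {mono_mat r n \<sigma> k | \<sigma> k. \<sigma> permutes {1..n}}" by blast
next
  fix A assume "A \<in> {mono_mat r n \<sigma> k | \<sigma> k. \<sigma> permutes {1..n}}"
  then obtain \<sigma> k where \<sigma>: "\<sigma> permutes {1..n}" and A: "A = mono_mat r n \<sigma> k" by blast
  have entry: "A $$ (a, b) \<noteq> 0 \<longleftrightarrow> Suc a = \<sigma> (Suc b)" if "a < n" "b < n" for a b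
    using that by (simp add: A mono_mat_def)
  have "\<exists>!b. b < n \<and> A $$ (a, b) \<noteq> 0" if "a < n" for a
  proof -
    obtain c where c: "\<sigma> c = Suc a"
      using permutes_surj[OF \<sigma>] by (metis surjD)
    then have "c \<in> {1..n}" using permutes_range[OF \<sigma>, of c] that by simp
    with c obtain b where b: "\<sigma> (Suc b) = Suc a" "b < n"
      by (cases c) auto
    show ?thesis
    proof (intro ex1I[of _ b])
      fix b' assume "b' < n \<and> A $$ (a, b') \<noteq> 0"
      then have "\<sigma> (Suc b') = \<sigma> (Suc b)" using entry that b by auto
      then show "b' = b" using permutes_inj[OF \<sigma>] by (auto dest: injD)
    qed (use entry that b in auto)
  qed
  moreover have "\<exists>!a. a < n \<and> A $$ (a, b) \<noteq> 0" if b: "b < n" for b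
  proof -
    obtain a where a: "\<sigma> (Suc b) = Suc a" "a < n"
      using permutes_range[OF \<sigma>, of "Suc b"] b by (cases "\<sigma> (Suc b)") auto
    show ?thesis
    proof (intro ex1I[of _ a])
      fix a' assume "a' < n \<and> A $$ (a', b) \<noteq> 0"
      then show "a' = a" using entry[of a' b] a that by simp
    qed (use entry[of a b] that a in simp)
  qed
  moreover have "\<exists>m::nat. A $$ (a, b) = zeta r ^ m" if "a < n" "b < n" "A $$ (a, b) \<noteq> 0" for a b
  proof -
    have "A $$ (a, b) = zeta r powi k (Suc b)"
      using that entry[of a b] by (simp add: A mono_mat_def)
    with zeta_powi_nat[OF assms, of "k (Suc b)"] show ?thesis by simp
  qed
  ultimately show "A \<in> carrier (G_r1n r n)"
    by (auto simp: G_r1n_def A)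
qed

lemma mono_in_G [simp]: "r \<ge> 1 \<Longrightarrow> \<sigma> permutes {1..n} \<Longrightarrow> mono_mat r n \<sigma> k \<in> carrier (G_r1n r n)"
  by (auto simp: G_carrier)

lemma G_sel: "monoid.mult (G_r1n r n) = (*)" "one (G_r1n r n) = 1\<^sub>m n"
  by (simp_all add: G_r1n_def)

lemma mono_left_inverse:
  assumes "\<sigma> permutes {1..n}"
  shows "mono_mat r n (Hilbert_Choice.inv \<sigma>) (\<lambda>b. - k (Hilbert_Choice.inv \<sigma> b)) * mono_mat r n \<sigma> k = 1\<^sub>m n"
  unfolding mono_mult[OF assms] one_mat_mono[of n r]
  by (rule mono_cong) (use permutes_inverses[OF assms] in auto)

lemma G_group:
  assumes "r \<ge> 1"
  shows "group (G_r1n r n)"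
proof (rule groupI)
  show "x \<otimes>\<^bsub>G_r1n r n\<^esub> y \<in> carrier (G_r1n r n)"
    if "x \<in> carrier (G_r1n r n)" "y \<in> carrier (G_r1n r n)" for x y
    using that assms by (force simp: G_carrier G_sel mono_mult intro: permutes_compose)
  show "\<one>\<^bsub>G_r1n r n\<^esub> \<in> carrier (G_r1n r n)"
    using assms by (simp add: G_sel one_mat_mono[of n r] permutes_id)
  show "x \<otimes>\<^bsub>G_r1n r n\<^esub> y \<otimes>\<^bsub>G_r1n r n\<^esub> z = x \<otimes>\<^bsub>G_r1n r n\<^esub> (y \<otimes>\<^bsub>G_r1n r n\<^esub> z)"
    if "x \<in> carrier (G_r1n r n)" "y \<in> carrier (G_r1n r n)" "z \<in> carrier (G_r1n r n)" for x y z
    using that by (auto simp: G_r1n_def)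
  show "\<one>\<^bsub>G_r1n r n\<^esub> \<otimes>\<^bsub>G_r1n r n\<^esub> x = x" if "x \<in> carrier (G_r1n r n)" for x
    using that by (auto simp: G_r1n_def)
  show "\<exists>y\<in>carrier (G_r1n r n). y \<otimes>\<^bsub>G_r1n r n\<^esub> x = \<one>\<^bsub>G_r1n r n\<^esub>" if "x \<in> carrier (G_r1n r n)" for x
  proof -
    from that obtain \<sigma> k where "\<sigma> permutes {1..n}" "x = mono_mat r n \<sigma> k" using assms by (auto simp: G_carrier)
    then show ?thesis using assms
      by (intro bexI[of _ "mono_mat r n (Hilbert_Choice.inv \<sigma>) (\<lambda>b. - k (Hilbert_Choice.inv \<sigma> b))"])
         (simp_all add: G_sel mono_left_inverse permutes_inv)
  qed
qed

lemma G_inv: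
  assumes "r \<ge> 1" "\<sigma> permutes {1..n}"
  shows "inv\<^bsub>G_r1n r n\<^esub> mono_mat r n \<sigma> k = mono_mat r n (Hilbert_Choice.inv \<sigma>) (\<lambda>b. - k (Hilbert_Choice.inv \<sigma> b))"
  by (rule group.inv_equality[OF G_group])
     (use assms in \<open>simp_all add: G_sel mono_left_inverse permutes_inv\<close>)

text \<open>Natural powers follow by induction from \<open>mono_mult\<close>; a negative power is by
  definition the inverse of a natural one and is read off from \<open>G_inv\<close>.\<close>

lemma zeta_mat_pow:
  assumes "r \<ge> 1"
  shows "zeta_mat r n i [^]\<^bsub>G_r1n r n\<^esub> (m::int) = mono_mat r n id (\<lambda>b. if b = i then m else 0)"
proof -
  interpret group "G_r1n r n" using assms by (rule G_group)
  have nat: "zeta_mat r n i [^]\<^bsub>G_r1n r n\<^esub> (m::nat) = mono_mat r n id (\<lambda>b. if b = i then int m else 0)" for m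
  proof (induction m)
    case 0
    show ?case by (simp add: G_sel one_mat_mono[of n r]) (rule mono_cong, auto)
  next
    case (Suc m)
    then show ?case
      by (simp add: G_sel zeta_mat_mono mono_mult[OF permutes_id]) (rule mono_cong, auto)
  qed
  show ?thesis
  proof (cases "m < 0")
    case True
    then have "zeta_mat r n i [^]\<^bsub>G_r1n r n\<^esub> m =
        inv\<^bsub>G_r1n r n\<^esub> mono_mat r n id (\<lambda>b. if b = i then int (nat (- m)) else 0)"
      unfolding int_pow_def2[of _ _ m] nat by simp
    also have "\<dots> = mono_mat r n id (\<lambda>b. if b = i then m else 0)"
      unfolding G_inv[OF assms permutes_id] by (rule mono_cong) (use True in auto)
    finally show ?thesis .
  next
    case False
    then have "zeta_mat r n i [^]\<^bsub>G_r1n r n\<^esub> m = mono_mat r n id (\<lambda>b. if b = i then int (nat m) else 0)"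
      unfolding int_pow_def2[of _ _ m] nat by simp
    also have "\<dots> = mono_mat r n id (\<lambda>b. if b = i then m else 0)"
      by (rule mono_cong) (use False in auto)
    finally show ?thesis .
  qed
qed

text \<open>Otherwise the simplifier turns \<open>{1..n}\<close> into \<open>{Suc 0..n}\<close>, to which hypotheses such as
  \<open>\<sigma> permutes {1..n}\<close> no longer apply.\<close>

declare One_nat_def [simp del]

section \<open>Permutations\<close>

text \<open>\<open>cyc n\<close> is the cycle \<open>c = s_1 ... s_(n-1)\<close> of the overview and
  \<open>cyc_inv n\<close> its inverse. The length \<open>m\<close> is kept variable so that the
  product can be built one factor at a time, as in \<open>cyc_Suc\<close>.\<close>

definition cyc :: "nat \<Rightarrow> nat \<Rightarrow> nat" where
  "cyc m i = (if 1 \<le> i \<and> i < m then i + 1 else if i = m then 1 else i)"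

definition cyc_inv :: "nat \<Rightarrow> nat \<Rightarrow> nat" where
  "cyc_inv m i = (if 1 < i \<and> i \<le> m then i - 1 else if i = 1 then m else i)"

lemma cyc_comp_inv [simp]: "m \<ge> 1 \<Longrightarrow> cyc m \<circ> cyc_inv m = id" "m \<ge> 1 \<Longrightarrow> cyc_inv m \<circ> cyc m = id"
  by (auto simp: cyc_def cyc_inv_def fun_eq_iff)

lemma cyc_permutes [simp]: "1 \<le> m \<Longrightarrow> m \<le> n \<Longrightarrow> cyc m permutes {1..n}"
  by (rule bij_imp_permutes, rule bij_betw_byWitness[where f' = "cyc_inv m"])
     (auto simp: cyc_def cyc_inv_def)

lemma cyc_inv_permutes [simp]: "1 \<le> m \<Longrightarrow> m \<le> n \<Longrightarrow> cyc_inv m permutes {1..n}"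
  by (rule bij_imp_permutes, rule bij_betw_byWitness[where f' = "cyc m"])
     (auto simp: cyc_def cyc_inv_def)

lemma cyc_Suc: "m \<ge> 1 \<Longrightarrow> cyc (Suc m) = cyc m \<circ> Transposition.transpose m (m + 1)"
  and cyc_inv_Suc: "m \<ge> 1 \<Longrightarrow> cyc_inv (Suc m) = Transposition.transpose m (m + 1) \<circ> cyc_inv m"
  by (auto simp: cyc_def cyc_inv_def fun_eq_iff Transposition.transpose_def)

lemma comp_transpose:
  "inj f \<Longrightarrow> f \<circ> Transposition.transpose a b = Transposition.transpose (f a) (f b) \<circ> f"
  by (auto simp: fun_eq_iff Transposition.transpose_def dest: injD)

lemma cyc_last: "2 \<le> n \<Longrightarrow> cyc n (n - 1) = n"
  by (auto simp: cyc_def)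

text \<open>These are the permutations behind the relations of \<open>A\<close>: the first two for
  one \<Phi> or \<Psi>, the next two for their squares, the last two for the relation between
  \<open>\<Psi> s_(n-1) \<Phi>\<close> and \<open>\<Phi> s_1 \<Psi>\<close>. All come from carrying
  a transposition through a cycle with \<open>comp_transpose\<close>.\<close>

lemma cyc_transpose:
  shows "2 \<le> i \<Longrightarrow> i + 1 \<le> n \<Longrightarrow>
      cyc_inv n \<circ> Transposition.transpose i (i + 1) = Transposition.transpose (i - 1) i \<circ> cyc_inv n"
    and "1 \<le> i \<Longrightarrow> i + 2 \<le> n \<Longrightarrow>
      cyc n \<circ> Transposition.transpose i (i + 1) = Transposition.transpose (i + 1) (i + 2) \<circ> cyc n"
    and "2 \<le> n \<Longrightarrow> cyc_inv n \<circ> cyc_inv n \<circ> Transposition.transpose 1 2 =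
      Transposition.transpose (n - 1) n \<circ> (cyc_inv n \<circ> cyc_inv n)"
    and "2 \<le> n \<Longrightarrow> cyc n \<circ> cyc n \<circ> Transposition.transpose (n - 1) n =
      Transposition.transpose 1 2 \<circ> (cyc n \<circ> cyc n)"
    and "2 \<le> n \<Longrightarrow> cyc n \<circ> Transposition.transpose (n - 1) n \<circ> cyc_inv n = Transposition.transpose 1 n"
    and "2 \<le> n \<Longrightarrow> cyc_inv n \<circ> Transposition.transpose 1 2 \<circ> cyc n = Transposition.transpose 1 n"
proof -
  have inj: "inj (cyc n)" "inj (cyc_inv n)" if "n \<ge> 1"
    using that permutes_inj[OF cyc_permutes[of n n]] permutes_inj[OF cyc_inv_permutes[of n n]] by auto
  show "cyc_inv n \<circ> Transposition.transpose i (i + 1) = Transposition.transpose (i - 1) i \<circ> cyc_inv n"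
    if "2 \<le> i" "i + 1 \<le> n"
    using comp_transpose[OF inj(2), of i "i + 1"] that by (simp add: cyc_inv_def)
  show "cyc n \<circ> Transposition.transpose i (i + 1) = Transposition.transpose (i + 1) (i + 2) \<circ> cyc n"
    if "1 \<le> i" "i + 2 \<le> n"
  proof -
    have e: "i + 2 = i + 1 + 1" by simp
    show ?thesis
      using comp_transpose[OF inj(1), of i "i + 1"] that unfolding e by (simp add: cyc_def)
  qed
  show "cyc_inv n \<circ> cyc_inv n \<circ> Transposition.transpose 1 2 =
      Transposition.transpose (n - 1) n \<circ> (cyc_inv n \<circ> cyc_inv n)" if "2 \<le> n"
    using comp_transpose[OF inj_compose[OF inj(2) inj(2)], of 1 2] that
    by (cases "n = 2") (simp_all add: cyc_inv_def)
  show "cyc n \<circ> cyc n \<circ> Transposition.transpose (n - 1) n =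
      Transposition.transpose 1 2 \<circ> (cyc n \<circ> cyc n)" if "2 \<le> n"
  proof -
    have "cyc n (n - 1) = n" "cyc n n = 1" "cyc n 1 = 2" using that cyc_last by (auto simp: cyc_def)
    then show ?thesis
      using comp_transpose[OF inj_compose[OF inj(1) inj(1)], of "n - 1" n] that by simp
  qed
  show "cyc n \<circ> Transposition.transpose (n - 1) n \<circ> cyc_inv n = Transposition.transpose 1 n" if "2 \<le> n"
  proof -
    have "cyc n \<circ> Transposition.transpose (n - 1) n = Transposition.transpose n 1 \<circ> cyc n"
      using comp_transpose[OF inj(1), of "n - 1" n] that cyc_last[of n] by (simp add: cyc_def[of n n])
    with that show ?thesis by (simp add: comp_assoc transpose_commute)
  qed
  show "cyc_inv n \<circ> Transposition.transpose 1 2 \<circ> cyc n = Transposition.transpose 1 n" if "2 \<le> n"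
  proof -
    have "cyc_inv n \<circ> Transposition.transpose 1 2 = Transposition.transpose n 1 \<circ> cyc_inv n"
      using comp_transpose[OF inj(2), of 1 2] that by (simp add: cyc_inv_def flip: One_nat_def)
    with that show ?thesis by (simp add: comp_assoc transpose_commute)
  qed
qed

text \<open>Double transitivity of the symmetric group, used to carry one instance of a relation to
  every pair of distinct indices. The first transposition moves \<open>a\<close> to
  \<open>i\<close>; the second corrects the image of \<open>b\<close> and fixes \<open>i\<close>,
  which differs from both points it exchanges.\<close>

lemma ex_permutation_two:
  assumes "a \<in> S" "b \<in> S" "a \<noteq> b" "i \<in> S" "j \<in> S" "i \<noteq> j"
  obtains \<sigma> where "\<sigma> permutes S" "\<sigma> a = i" "\<sigma> b = j"
proof
  let ?\<tau> = "Transposition.transpose a i"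
  have "?\<tau> b \<in> S" using assms by (simp add: Transposition.transpose_def)
  then show "Transposition.transpose (?\<tau> b) j \<circ> ?\<tau> permutes S"
    using assms by (intro permutes_compose permutes_swap_id)
  show "(Transposition.transpose (?\<tau> b) j \<circ> ?\<tau>) a = i" "(Transposition.transpose (?\<tau> b) j \<circ> ?\<tau>) b = j"
    using assms by (auto simp: Transposition.transpose_def)
qed

text \<open>Conjugating \<open>(a b)\<close> by \<open>(b b+1)\<close> gives \<open>(a b+1)\<close>.
  Only adjacent transpositions within the interval from \<open>a\<close> to \<open>b\<close> occur,
  so a point outside it is never moved.\<close>

lemma adjacent_transpositions_induct:
  assumes "a \<le> b"
    and "P id"
    and adj: "\<And>i. a \<le> i \<Longrightarrow> i < b \<Longrightarrow> P (Transposition.transpose i (i + 1))"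
    and comp: "\<And>\<sigma> \<tau>. P \<sigma> \<Longrightarrow> P \<tau> \<Longrightarrow> P (\<sigma> \<circ> \<tau>)"
  shows "P (Transposition.transpose a (b::nat))"
  using assms(1) adj
proof (induction b rule: dec_induct)
  case base
  show ?case using \<open>P id\<close> by (simp add: id_def)
next
  case (step b)
  show ?case
  proof (cases "a = b")
    case True
    then show ?thesis using step.prems[of b] by (simp flip: Suc_eq_plus1)
  next
    case False
    let ?s = "Transposition.transpose b (b + 1)"
    have "P ?s" using step by simp
    moreover have "P (Transposition.transpose a b)" using step by simp
    ultimately have "P (?s \<circ> (Transposition.transpose a b \<circ> ?s))" by (intro comp)
    also have "?s \<circ> (Transposition.transpose a b \<circ> ?s) = Transposition.transpose a (Suc b)"
      using False step.hyps by (auto simp: fun_eq_iff Transposition.transpose_def)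
    finally show ?thesis .
  qed
qed

section \<open>Rings with an action of the monomial group\<close>

text \<open>Both \<open>H\<close> and \<open>A\<close> are instances, so computations with monomial
  matrices are made once. The central elements \<open>\<omega> m\<close> stand for the scalars
  \<zeta> to the power \<open>m\<close>, the elements \<open>g w\<close> for the images of the
  group.\<close>

locale mono_rep = ring T for T (structure) +
  fixes r n :: nat and g :: "complex mat \<Rightarrow> 'a" and \<omega> :: "int \<Rightarrow> 'a"
  assumes r1 [simp]: "r \<ge> 1" and n1 [simp]: "n \<ge> 1"
    and g_closed: "w \<in> carrier (G_r1n r n) \<Longrightarrow> g w \<in> carrier T"
    and g_mult: "v \<in> carrier (G_r1n r n) \<Longrightarrow> w \<in> carrier (G_r1n r n) \<Longrightarrow> g v \<otimes> g w = g (v * w)"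
    and g_one: "g (1\<^sub>m n) = \<one>"
    and \<omega>_closed [simp]: "\<omega> a \<in> carrier T"
    and \<omega>_zero [simp]: "\<omega> 0 = \<one>"
    and \<omega>_add: "\<omega> (a + b) = \<omega> a \<otimes> \<omega> b"
    and \<omega>_central: "x \<in> carrier T \<Longrightarrow> x \<otimes> \<omega> a = \<omega> a \<otimes> x"
begin

definition M :: "(nat \<Rightarrow> nat) \<Rightarrow> (nat \<Rightarrow> int) \<Rightarrow> 'a" where "M \<sigma> k = g (mono_mat r n \<sigma> k)"

definition P :: "(nat \<Rightarrow> nat) \<Rightarrow> 'a" where "P \<sigma> = M \<sigma> (\<lambda>_. 0)"

lemma M_cong: "(\<And>b. b \<in> {1..n} \<Longrightarrow> \<sigma> b = \<tau> b) \<Longrightarrow> (\<And>b. b \<in> {1..n} \<Longrightarrow> k b = l b) \<Longrightarrow> M \<sigma> k = M \<tau> l"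
  unfolding M_def by (metis mono_cong)

lemma M_closed [simp]: "\<sigma> permutes {1..n} \<Longrightarrow> M \<sigma> k \<in> carrier T"
  by (simp add: M_def g_closed)

lemma P_closed [simp]: "\<sigma> permutes {1..n} \<Longrightarrow> P \<sigma> \<in> carrier T"
  by (simp add: P_def)

lemma M_mult: "\<sigma> permutes {1..n} \<Longrightarrow> \<tau> permutes {1..n} \<Longrightarrow> M \<sigma> k \<otimes> M \<tau> l = M (\<sigma> \<circ> \<tau>) (\<lambda>b. k (\<tau> b) + l b)"
  by (simp add: M_def g_mult mono_mult)

lemma M_id [simp]: "M id (\<lambda>_. 0) = \<one>" and P_id [simp]: "P id = \<one>"
  by (simp_all add: P_def M_def g_one flip: one_mat_mono)

lemma P_mult: "\<sigma> permutes {1..n} \<Longrightarrow> \<tau> permutes {1..n} \<Longrightarrow> P \<sigma> \<otimes> P \<tau> = P (\<sigma> \<circ> \<tau>)"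
  by (simp add: P_def M_mult)

lemma P_mult_left:
  "\<sigma> permutes {1..n} \<Longrightarrow> \<tau> permutes {1..n} \<Longrightarrow> x \<in> carrier T \<Longrightarrow> P \<sigma> \<otimes> (P \<tau> \<otimes> x) = P (\<sigma> \<circ> \<tau>) \<otimes> x"
  by (simp add: P_mult flip: m_assoc)

lemma \<omega>_left: "x \<in> carrier T \<Longrightarrow> y \<in> carrier T \<Longrightarrow> x \<otimes> (\<omega> a \<otimes> y) = \<omega> a \<otimes> (x \<otimes> y)"
  by (simp add: \<omega>_central flip: m_assoc)

lemma \<omega>_cancel: "x \<in> carrier T \<Longrightarrow> \<omega> a \<otimes> (\<omega> (- a) \<otimes> x) = x"
  using \<omega>_add[of a "- a", symmetric] by (simp flip: m_assoc)

text \<open>The case \<open>\<epsilon> = - 1\<close> is the action on the \<open>x\<^sub>j\<close>, the case \<open>\<epsilon> = 1\<close> the one on the \<open>y\<^sub>j\<close>.\<close>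

definition act :: "int \<Rightarrow> (nat \<Rightarrow> 'a) \<Rightarrow> bool" where
  "act \<epsilon> X \<longleftrightarrow> (\<forall>j\<in>{1..n}. X j \<in> carrier T \<and>
     (\<forall>\<sigma> k. \<sigma> permutes {1..n} \<longrightarrow> M \<sigma> k \<otimes> X j = \<omega> (\<epsilon> * k j) \<otimes> (X (\<sigma> j) \<otimes> M \<sigma> k)))"

definition spread :: "'a \<Rightarrow> nat \<Rightarrow> nat \<Rightarrow> 'a" where
  "spread E p j = P (Transposition.transpose j p) \<otimes> E \<otimes> P (Transposition.transpose j p)"

lemma spread_base: "E \<in> carrier T \<Longrightarrow> spread E p p = E"
  by (simp add: spread_def)

text \<open>An element that commutes, up to the character \<open>k \<mapsto> \<omega> (\<epsilon> * k p)\<close>, with the monomial matrices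
  stabilizing the line \<open>p\<close> spreads to a family indexed by all the coordinates. Only generators of
  the stabilizer have to be checked; as \<open>p\<close> is an endpoint of \<open>{1..n}\<close>, the adjacent transpositions
  avoiding \<open>p\<close> generate all the permutations fixing \<open>p\<close>.\<close>

context
  fixes E :: 'a and p :: nat and \<epsilon> :: int
  assumes E [simp]: "E \<in> carrier T"
    and p: "p = 1 \<or> p = n"
    and comm_simple: "\<And>i. 1 \<le> i \<Longrightarrow> i < n \<Longrightarrow> i \<noteq> p \<Longrightarrow> i + 1 \<noteq> p \<Longrightarrow>
      P (Transposition.transpose i (i + 1)) \<otimes> E = E \<otimes> P (Transposition.transpose i (i + 1))"
    and comm_zeta: "\<And>i. i \<in> {1..n} \<Longrightarrow> M id (\<lambda>b. if b = i then 1 else 0) \<otimes> E =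
      \<omega> (if i = p then \<epsilon> else 0) \<otimes> (E \<otimes> M id (\<lambda>b. if b = i then 1 else 0))"
begin

text \<open>\<open>m\<close> records the power of \<omega> by which \<open>E\<close> and a monomial
  matrix fail to commute. These exponents add under products, so a check on generators determines
  them on the whole stabilizer.\<close>

definition com :: "(nat \<Rightarrow> nat) \<Rightarrow> (nat \<Rightarrow> int) \<Rightarrow> int \<Rightarrow> bool" where
  "com \<sigma> k m \<longleftrightarrow> M \<sigma> k \<otimes> E = \<omega> m \<otimes> (E \<otimes> M \<sigma> k)"

lemma com_mult:
  assumes "com \<sigma> k a" "com \<tau> l b" and [simp]: "\<sigma> permutes {1..n}" "\<tau> permutes {1..n}"
  shows "com (\<sigma> \<circ> \<tau>) (\<lambda>b. k (\<tau> b) + l b) (a + b)"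
proof -
  have "M \<sigma> k \<otimes> M \<tau> l \<otimes> E = M \<sigma> k \<otimes> (M \<tau> l \<otimes> E)" by (simp add: m_assoc)
  also have "\<dots> = \<omega> b \<otimes> ((M \<sigma> k \<otimes> E) \<otimes> M \<tau> l)"
    using assms(2) by (simp add: com_def \<omega>_left m_assoc)
  also have "\<dots> = \<omega> (a + b) \<otimes> (E \<otimes> (M \<sigma> k \<otimes> M \<tau> l))"
    using assms(1) unfolding add.commute[of a b] by (simp add: com_def m_assoc \<omega>_add)
  finally show ?thesis by (simp add: com_def M_mult)
qed

lemma com_id_zero: "com id (\<lambda>_. 0) 0"
  by (simp add: com_def)

lemma com_diag_add: "com id k a \<Longrightarrow> com id l b \<Longrightarrow> com id (\<lambda>b. k b + l b) (a + b)"
  using com_mult[of id k a id l b] by (simp add: permutes_id)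

lemma com_diag_uminus:
  assumes "com id k a"
  shows "com id (\<lambda>b. - k b) (- a)"
proof -
  let ?z = "M id k" and ?z' = "M id (\<lambda>b. - k b)"
  have z [simp]: "?z \<otimes> ?z' = \<one>" "?z' \<otimes> ?z = \<one>" "?z \<in> carrier T" "?z' \<in> carrier T"
    by (simp_all add: M_mult permutes_id)
  \<comment> \<open>The hypothesis solved for \<open>E \<otimes> ?z\<close>; inserting
    \<open>?z \<otimes> ?z'\<close> to the right of \<open>E\<close> then moves \<open>?z'\<close>
    across.\<close>
  have *: "E \<otimes> ?z = \<omega> (- a) \<otimes> (?z \<otimes> E)"
    using assms \<omega>_cancel[of "E \<otimes> ?z" "- a"] by (simp add: com_def)
  have "?z' \<otimes> E = ?z' \<otimes> (E \<otimes> ?z) \<otimes> ?z'" by (simp add: m_assoc)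
  also have "\<dots> = \<omega> (- a) \<otimes> (?z' \<otimes> ?z \<otimes> (E \<otimes> ?z'))"
    unfolding * by (simp add: \<omega>_left m_assoc del: z(1,2))
  finally show ?thesis by (simp add: com_def)
qed

lemma com_zeta:
  assumes "i \<in> {1..n}"
  shows "com id (\<lambda>b. if b = i then m else 0) (if i = p then \<epsilon> * m else 0)"
proof -
  have nat: "com id (\<lambda>b. if b = i then int m else 0) (if i = p then \<epsilon> * int m else 0)" for m
  proof (induction m)
    case 0
    show ?case using com_id_zero by (simp add: id_def cong: if_cong)
  next
    case (Suc m)
    have "com id (\<lambda>b. if b = i then 1 else 0) (if i = p then \<epsilon> else 0)"
      unfolding com_def by (rule comm_zeta[OF assms])
    from com_diag_add[OF this Suc] have "com id (\<lambda>b. (if b = i then 1 else 0) + (if b = i then int m else 0))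
      ((if i = p then \<epsilon> else 0) + (if i = p then \<epsilon> * int m else 0))" .
    also have "(\<lambda>b. (if b = i then 1 else 0) + (if b = i then int m else 0)) = (\<lambda>b. if b = i then int (Suc m) else 0)"
      by auto
    also have "(if i = p then \<epsilon> else 0) + (if i = p then \<epsilon> * int m else 0) = (if i = p then \<epsilon> * int (Suc m) else 0)"
      by (simp add: algebra_simps)
    finally show ?case .
  qed
  show ?thesis
  proof (cases "m \<ge> 0")
    case True
    then have "int (nat m) = m" by simp
    then show ?thesis using nat[of "nat m"] by (simp only:)
  next
    case False
    have "com id (\<lambda>b. - (if b = i then int (nat (- m)) else 0)) (- (if i = p then \<epsilon> * int (nat (- m)) else 0))"
      using com_diag_uminus[OF nat[of "nat (- m)"]] .
    also have "(\<lambda>b. - (if b = i then int (nat (- m)) else 0)) = (\<lambda>b. if b = i then m else 0)"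
      using False by auto
    also have "- (if i = p then \<epsilon> * int (nat (- m)) else 0) = (if i = p then \<epsilon> * m else 0)"
      using False by auto
    finally show ?thesis .
  qed
qed

text \<open>A diagonal matrix is a product of powers of the \<zeta>-matrices of single coordinates,
  and only coordinate \<open>p\<close> contributes to the exponent. The induction switches on one
  coordinate at a time.\<close>

lemma com_diag: "com id k (\<epsilon> * k p)"
proof -
  have F: "com id (\<lambda>b. if b \<in> F then k b else 0) (if p \<in> F then \<epsilon> * k p else 0)" if "F \<subseteq> {1..n}" for F
  proof -
    have "finite F" using that finite_atLeastAtMost by (rule finite_subset)
    then show ?thesis using that
    proof (induction F)
      case empty
      show ?case using com_id_zero by (simp add: id_def)
    next
      case (insert i F)
      have "com id (\<lambda>b. if b \<in> F then k b else 0) (if p \<in> F then \<epsilon> * k p else 0)"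
        by (rule insert.IH) (use insert.prems in auto)
      from com_diag_add[OF com_zeta[of i "k i"] this] insert.prems
      have "com id (\<lambda>b. (if b = i then k i else 0) + (if b \<in> F then k b else 0))
          ((if i = p then \<epsilon> * k i else 0) + (if p \<in> F then \<epsilon> * k p else 0))"
        by blast
      also have "(\<lambda>b. (if b = i then k i else 0) + (if b \<in> F then k b else 0)) =
          (\<lambda>b. if b \<in> insert i F then k b else 0)"
        using insert.hyps by auto
      also have "(if i = p then \<epsilon> * k i else 0) + (if p \<in> F then \<epsilon> * k p else 0) =
          (if p \<in> insert i F then \<epsilon> * k p else 0)"
        using insert.hyps by auto
      finally show ?case .
    qed
  qed
  have "p \<in> {1..n}" using p n1 by auto
  with F[OF order_refl] have "com id (\<lambda>b. if b \<in> {1..n} then k b else 0) (\<epsilon> * k p)"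
    by (simp only: if_True)
  \<comment> \<open>Exponents at indices outside \<open>{1..n}\<close> leave no trace in the
    matrix.\<close>
  also have "M id (\<lambda>b. if b \<in> {1..n} then k b else 0) = M id k"
    by (rule M_cong) auto
  then have "com id (\<lambda>b. if b \<in> {1..n} then k b else 0) (\<epsilon> * k p) = com id k (\<epsilon> * k p)"
    by (simp add: com_def)
  finally show ?thesis .
qed

lemma com_perm_comp:
  "com \<sigma> (\<lambda>_. 0) 0 \<Longrightarrow> com \<tau> (\<lambda>_. 0) 0 \<Longrightarrow> \<sigma> permutes {1..n} \<Longrightarrow> \<tau> permutes {1..n} \<Longrightarrow>
    com (\<sigma> \<circ> \<tau>) (\<lambda>_. 0) 0"
  using com_mult[of \<sigma> "\<lambda>_. 0" 0 \<tau> "\<lambda>_. 0" 0] by simp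

lemma com_transpose_less:
  assumes "a \<in> {1..n} - {p}" "b \<in> {1..n} - {p}" "a \<le> b"
  shows "com (Transposition.transpose a b) (\<lambda>_. 0) 0"
proof -
  have "com (Transposition.transpose a b) (\<lambda>_. 0) 0 \<and> Transposition.transpose a b permutes {1..n}"
  proof (rule adjacent_transpositions_induct[OF assms(3)])
    show "com id (\<lambda>_. 0) 0 \<and> id permutes {1..n}" using com_id_zero by (simp add: permutes_id)
  next
    fix i assume "a \<le> i" "i < b"
    \<comment> \<open>As \<open>p\<close> is an endpoint of \<open>{1..n}\<close> and differs from
      \<open>a\<close> and \<open>b\<close>, it lies outside the interval between them.\<close>
    with assms p have i: "1 \<le> i" "i < n" "i \<noteq> p" "i + 1 \<noteq> p" by auto
    then have [simp]: "Transposition.transpose i (i + 1) permutes {1..n}"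
      by (intro permutes_swap_id) auto
    show "com (Transposition.transpose i (i + 1)) (\<lambda>_. 0) 0 \<and>
        Transposition.transpose i (i + 1) permutes {1..n}"
      using comm_simple[OF i] by (simp add: com_def P_def)
  qed (blast intro: com_perm_comp permutes_compose)
  then show ?thesis ..
qed

lemma com_perm:
  assumes "\<sigma> permutes {1..n} - {p}"
  shows "com \<sigma> (\<lambda>_. 0) 0"
proof -
  have "finite ({1..n} - {p})" by simp
  with assms show ?thesis
  proof (induction rule: permutes_induct)
    case id
    show ?case by (rule com_id_zero)
  next
    case (swap a b \<sigma>)
    have "com (Transposition.transpose a b) (\<lambda>_. 0) 0"
    proof (cases "a \<le> b")
      case True
      then show ?thesis using com_transpose_less swap by blast
    next
      case False
      then show ?thesis using com_transpose_less[of b a] swap by (simp add: transpose_commute)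
    qed
    moreover have "\<sigma> permutes {1..n}" using swap by (auto intro: permutes_subset)
    ultimately show ?case
      using swap by (intro com_perm_comp permutes_swap_id) auto
  qed
qed

lemma com_stab:
  assumes \<sigma>: "\<sigma> permutes {1..n}" "\<sigma> p = p"
  shows "com \<sigma> k (\<epsilon> * k p)"
proof -
  have "\<sigma> permutes {1..n} - {p}"
    using \<sigma> by (auto simp: permutes_def)
  from com_mult[OF com_perm[OF this] com_diag[of k] \<sigma>(1) permutes_id] show ?thesis by simp
qed

text \<open>Every monomial matrix factors as
  \<open>P (?t (\<sigma> j)) \<otimes> m \<otimes> P (?t j)\<close>, where \<open>m\<close>
  stabilizes the line \<open>p\<close>. The outer factors cancel against those in
  \<open>spread\<close>, and \<open>com_stab\<close> moves \<open>E\<close> past \<open>m\<close>;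
  the exponent of \<open>m\<close> at \<open>p\<close> is \<open>k j\<close>.\<close>

lemma act_spread: "act \<epsilon> (spread E p)"
  unfolding act_def
proof (intro ballI conjI allI impI)
  fix j assume j: "j \<in> {1..n}"
  have pn: "p \<in> {1..n}" using p n1 by auto
  let ?t = "\<lambda>j. Transposition.transpose j p"
  have t [simp]: "?t j permutes {1..n}" if "j \<in> {1..n}" for j
    using that pn by (intro permutes_swap_id)
  show "spread E p j \<in> carrier T" using j by (simp add: spread_def)
  fix \<sigma> k assume \<sigma> [simp]: "\<sigma> permutes {1..n}"
  have \<sigma>j: "\<sigma> j \<in> {1..n}" using j permutes_range[OF \<sigma>] by simp
  define u where "u = ?t (\<sigma> j) \<circ> \<sigma> \<circ> ?t j"
  have u [simp]: "u permutes {1..n}" unfolding u_def using j \<sigma>j \<sigma> t by (intro permutes_compose) auto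
  define m where "m = M u (\<lambda>b. k (?t j b))"
  have m [simp]: "m \<in> carrier T" by (simp add: m_def)
  have M: "M \<sigma> k = P (?t (\<sigma> j)) \<otimes> m \<otimes> P (?t j)"
    unfolding P_def m_def using j \<sigma>j by (simp add: M_mult permutes_compose) (rule M_cong, auto simp: u_def)
  have tt: "P (?t j) \<otimes> (P (?t j) \<otimes> x) = x" if "j \<in> {1..n}" "x \<in> carrier T" for j x
    using that by (simp add: P_mult_left)
  have "u p = p" by (simp add: u_def)
  from com_stab[OF u this, of "\<lambda>b. k (?t j b)"]
  have com: "m \<otimes> E = \<omega> (\<epsilon> * k j) \<otimes> (E \<otimes> m)"
    by (simp add: com_def m_def)
  define q q' where "q = P (?t j)" and "q' = P (?t (\<sigma> j))"
  have q [simp]: "q \<in> carrier T" "q' \<in> carrier T" using j \<sigma>j by (simp_all add: q_def q'_def)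
  have qq: "q \<otimes> (q \<otimes> x) = x" "q' \<otimes> (q' \<otimes> x) = x" if "x \<in> carrier T" for x
    unfolding q_def q'_def using tt that j \<sigma>j by auto
  have "M \<sigma> k \<otimes> spread E p j = q' \<otimes> ((m \<otimes> E) \<otimes> q)"
    unfolding M spread_def q_def[symmetric] q'_def[symmetric] by (simp add: m_assoc qq)
  also have "\<dots> = \<omega> (\<epsilon> * k j) \<otimes> (q' \<otimes> E \<otimes> q' \<otimes> (q' \<otimes> m \<otimes> q))"
    unfolding com by (simp add: m_assoc \<omega>_left qq)
  also have "\<dots> = \<omega> (\<epsilon> * k j) \<otimes> (spread E p (\<sigma> j) \<otimes> M \<sigma> k)"
    unfolding M spread_def q_def[symmetric] q'_def[symmetric] ..
  finally show "M \<sigma> k \<otimes> spread E p j = \<omega> (\<epsilon> * k j) \<otimes> (spread E p (\<sigma> j) \<otimes> M \<sigma> k)" .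
qed

end

abbreviation sw :: "nat \<Rightarrow> nat \<Rightarrow> 'a" where "sw i j \<equiv> P (Transposition.transpose i j)"

definition zt :: "nat \<Rightarrow> int \<Rightarrow> 'a" where "zt i m = M id (\<lambda>b. if b = i then m else 0)"

lemma transpose_permutes [simp]: "i \<in> {1..n} \<Longrightarrow> j \<in> {1..n} \<Longrightarrow> Transposition.transpose i j permutes {1..n}"
  by (rule permutes_swap_id)

lemma id_permutes [simp]: "id permutes {1..n}"
  by (rule permutes_id)

lemma zt_closed [simp]: "zt i m \<in> carrier T"
  by (simp add: zt_def)

lemma zt_perm: "\<sigma> permutes {1..n} \<Longrightarrow> i \<in> {1..n} \<Longrightarrow> zt (\<sigma> i) m \<otimes> P \<sigma> = P \<sigma> \<otimes> zt i m"
  unfolding P_def zt_def by (simp add: M_mult) (rule M_cong, auto dest: injD[OF permutes_inj])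

text \<open>The cycle raises the index of a transposition or of a \<zeta>-matrix by one and the
  hypotheses on \<open>u\<close> lower it again, so \<open>u \<otimes> P (cyc n)\<close> commutes
  with them. Only the wrap-around at \<open>i = n\<close> leaves the factor
  \<open>\<omega> (- 1)\<close>.\<close>

lemma act_of_Phi:
  assumes [simp]: "u \<in> carrier T"
    and s: "\<And>i. 2 \<le> i \<Longrightarrow> i + 1 \<le> n \<Longrightarrow> u \<otimes> sw i (i + 1) = sw (i - 1) i \<otimes> u"
    and z: "\<And>i. i \<in> {1..n} \<Longrightarrow> zt i 1 \<otimes> u = u \<otimes> (if i < n then zt (i + 1) 1 else \<omega> (- 1) \<otimes> zt 1 1)"
  shows "act (- 1) (spread (u \<otimes> P (cyc n)) n)"
proof (rule act_spread)
  fix i assume i: "1 \<le> i" "i < n" "i \<noteq> n" "i + 1 \<noteq> n"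
  have "cyc n \<circ> Transposition.transpose i (i + 1) = Transposition.transpose (i + 1) (i + 2) \<circ> cyc n"
    using i by (intro cyc_transpose(2)) auto
  moreover define q where "q = sw (i + 1) (i + 2)"
  ultimately have q: "q \<otimes> P (cyc n) = P (cyc n) \<otimes> sw i (i + 1)" "q \<in> carrier T"
    using i by (simp_all add: P_mult)
  have "i + 2 = i + 1 + 1" by simp
  then have "sw i (i + 1) \<otimes> u = u \<otimes> q"
    using s[of "i + 1"] i by (simp only: q_def) simp
  with q(2) i have "sw i (i + 1) \<otimes> (u \<otimes> P (cyc n)) = u \<otimes> (q \<otimes> P (cyc n))"
    by (simp flip: m_assoc)
  with q i show "sw i (i + 1) \<otimes> (u \<otimes> P (cyc n)) = u \<otimes> P (cyc n) \<otimes> sw i (i + 1)"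
    by (simp add: m_assoc)
next
  fix i assume i: "i \<in> {1..n}"
  have "zt i 1 \<otimes> (u \<otimes> P (cyc n)) = \<omega> (if i = n then - 1 else 0) \<otimes> (u \<otimes> P (cyc n) \<otimes> zt i 1)"
  proof (cases "i = n")
    case True
    have "zt n 1 \<otimes> (u \<otimes> P (cyc n)) = u \<otimes> (\<omega> (- 1) \<otimes> zt 1 1) \<otimes> P (cyc n)"
      using z[of n] by (simp flip: m_assoc)
    also have "\<dots> = \<omega> (- 1) \<otimes> (u \<otimes> (zt 1 1 \<otimes> P (cyc n)))"
      by (simp add: m_assoc \<omega>_left)
    also have "zt 1 1 \<otimes> P (cyc n) = P (cyc n) \<otimes> zt n 1"
      using zt_perm[of "cyc n" n 1] by (simp add: cyc_def)
    finally show ?thesis using True by (simp add: m_assoc)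
  next
    case False
    then have "zt i 1 \<otimes> (u \<otimes> P (cyc n)) = u \<otimes> (zt (i + 1) 1 \<otimes> P (cyc n))"
      using z[OF i] i by (simp add: m_assoc[symmetric])
    also have "zt (i + 1) 1 \<otimes> P (cyc n) = P (cyc n) \<otimes> zt i 1"
      using zt_perm[of "cyc n" i 1] i False by (simp add: cyc_def)
    finally show ?thesis using False i by (simp add: m_assoc)
  qed
  then show "M id (\<lambda>b. if b = i then 1 else 0) \<otimes> (u \<otimes> P (cyc n)) =
      \<omega> (if i = n then - 1 else 0) \<otimes> (u \<otimes> P (cyc n) \<otimes> M id (\<lambda>b. if b = i then 1 else 0))"
    unfolding zt_def .
qed simp_all

text \<open>The mirror image of \<open>act_of_Phi\<close>: now the wrap-around occurs at
  \<open>i = 1\<close> and leaves \<open>\<omega> 1\<close>.\<close>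

lemma act_of_Psi:
  assumes [simp]: "u \<in> carrier T"
    and s: "\<And>i. 1 \<le> i \<Longrightarrow> i + 2 \<le> n \<Longrightarrow> u \<otimes> sw i (i + 1) = sw (i + 1) (i + 2) \<otimes> u"
    and z: "\<And>i. i \<in> {1..n} \<Longrightarrow> zt i 1 \<otimes> u = u \<otimes> (if 1 < i then zt (i - 1) 1 else \<omega> 1 \<otimes> zt n 1)"
  shows "act 1 (spread (u \<otimes> P (cyc_inv n)) 1)"
proof (rule act_spread)
  fix i assume "1 \<le> i" "i < n" "i \<noteq> 1" "i + 1 \<noteq> 1"
  then have i: "2 \<le> i" "i < n" "1 \<le> i - 1" "i - 1 \<le> n" by auto
  have "cyc_inv n \<circ> Transposition.transpose i (i + 1) = Transposition.transpose (i - 1) i \<circ> cyc_inv n"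
    using i by (intro cyc_transpose(1)) auto
  moreover define q where "q = sw (i - 1) i"
  ultimately have q: "q \<otimes> P (cyc_inv n) = P (cyc_inv n) \<otimes> sw i (i + 1)" "q \<in> carrier T"
    using i by (simp_all add: P_mult)
  have "i - 1 + 1 = i" "i - 1 + 2 = i + 1" using i by auto
  then have "sw i (i + 1) \<otimes> u = u \<otimes> q"
    using s[of "i - 1"] i by (simp only: q_def)
  with q(2) i have "sw i (i + 1) \<otimes> (u \<otimes> P (cyc_inv n)) = u \<otimes> (q \<otimes> P (cyc_inv n))"
    by (simp flip: m_assoc)
  with q i show "sw i (i + 1) \<otimes> (u \<otimes> P (cyc_inv n)) = u \<otimes> P (cyc_inv n) \<otimes> sw i (i + 1)"
    by (simp add: m_assoc)
next
  fix i assume i: "i \<in> {1..n}"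
  have "zt i 1 \<otimes> (u \<otimes> P (cyc_inv n)) = \<omega> (if i = 1 then 1 else 0) \<otimes> (u \<otimes> P (cyc_inv n) \<otimes> zt i 1)"
  proof (cases "i = 1")
    case True
    have "zt 1 1 \<otimes> (u \<otimes> P (cyc_inv n)) = u \<otimes> (\<omega> 1 \<otimes> zt n 1) \<otimes> P (cyc_inv n)"
      using z[of 1] by (simp flip: m_assoc)
    also have "\<dots> = \<omega> 1 \<otimes> (u \<otimes> (zt n 1 \<otimes> P (cyc_inv n)))"
      by (simp add: m_assoc \<omega>_left)
    also have "zt n 1 \<otimes> P (cyc_inv n) = P (cyc_inv n) \<otimes> zt 1 1"
      using zt_perm[of "cyc_inv n" 1 1] by (simp add: cyc_inv_def)
    finally show ?thesis using True by (simp add: m_assoc)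
  next
    case False
    then have "zt i 1 \<otimes> (u \<otimes> P (cyc_inv n)) = u \<otimes> (zt (i - 1) 1 \<otimes> P (cyc_inv n))"
      using z[OF i] i by (simp add: m_assoc[symmetric])
    also have "zt (i - 1) 1 \<otimes> P (cyc_inv n) = P (cyc_inv n) \<otimes> zt i 1"
      using zt_perm[of "cyc_inv n" i 1] i False by (simp add: cyc_inv_def)
    finally show ?thesis using False i by (simp add: m_assoc)
  qed
  then show "M id (\<lambda>b. if b = i then 1 else 0) \<otimes> (u \<otimes> P (cyc_inv n)) =
      \<omega> (if i = 1 then 1 else 0) \<otimes> (u \<otimes> P (cyc_inv n) \<otimes> M id (\<lambda>b. if b = i then 1 else 0))"
    unfolding zt_def .
qed simp_all

end

section \<open>Equivariant families \<open>X\<close>, \<open>Y\<close> and the elements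
  \<open>phi\<close>, \<open>psi\<close>\<close>

locale mono_act = mono_rep +
  fixes X Y :: "nat \<Rightarrow> 'a"
  assumes act_X: "act (- 1) X" and act_Y: "act 1 Y"
begin

lemma X_closed [simp]: "j \<in> {1..n} \<Longrightarrow> X j \<in> carrier T"
  and Y_closed [simp]: "j \<in> {1..n} \<Longrightarrow> Y j \<in> carrier T"
  using act_X act_Y by (auto simp: act_def)

lemma M_X: "j \<in> {1..n} \<Longrightarrow> \<sigma> permutes {1..n} \<Longrightarrow> M \<sigma> k \<otimes> X j = \<omega> (- k j) \<otimes> (X (\<sigma> j) \<otimes> M \<sigma> k)"
  and M_Y: "j \<in> {1..n} \<Longrightarrow> \<sigma> permutes {1..n} \<Longrightarrow> M \<sigma> k \<otimes> Y j = \<omega> (k j) \<otimes> (Y (\<sigma> j) \<otimes> M \<sigma> k)"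
  using act_X act_Y by (auto simp: act_def)

lemma perm_range [simp]: "\<sigma> permutes {1..n} \<Longrightarrow> j \<in> {1..n} \<Longrightarrow> \<sigma> j \<in> {1..n}"
  using permutes_in_image[of \<sigma> "{1..n}" j] by simp

lemma P_X: "j \<in> {1..n} \<Longrightarrow> \<sigma> permutes {1..n} \<Longrightarrow> P \<sigma> \<otimes> X j = X (\<sigma> j) \<otimes> P \<sigma>"
  and P_Y: "j \<in> {1..n} \<Longrightarrow> \<sigma> permutes {1..n} \<Longrightarrow> P \<sigma> \<otimes> Y j = Y (\<sigma> j) \<otimes> P \<sigma>"
  unfolding P_def by (simp_all add: M_X M_Y del: atLeastAtMost_iff)

lemma P_X_left: "j \<in> {1..n} \<Longrightarrow> \<sigma> permutes {1..n} \<Longrightarrow> x \<in> carrier T \<Longrightarrow> P \<sigma> \<otimes> (X j \<otimes> x) = X (\<sigma> j) \<otimes> (P \<sigma> \<otimes> x)"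
  and P_Y_left: "j \<in> {1..n} \<Longrightarrow> \<sigma> permutes {1..n} \<Longrightarrow> x \<in> carrier T \<Longrightarrow> P \<sigma> \<otimes> (Y j \<otimes> x) = Y (\<sigma> j) \<otimes> (P \<sigma> \<otimes> x)"
  by (simp_all add: P_X P_Y del: atLeastAtMost_iff flip: m_assoc)

lemmas P_move = P_X P_Y P_X_left P_Y_left P_mult P_mult_left m_assoc

text \<open>In \<open>H\<close> these are the prescribed images of \<Phi> and \<Psi>; in
  \<open>A\<close> they turn out to be \<Phi> and \<Psi> themselves, see
  \<open>A_phi\<close>.\<close>

definition phi :: 'a where "phi = X n \<otimes> P (cyc_inv n)"
definition psi :: 'a where "psi = Y 1 \<otimes> P (cyc n)"

lemma phi_closed [simp]: "phi \<in> carrier T" and psi_closed [simp]: "psi \<in> carrier T"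
  by (simp_all add: phi_def psi_def)

lemma P_cancel:
  assumes "\<sigma> permutes {1..n}" "x \<in> carrier T" "y \<in> carrier T"
  shows "x \<otimes> P \<sigma> = y \<otimes> P \<sigma> \<longleftrightarrow> x = y"
proof
  assume *: "x \<otimes> P \<sigma> = y \<otimes> P \<sigma>"
  have "P \<sigma> \<otimes> P (Hilbert_Choice.inv \<sigma>) = \<one>"
    using assms by (simp add: P_mult permutes_inv permutes_inv_o)
  with arg_cong[OF *, of "\<lambda>z. z \<otimes> P (Hilbert_Choice.inv \<sigma>)"] assms show "x = y"
    by (simp add: m_assoc permutes_inv)
qed simp

lemma phi_simple:
  assumes "2 \<le> i" "i + 1 \<le> n"
  shows "phi \<otimes> sw i (i + 1) = sw (i - 1) i \<otimes> phi"
proof -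
  have [simp]: "1 \<le> i - 1" "i - 1 \<le> n" "Transposition.transpose (i - 1) i n = n"
    using assms by (auto simp: Transposition.transpose_def)
  show ?thesis
    unfolding phi_def using assms cyc_transpose(1)[OF assms] by (simp add: P_move)
qed

lemma psi_simple:
  assumes "1 \<le> i" "i + 2 \<le> n"
  shows "psi \<otimes> sw i (i + 1) = sw (i + 1) (i + 2) \<otimes> psi"
proof -
  have [simp]: "Transposition.transpose (i + 1) (i + 2) 1 = 1"
    using assms by (auto simp: Transposition.transpose_def)
  show ?thesis
    unfolding psi_def using assms cyc_transpose(2)[OF assms] by (simp add: P_move)
qed

text \<open>Moving permutations to the right turns the two sides into
  \<open>X n \<otimes> X (n - 1)\<close> and \<open>X (n - 1) \<otimes> X n\<close>, followed by the
  same permutation. The equivalence is read from right to left in \<open>H\<close> and from left to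
  right in \<open>A\<close>.\<close>

lemma phi_sq:
  assumes n: "2 \<le> n"
  shows "phi \<otimes> phi \<otimes> sw 1 2 = sw (n - 1) n \<otimes> (phi \<otimes> phi) \<longleftrightarrow> X n \<otimes> X (n - 1) = X (n - 1) \<otimes> X n"
proof -
  let ?p = "cyc_inv n \<circ> cyc_inv n \<circ> Transposition.transpose 1 2"
  have c: "cyc_inv n n = n - 1" using n by (simp add: cyc_inv_def)
  have p: "?p permutes {1..n}" using n by (intro permutes_compose) auto
  have "phi \<otimes> phi \<otimes> sw 1 2 = X n \<otimes> X (n - 1) \<otimes> P ?p"
    unfolding phi_def using n by (simp add: P_move c permutes_compose)
  moreover have "sw (n - 1) n \<otimes> (phi \<otimes> phi) = X (n - 1) \<otimes> X n \<otimes> P ?p"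
    unfolding phi_def cyc_transpose(3)[OF n] using n by (simp add: P_move c permutes_compose)
  ultimately show ?thesis using P_cancel[OF p] n by simp
qed

lemma psi_sq:
  assumes n: "2 \<le> n"
  shows "psi \<otimes> psi \<otimes> sw (n - 1) n = sw 1 2 \<otimes> (psi \<otimes> psi) \<longleftrightarrow> Y 1 \<otimes> Y 2 = Y 2 \<otimes> Y 1"
proof -
  let ?p = "cyc n \<circ> cyc n \<circ> Transposition.transpose (n - 1) n"
  have c: "cyc n 1 = 2" using n by (simp add: cyc_def)
  have p: "?p permutes {1..n}" using n by (intro permutes_compose) auto
  have "psi \<otimes> psi \<otimes> sw (n - 1) n = Y 1 \<otimes> Y 2 \<otimes> P ?p"
    unfolding psi_def using n by (simp add: P_move c permutes_compose)
  moreover have "sw 1 2 \<otimes> (psi \<otimes> psi) = Y 2 \<otimes> Y 1 \<otimes> P ?p"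
    unfolding psi_def cyc_transpose(4)[OF n] using n by (simp add: P_move c permutes_compose)
  ultimately show ?thesis using P_cancel[OF p] n by simp
qed

lemma zeta_phi:
  assumes i: "i \<in> {1..n}"
  shows "zt i 1 \<otimes> phi = phi \<otimes> (if i < n then zt (i + 1) 1 else \<omega> (- 1) \<otimes> zt 1 1)"
proof -
  \<comment> \<open>The index that \<open>cyc_inv n\<close> sends to \<open>i\<close>; it wraps
    around to 1 when \<open>i = n\<close>, where moving past \<open>X n\<close> also produces
    \<open>\<omega> (- 1)\<close>.\<close>
  define j where "j = (if i < n then i + 1 else 1)"
  have "cyc_inv n j = i" "j \<in> {1..n}" using i by (auto simp: j_def cyc_inv_def)
  with zt_perm[of "cyc_inv n" j 1] have j: "zt i 1 \<otimes> P (cyc_inv n) = P (cyc_inv n) \<otimes> zt j 1" by simp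
  have "zt i 1 \<otimes> phi = \<omega> (if i < n then 0 else - 1) \<otimes> (X n \<otimes> (zt i 1 \<otimes> P (cyc_inv n)))"
    using M_X[of n id "\<lambda>b. if b = i then 1 else 0", folded zt_def] i unfolding phi_def
    by (simp flip: m_assoc)
  also have "\<dots> = phi \<otimes> (\<omega> (if i < n then 0 else - 1) \<otimes> zt j 1)"
    unfolding j phi_def using \<open>j \<in> {1..n}\<close> by (simp add: m_assoc \<omega>_left)
  finally show ?thesis using \<open>j \<in> {1..n}\<close> by (simp add: j_def)
qed

lemma zeta_psi:
  assumes i: "i \<in> {1..n}"
  shows "zt i 1 \<otimes> psi = psi \<otimes> (if 1 < i then zt (i - 1) 1 else \<omega> 1 \<otimes> zt n 1)"
proof -
  define j where "j = (if 1 < i then i - 1 else n)"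
  have "cyc n j = i" "j \<in> {1..n}" using i by (auto simp: j_def cyc_def)
  with zt_perm[of "cyc n" j 1] have j: "zt i 1 \<otimes> P (cyc n) = P (cyc n) \<otimes> zt j 1" by simp
  have "zt i 1 \<otimes> psi = \<omega> (if 1 < i then 0 else 1) \<otimes> (Y 1 \<otimes> (zt i 1 \<otimes> P (cyc n)))"
    using M_Y[of 1 id "\<lambda>b. if b = i then 1 else 0", folded zt_def] i unfolding psi_def
    by (simp flip: m_assoc)
  also have "\<dots> = psi \<otimes> (\<omega> (if 1 < i then 0 else 1) \<otimes> zt j 1)"
    unfolding j psi_def using \<open>j \<in> {1..n}\<close> by (simp add: m_assoc \<omega>_left)
  finally show ?thesis using \<open>j \<in> {1..n}\<close> by (simp add: j_def)
qed

lemma cyc_values: "cyc n n = 1" "cyc_inv n 1 = n" "2 \<le> n \<Longrightarrow> cyc_inv n 2 = 1"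
  by (auto simp: cyc_def cyc_inv_def)

lemma psi_phi: "psi \<otimes> phi = Y 1 \<otimes> X 1"
  unfolding psi_def phi_def by (simp add: P_move cyc_values cyc_last)

lemma phi_psi: "phi \<otimes> psi = X n \<otimes> Y n"
  unfolding psi_def phi_def by (simp add: P_move cyc_values cyc_last)

text \<open>The transposition takes \<open>X n\<close> to \<open>X (n - 1)\<close> and the cycle
  takes it back to \<open>X n\<close>; the remaining permutations combine to the transposition of 1
  and \<open>n\<close>.\<close>

lemma psi_s_phi: "2 \<le> n \<Longrightarrow> psi \<otimes> sw (n - 1) n \<otimes> phi = Y 1 \<otimes> X n \<otimes> sw 1 n"
  using cyc_transpose(5)[of n] unfolding psi_def phi_def
  by (simp add: P_move cyc_values cyc_last permutes_compose comp_assoc)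

lemma phi_s_psi: "2 \<le> n \<Longrightarrow> phi \<otimes> sw 1 2 \<otimes> psi = X n \<otimes> Y 1 \<otimes> sw 1 n"
  using cyc_transpose(6)[of n] unfolding psi_def phi_def
  by (simp add: P_move cyc_values cyc_last permutes_compose comp_assoc)

lemma X_commute_all:
  assumes "2 \<le> n \<Longrightarrow> X n \<otimes> X (n - 1) = X (n - 1) \<otimes> X n" and ij: "i \<in> {1..n}" "j \<in> {1..n}"
  shows "X i \<otimes> X j = X j \<otimes> X i"
proof (cases "i = j")
  case False
  with ij have n: "2 \<le> n" by auto
  obtain \<sigma> where \<sigma>: "\<sigma> permutes {1..n}" "\<sigma> n = i" "\<sigma> (n - 1) = j"
    by (rule ex_permutation_two[of n "{1..n}" "n - 1" i j]) (use n ij False in auto)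
  have "P \<sigma> \<otimes> (X n \<otimes> X (n - 1)) = P \<sigma> \<otimes> (X (n - 1) \<otimes> X n)"
    using assms(1)[OF n] by simp
  then have "X i \<otimes> X j \<otimes> P \<sigma> = X j \<otimes> X i \<otimes> P \<sigma>"
    using n ij \<sigma> by (simp add: P_move)
  then show ?thesis using P_cancel[OF \<sigma>(1)] ij by simp
qed simp

lemma Y_commute_all:
  assumes "2 \<le> n \<Longrightarrow> Y 1 \<otimes> Y 2 = Y 2 \<otimes> Y 1" and ij: "i \<in> {1..n}" "j \<in> {1..n}"
  shows "Y i \<otimes> Y j = Y j \<otimes> Y i"
proof (cases "i = j")
  case False
  with ij have n: "2 \<le> n" by auto
  obtain \<sigma> where \<sigma>: "\<sigma> permutes {1..n}" "\<sigma> 1 = i" "\<sigma> 2 = j"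
    by (rule ex_permutation_two[of 1 "{1..n}" 2 i j]) (use n ij False in auto)
  have "P \<sigma> \<otimes> (Y 1 \<otimes> Y 2) = P \<sigma> \<otimes> (Y 2 \<otimes> Y 1)"
    using assms(1)[OF n] by simp
  then have "Y i \<otimes> Y j \<otimes> P \<sigma> = Y j \<otimes> Y i \<otimes> P \<sigma>"
    using n ij \<sigma> by (simp add: P_move)
  then show ?thesis using P_cancel[OF \<sigma>(1)] ij by simp
qed simp

text \<open>Conjugation by \<sigma> carries a commutation relation from one pair of indices to
  another, provided the correction term is carried along from \<open>D\<close> to
  \<open>D'\<close>.\<close>

lemma YX_conj:
  assumes \<sigma>: "\<sigma> permutes {1..n}" and ab: "a \<in> {1..n}" "b \<in> {1..n}"
    and [simp]: "D \<in> carrier T" "D' \<in> carrier T" and D: "P \<sigma> \<otimes> D = D' \<otimes> P \<sigma>"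
    and YX: "Y a \<otimes> X b = X b \<otimes> Y a \<oplus> D"
  shows "Y (\<sigma> a) \<otimes> X (\<sigma> b) = X (\<sigma> b) \<otimes> Y (\<sigma> a) \<oplus> D'"
proof -
  have \<sigma>ab: "\<sigma> a \<in> {1..n}" "\<sigma> b \<in> {1..n}" using perm_range[OF \<sigma>] ab by auto
  have "P \<sigma> \<otimes> (Y a \<otimes> X b) = P \<sigma> \<otimes> (X b \<otimes> Y a \<oplus> D)" using YX by simp
  then have "Y (\<sigma> a) \<otimes> X (\<sigma> b) \<otimes> P \<sigma> = (X (\<sigma> b) \<otimes> Y (\<sigma> a) \<oplus> D') \<otimes> P \<sigma>"
    using ab \<sigma> \<sigma>ab D by (simp add: P_move r_distr l_distr)
  then show ?thesis using P_cancel[OF \<sigma>] \<sigma>ab by simp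
qed

end

section \<open>The Cherednik algebra\<close>

lemma cst_simps: "cst 0 = 0" "cst 1 = 1" "cst (a * b) = cst a * cst b"
  by (simp_all add: cst_def mult_single)

locale cherednik_params =
  fixes r n :: nat
  assumes r1 [simp]: "r \<ge> 1" and n1 [simp]: "n \<ge> 1"
begin

abbreviation R where "R \<equiv> param_ring r"
abbreviation G where "G \<equiv> G_r1n r n"

sublocale scalar_ring R
proof
  show "1 \<in> R" by (auto simp: param_ring_def)
  show "- a \<in> R" if "a \<in> R" for a
    using that by (auto simp: param_ring_def in_keys_iff)
  show "a + b \<in> R" if "a \<in> R" "b \<in> R" for a b
    using that keys_add[of a b] by (auto simp: param_ring_def)
  show "a * b \<in> R" if "a \<in> R" "b \<in> R" for a b
  proof -
    have "Poly_Mapping.keys m \<subseteq> {..<r}" if m: "m \<in> Poly_Mapping.keys (a * b)" for m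
    proof -
      obtain u v where "u \<in> Poly_Mapping.keys a" "v \<in> Poly_Mapping.keys b" "m = u + v"
        using keys_mult[of a b] m by blast
      then show ?thesis
        using \<open>a \<in> R\<close> \<open>b \<in> R\<close> keys_add[of u v] by (fastforce simp: param_ring_def)
    qed
    then show ?thesis by (auto simp: param_ring_def)
  qed
qed

lemma sum_mem: "(\<And>a. a \<in> A \<Longrightarrow> f a \<in> R) \<Longrightarrow> sum f A \<in> R"
  by (induction A rule: infinite_finite_induct) auto

lemma cst_mem [simp]: "cst a \<in> R"
  by (auto simp: cst_def param_ring_def)

lemma indet_mem: "i < r \<Longrightarrow> indet i \<in> R"
  by (auto simp: indet_def param_ring_def)

lemma c0_mem [simp]: "c0 \<in> R"
  using r1 unfolding c0_def by (intro indet_mem) linarith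

lemma dpar_mem [simp]: "dpar r j \<in> R"
proof -
  have "nat (j mod int r) < r"
    using r1 pos_mod_bound[of "int r" j] pos_mod_sign[of "int r" j] by linarith
  then show ?thesis
    unfolding dpar_def Let_def by (auto intro!: indet_mem sum_mem uminus_mem)
qed

abbreviation gens where "gens \<equiv> cher_gens r n"

lemma xel_mem [simp]: "i \<in> {1..n} \<Longrightarrow> xel i \<in> F gens"
  and yel_mem [simp]: "i \<in> {1..n} \<Longrightarrow> yel i \<in> F gens"
  and grp_mem [simp]: "w \<in> carrier G \<Longrightarrow> grp w \<in> F gens"
  by (auto simp: xel_def yel_def grp_def cher_gens_def intro!: F_gen)

text \<open>Expressions in group elements alone. The correction terms of the commutation relations
  lie here, their classes belong to \<open>H_gr\<close>, and \<open>Ac_colift_B\<close> evaluates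
  the inverse map on them.\<close>

abbreviation B where "B \<equiv> F (Wgen ` carrier G)"

lemma B_subset: "B \<subseteq> F gens"
  by (rule F_mono) (auto simp: cher_gens_def)

lemma B_mem: "b \<in> B \<Longrightarrow> b \<in> F gens"
  using B_subset by blast

lemma grp_B [simp]: "w \<in> carrier G \<Longrightarrow> grp w \<in> B"
  by (auto simp: grp_def intro!: F_gen)

lemma zpow_mono: "zpow r n i k = grp (mono_mat r n id (\<lambda>b. if b = i then k else 0))"
  by (simp add: zpow_def zeta_mat_pow)

lemma transpn_mono: "transpn n i j = grp (mono_mat r n (Transposition.transpose i j) (\<lambda>_. 0))"
  by (simp add: transpn_def transp_mat_mono[of n i j r])

lemma zpow_B [simp]: "zpow r n i k \<in> B"
  unfolding zpow_mono by (intro grp_B mono_in_G permutes_id) simp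

lemma transpn_B [simp]: "i \<in> {1..n} \<Longrightarrow> j \<in> {1..n} \<Longrightarrow> transpn n i j \<in> B"
  unfolding transpn_mono by (intro grp_B mono_in_G permutes_swap_id) simp_all

lemma simple_B [simp]: "1 \<le> i \<Longrightarrow> i < n \<Longrightarrow> simple n i \<in> B"
  unfolding simple_def by (rule transpn_B) auto

lemma eps_B [simp]: "eps r n i j \<in> B"
  unfolding eps_def by (auto intro!: F_mult F_sum)

definition reflection :: "nat \<Rightarrow> nat \<Rightarrow> nat \<Rightarrow> cher_free" where
  "reflection i j l = zpow r n i (int l) * transpn n i j * zpow r n i (- int l)"

lemma refl_B [simp]: "i \<in> {1..n} \<Longrightarrow> j \<in> {1..n} \<Longrightarrow> reflection i j l \<in> B"
  unfolding reflection_def by (auto intro!: F_mult)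

definition refl_sum :: "nat \<Rightarrow> cher_free" where
  "refl_sum i = (\<Sum>j\<in>{1..n} - {i}. \<Sum>l<r. reflection i j l)"

definition refl_twist :: "nat \<Rightarrow> nat \<Rightarrow> cher_free" where
  "refl_twist i j = (\<Sum>l<r. scal (cst (zeta r powi (- int l))) * reflection i j l)"

definition eps_sum :: "nat \<Rightarrow> cher_free" where
  "eps_sum i = (\<Sum>l<r. scal (dpar r (int l) - dpar r (int l - 1)) * eps r n i l)"

lemma refl_sum_B [simp]: "i \<in> {1..n} \<Longrightarrow> refl_sum i \<in> B"
  and refl_twist_B [simp]: "i \<in> {1..n} \<Longrightarrow> j \<in> {1..n} \<Longrightarrow> refl_twist i j \<in> B"
  and eps_sum_B [simp]: "eps_sum i \<in> B"
  unfolding refl_sum_def refl_twist_def eps_sum_def by (auto intro!: F_mult F_sum refl_B)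

lemma phi_sum_B [simp]: "i \<in> {1..n} \<Longrightarrow> phi_sum r n i \<in> B"
  unfolding phi_sum_def reflection_def[symmetric] by (auto intro!: F_sum refl_B)

lemmas B_F [simp] = zpow_B[THEN B_mem] transpn_B[THEN B_mem] simple_B[THEN B_mem]
  eps_B[THEN B_mem] refl_B[THEN B_mem] refl_sum_B[THEN B_mem] refl_twist_B[THEN B_mem]
  eps_sum_B[THEN B_mem] phi_sum_B[THEN B_mem]

lemma yx_same':
  "i \<in> {1..n} \<Longrightarrow> (yel i * xel i, xel i * yel i + 1 - scal c0 * refl_sum i - eps_sum i) \<in> cher_rels r n"
  unfolding refl_sum_def eps_sum_def reflection_def by (rule cher_rels.yx_same)

lemma yx_diff':
  "i \<in> {1..n} \<Longrightarrow> j \<in> {1..n} \<Longrightarrow> i \<noteq> j \<Longrightarrow>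
    (yel i * xel j, xel j * yel i + scal c0 * refl_twist i j) \<in> cher_rels r n"
  unfolding refl_twist_def reflection_def by (rule cher_rels.yx_diff)

lemma cher_rels_cases:
  assumes "(a, b) \<in> cher_rels r n"
  obtains i j where "i \<in> {1..n}" "j \<in> {1..n}" "a = xel i * xel j" "b = xel j * xel i"
  | i j where "i \<in> {1..n}" "j \<in> {1..n}" "a = yel i * yel j" "b = yel j * yel i"
  | "a = grp \<one>\<^bsub>G\<^esub>" "b = 1"
  | v w where "v \<in> carrier G" "w \<in> carrier G" "a = grp v * grp w" "b = grp (v \<otimes>\<^bsub>G\<^esub> w)"
  | w j where "w \<in> carrier G" "j \<in> {1..n}" "a = grp w * xel j * grp (inv\<^bsub>G\<^esub> w)"
      "b = (\<Sum>k=1..n. scal (cst ((inv\<^bsub>G\<^esub> w) $$ (j - 1, k - 1))) * xel k)"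
  | w j where "w \<in> carrier G" "j \<in> {1..n}" "a = grp w * yel j * grp (inv\<^bsub>G\<^esub> w)"
      "b = (\<Sum>k=1..n. scal (cst (w $$ (k - 1, j - 1))) * yel k)"
  | i where "i \<in> {1..n}" "a = yel i * xel i" "b = xel i * yel i + 1 - scal c0 * refl_sum i - eps_sum i"
  | i j where "i \<in> {1..n}" "j \<in> {1..n}" "i \<noteq> j" "a = yel i * xel j"
      "b = xel j * yel i + scal c0 * refl_twist i j"
  using assms unfolding refl_sum_def refl_twist_def eps_sum_def reflection_def
  by (cases rule: cher_rels.cases) blast+

sublocale group G
  by (rule G_group) simp

lemma cher_presentation: "presentation R gens (cher_rels r n)"
proof
  fix a b assume "(a, b) \<in> cher_rels r n"
  then show "a \<in> F gens \<and> b \<in> F gens"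
    by (cases rule: cher_rels_cases) (auto intro!: F_mult F_add F_diff F_sum)
qed

sublocale H: presentation R gens "cher_rels r n"
  rewrites "presented_alg R gens (cher_rels r n) = cherednik r n"
    and "presented_class R gens (cher_rels r n) = cher_class r n"
  by (rule cher_presentation) (simp_all add: cherednik_def cher_class_def)

abbreviation cl where "cl \<equiv> cher_class r n"

text \<open>Row \<open>j\<close> of the inverse matrix has a single nonzero entry, in column
  \<open>\<sigma> j\<close>. The family \<open>f\<close> is arbitrary because the sum occurs both
  with the \<open>xel m\<close> and with their images in \<open>A\<close>.\<close>

lemma wx_sum:
  assumes \<sigma>: "\<sigma> permutes {1..n}" and j: "j \<in> {1..n}"
  shows "(\<Sum>m=1..n. scal (cst ((inv\<^bsub>G\<^esub> mono_mat r n \<sigma> k) $$ (j - 1, m - 1))) * f m) =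
    scal (cst (zeta r powi (- k j))) * f (\<sigma> j)"
proof -
  have eq: "j = Hilbert_Choice.inv \<sigma> m \<longleftrightarrow> m = \<sigma> j" for m
    using permutes_inverses[OF \<sigma>] by metis
  have "(\<Sum>m=1..n. scal (cst ((inv\<^bsub>G\<^esub> mono_mat r n \<sigma> k) $$ (j - 1, m - 1))) * f m) =
      (\<Sum>m=1..n. if m = \<sigma> j then scal (cst (zeta r powi (- k j))) * f (\<sigma> j) else 0)"
    by (rule sum.cong)
       (use \<sigma> j in \<open>auto simp: G_inv mono_entry eq cst_simps scal_simps permutes_inverses\<close>)
  then show ?thesis using permutes_range[OF \<sigma>, of j] j by simp
qed

lemma wy_sum:
  assumes \<sigma>: "\<sigma> permutes {1..n}" and j: "j \<in> {1..n}"
  shows "(\<Sum>m=1..n. scal (cst (mono_mat r n \<sigma> k $$ (m - 1, j - 1))) * f m) =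
    scal (cst (zeta r powi k j)) * f (\<sigma> j)"
proof -
  have "(\<Sum>m=1..n. scal (cst (mono_mat r n \<sigma> k $$ (m - 1, j - 1))) * f m) =
      (\<Sum>m=1..n. if m = \<sigma> j then scal (cst (zeta r powi k j)) * f (\<sigma> j) else 0)"
    by (rule sum.cong)
       (use \<sigma> j in \<open>auto simp: mono_entry cst_simps scal_simps\<close>)
  then show ?thesis using permutes_range[OF \<sigma>, of j] j by simp
qed

definition wt :: "int \<Rightarrow> cher_free set" where "wt m = cl (scal (cst (zeta r powi m)))"

lemma scal_central: "c \<in> R \<Longrightarrow> x \<in> carrier (cherednik r n) \<Longrightarrow>
    x \<otimes>\<^bsub>cherednik r n\<^esub> cl (scal c) = cl (scal c) \<otimes>\<^bsub>cherednik r n\<^esub> x"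
  by (auto simp: H.Q_carrier scal_commute simp flip: H.cls_mult)

sublocale H: mono_rep "cherednik r n" r n "\<lambda>w. cl (grp w)" wt
proof
  show "cl (grp v) \<otimes>\<^bsub>cherednik r n\<^esub> cl (grp w) = cl (grp (v * w))" if "v \<in> carrier G" "w \<in> carrier G" for v w
    using H.cls_rel[OF cher_rels.w_mult[OF that]] that by (simp add: H.cls_mult G_sel)
  show "cl (grp (1\<^sub>m n)) = \<one>\<^bsub>cherednik r n\<^esub>"
    using H.cls_rel[OF cher_rels.w_one] by (simp add: H.cls_one G_sel)
  show "wt (a + b) = wt a \<otimes>\<^bsub>cherednik r n\<^esub> wt b" for a b
    by (simp add: wt_def power_int_add cst_simps scal_simps H.cls_mult)
qed (simp_all add: wt_def cst_simps scal_simps H.cls_one scal_central)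

lemma cl_grp_mono: "cl (grp (mono_mat r n \<sigma> k)) = H.M \<sigma> k"
  by (simp add: H.M_def)

lemma cl_zpow: "cl (zpow r n i k) = H.zt i k"
  by (simp add: zpow_mono cl_grp_mono H.zt_def)

lemma cl_transpn: "cl (transpn n i j) = H.sw i j"
  by (simp add: transpn_mono cl_grp_mono H.P_def)

lemma cl_simple: "cl (simple n i) = H.sw i (i + 1)"
  by (simp add: simple_def cl_transpn)

text \<open>Turns the relations \<open>wx\<close> and \<open>wy\<close>, stated as conjugations,
  into the commutation form required by \<open>act\<close>.\<close>

lemma conj_inv:
  assumes w: "w \<in> carrier G" and [simp]: "u \<in> F gens" "v \<in> F gens"
    and "cl (grp w * u * grp (inv\<^bsub>G\<^esub> w)) = cl v"
  shows "cl (grp w) \<otimes>\<^bsub>cherednik r n\<^esub> cl u = cl v \<otimes>\<^bsub>cherednik r n\<^esub> cl (grp w)"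
proof -
  have w': "inv\<^bsub>G\<^esub> w \<in> carrier G" "inv\<^bsub>G\<^esub> w * w = 1\<^sub>m n" using w l_inv[OF w] by (simp_all add: G_sel)
  have "cl v \<otimes>\<^bsub>cherednik r n\<^esub> cl (grp w) = cl (grp w) \<otimes>\<^bsub>cherednik r n\<^esub> cl u \<otimes>\<^bsub>cherednik r n\<^esub>
      (cl (grp (inv\<^bsub>G\<^esub> w)) \<otimes>\<^bsub>cherednik r n\<^esub> cl (grp w))"
    unfolding assms(4)[symmetric] using w w' by (simp add: H.cls_mult H.Q.m_assoc)
  also have "cl (grp (inv\<^bsub>G\<^esub> w)) \<otimes>\<^bsub>cherednik r n\<^esub> cl (grp w) = \<one>\<^bsub>cherednik r n\<^esub>"
    using w w' H.g_mult[of "inv\<^bsub>G\<^esub> w" w] H.g_one by simp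
  finally show ?thesis using w by simp
qed

sublocale H: mono_act "cherednik r n" r n "\<lambda>w. cl (grp w)" wt "\<lambda>j. cl (xel j)" "\<lambda>j. cl (yel j)"
proof
  show "H.act (- 1) (\<lambda>j. cl (xel j))"
    unfolding H.act_def
  proof (intro ballI conjI allI impI)
    fix j \<sigma> and k :: "nat \<Rightarrow> int" assume j: "j \<in> {1..n}" and \<sigma>: "\<sigma> permutes {1..n}"
    have \<sigma>j: "\<sigma> j \<in> {1..n}" using permutes_range[OF \<sigma>, of j] j by simp
    have w: "mono_mat r n \<sigma> k \<in> carrier G" using \<sigma> by simp
    have "H.M \<sigma> k \<otimes>\<^bsub>cherednik r n\<^esub> cl (xel j) =
        cl (scal (cst (zeta r powi (- k j))) * xel (\<sigma> j)) \<otimes>\<^bsub>cherednik r n\<^esub> H.M \<sigma> k"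
      unfolding H.M_def
      by (rule conj_inv[OF w])
         (use H.cls_rel[OF cher_rels.wx[OF w j]] wx_sum[OF \<sigma> j, of k xel] j \<sigma>j in simp_all)
    then show "H.M \<sigma> k \<otimes>\<^bsub>cherednik r n\<^esub> cl (xel j) =
        wt (- 1 * k j) \<otimes>\<^bsub>cherednik r n\<^esub> (cl (xel (\<sigma> j)) \<otimes>\<^bsub>cherednik r n\<^esub> H.M \<sigma> k)"
      using \<sigma> \<sigma>j by (simp add: H.cls_mult wt_def H.Q.m_assoc)
  qed simp
  show "H.act 1 (\<lambda>j. cl (yel j))"
    unfolding H.act_def
  proof (intro ballI conjI allI impI)
    fix j \<sigma> and k :: "nat \<Rightarrow> int" assume j: "j \<in> {1..n}" and \<sigma>: "\<sigma> permutes {1..n}"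
    have \<sigma>j: "\<sigma> j \<in> {1..n}" using permutes_range[OF \<sigma>, of j] j by simp
    have w: "mono_mat r n \<sigma> k \<in> carrier G" using \<sigma> by simp
    have "H.M \<sigma> k \<otimes>\<^bsub>cherednik r n\<^esub> cl (yel j) =
        cl (scal (cst (zeta r powi k j)) * yel (\<sigma> j)) \<otimes>\<^bsub>cherednik r n\<^esub> H.M \<sigma> k"
      unfolding H.M_def
      by (rule conj_inv[OF w])
         (use H.cls_rel[OF cher_rels.wy[OF w j]] wy_sum[OF \<sigma> j, of k yel] j \<sigma>j in simp_all)
    then show "H.M \<sigma> k \<otimes>\<^bsub>cherednik r n\<^esub> cl (yel j) =
        wt (1 * k j) \<otimes>\<^bsub>cherednik r n\<^esub> (cl (yel (\<sigma> j)) \<otimes>\<^bsub>cherednik r n\<^esub> H.M \<sigma> k)"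
      using \<sigma> \<sigma>j by (simp add: H.cls_mult wt_def H.Q.m_assoc)
  qed simp
qed

lemma cl_prod_simple:
  assumes "1 \<le> m" "m \<le> n"
  shows "prod_list (map (simple n) [1..<m]) \<in> B \<and> cl (prod_list (map (simple n) [1..<m])) = H.P (cyc m)"
  using assms
proof (induction m rule: dec_induct)
  case base
  have "cyc 1 = id" by (auto simp: cyc_def)
  then have "H.P (cyc 1) = \<one>\<^bsub>cherednik r n\<^esub>" by (simp only: H.P_id)
  then show ?case by (simp add: H.cls_one)
next
  case (step m)
  then have "[1..<Suc m] = [1..<m] @ [m]" "simple n m \<in> B" by (auto simp: upt_Suc_append)
  moreover have "H.P (cyc (Suc m)) = H.P (cyc m) \<otimes>\<^bsub>cherednik r n\<^esub> H.sw m (m + 1)"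
    unfolding cyc_Suc[OF step(1)] by (rule H.P_mult[symmetric]) (use step in auto)
  ultimately show ?case
    using step by (auto simp: H.cls_mult B_mem cl_simple)
qed

lemma cl_prod_simple_rev:
  assumes "1 \<le> m" "m \<le> n"
  shows "prod_list (map (simple n) (rev [1..<m])) \<in> B \<and> cl (prod_list (map (simple n) (rev [1..<m]))) = H.P (cyc_inv m)"
  using assms
proof (induction m rule: dec_induct)
  case base
  have "cyc_inv 1 = id" by (auto simp: cyc_inv_def)
  then have "H.P (cyc_inv 1) = \<one>\<^bsub>cherednik r n\<^esub>" by (simp only: H.P_id)
  then show ?case by (simp add: H.cls_one)
next
  case (step m)
  then have "rev [1..<Suc m] = m # rev [1..<m]" "simple n m \<in> B" by (auto simp: upt_Suc_append)
  moreover have "H.P (cyc_inv (Suc m)) = H.sw m (m + 1) \<otimes>\<^bsub>cherednik r n\<^esub> H.P (cyc_inv m)"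
    unfolding cyc_inv_Suc[OF step(1)] by (rule H.P_mult[symmetric]) (use step in auto)
  ultimately show ?case
    using step by (auto simp: H.cls_mult B_mem cl_simple)
qed

definition Phi_img where "Phi_img = xel n * prod_list (map (simple n) (rev [1..<n]))"
definition Psi_img where "Psi_img = yel 1 * prod_list (map (simple n) [1..<n])"

lemma Phi_img_mem [simp]: "Phi_img \<in> F gens" and Psi_img_mem [simp]: "Psi_img \<in> F gens"
  using cl_prod_simple[of n] cl_prod_simple_rev[of n]
  by (auto simp: Phi_img_def Psi_img_def B_mem)

lemma cl_Phi: "cl Phi_img = H.phi" and cl_Psi: "cl Psi_img = H.psi"
  using cl_prod_simple[of n] cl_prod_simple_rev[of n]
  by (auto simp: Phi_img_def Psi_img_def H.phi_def H.psi_def H.cls_mult B_mem)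

section \<open>Conjugation of the group algebra terms by permutations\<close>

lemma cl_refl:
  "i \<in> {1..n} \<Longrightarrow> j \<in> {1..n} \<Longrightarrow> cl (reflection i j l) =
    H.zt i (int l) \<otimes>\<^bsub>cherednik r n\<^esub> H.sw i j \<otimes>\<^bsub>cherednik r n\<^esub> H.zt i (- int l)"
  by (simp add: reflection_def H.cls_mult cl_zpow cl_transpn)

text \<open>Conjugation by \<sigma> in \<open>H\<close>, restricted to group expressions: such
  identities are proved in \<open>H\<close> and carried to \<open>A\<close> by
  \<open>iota_conj\<close>.\<close>

definition conj_rel :: "(nat \<Rightarrow> nat) \<Rightarrow> cher_free \<Rightarrow> cher_free \<Rightarrow> bool" where
  "conj_rel \<sigma> a b \<longleftrightarrow> a \<in> B \<and> b \<in> B \<and>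
     H.P \<sigma> \<otimes>\<^bsub>cherednik r n\<^esub> cl a = cl b \<otimes>\<^bsub>cherednik r n\<^esub> H.P \<sigma>"

context
  fixes \<sigma> assumes \<sigma> [simp]: "\<sigma> permutes {1..n}"
begin

lemma conj_rel_iff: "conj_rel \<sigma> a b \<longleftrightarrow> a \<in> B \<and> b \<in> B \<and>
    cl (grp (mono_mat r n \<sigma> (\<lambda>_. 0)) * a) = cl (b * grp (mono_mat r n \<sigma> (\<lambda>_. 0)))"
  by (auto simp: conj_rel_def H.cls_mult B_mem cl_grp_mono H.P_def)

lemma conj_rel_sum: "(\<And>i. i \<in> A \<Longrightarrow> conj_rel \<sigma> (f i) (h i)) \<Longrightarrow> conj_rel \<sigma> (sum f A) (sum h A)"
  unfolding conj_rel_iff sum_distrib_left sum_distrib_right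
  by (intro conjI F_sum H.cls_sum_cong) (auto simp: B_mem)

lemma conj_rel_scal:
  assumes "c \<in> R" "conj_rel \<sigma> a b"
  shows "conj_rel \<sigma> (scal c * a) (scal c * b)"
proof -
  let ?w = "grp (mono_mat r n \<sigma> (\<lambda>_. 0))"
  have "?w * (scal c * a) = scal c * (?w * a)" "scal c * b * ?w = scal c * (b * ?w)"
    by (metis mult.assoc scal_commute)+
  with assms show ?thesis
    unfolding conj_rel_iff by (simp add: H.cls_mult[of "scal c"] B_mem)
qed

lemma conj_rel_mult:
  assumes "conj_rel \<sigma> a b" "conj_rel \<sigma> a' b'"
  shows "conj_rel \<sigma> (a * a') (b * b')"
proof -
  have [simp]: "cl a \<in> carrier (cherednik r n)" "cl a' \<in> carrier (cherednik r n)"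
    "cl b \<in> carrier (cherednik r n)" "cl b' \<in> carrier (cherednik r n)"
    using assms by (auto simp: conj_rel_def B_mem)
  have "H.P \<sigma> \<otimes>\<^bsub>cherednik r n\<^esub> (cl a \<otimes>\<^bsub>cherednik r n\<^esub> cl a') =
      cl b \<otimes>\<^bsub>cherednik r n\<^esub> H.P \<sigma> \<otimes>\<^bsub>cherednik r n\<^esub> cl a'"
    using assms(1) by (simp add: conj_rel_def flip: H.Q.m_assoc)
  also have "\<dots> = cl b \<otimes>\<^bsub>cherednik r n\<^esub> cl b' \<otimes>\<^bsub>cherednik r n\<^esub> H.P \<sigma>"
    using assms(2) by (simp add: conj_rel_def H.Q.m_assoc)
  finally show ?thesis
    using assms by (simp add: conj_rel_def H.cls_mult B_mem)
qed

lemma conj_rel_zpow: "i \<in> {1..n} \<Longrightarrow> conj_rel \<sigma> (zpow r n i k) (zpow r n (\<sigma> i) k)"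
  by (simp add: conj_rel_def cl_zpow H.zt_perm)

lemma conj_rel_transpn:
  "i \<in> {1..n} \<Longrightarrow> j \<in> {1..n} \<Longrightarrow> conj_rel \<sigma> (transpn n i j) (transpn n (\<sigma> i) (\<sigma> j))"
  using H.perm_range[OF \<sigma>] comp_transpose[OF permutes_inj[OF \<sigma>], of i j]
  by (simp add: conj_rel_def cl_transpn H.P_mult)

lemma conj_rel_refl: "i \<in> {1..n} \<Longrightarrow> j \<in> {1..n} \<Longrightarrow> conj_rel \<sigma> (reflection i j l) (reflection (\<sigma> i) (\<sigma> j) l)"
  unfolding reflection_def by (intro conj_rel_mult conj_rel_zpow conj_rel_transpn)

lemma conj_rel_refl_sum:
  assumes i: "i \<in> {1..n}"
  shows "conj_rel \<sigma> (refl_sum i) (refl_sum (\<sigma> i))"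
proof -
  \<comment> \<open>The permutation reindexes the reflections through \<open>i\<close> by those
    through \<open>\<sigma> i\<close>.\<close>
  have "bij_betw \<sigma> ({1..n} - {i}) ({1..n} - {\<sigma> i})"
    using permutes_imp_bij[OF \<sigma>] i H.perm_range[OF \<sigma> i] by (intro bij_betw_DiffI) auto
  then have "refl_sum (\<sigma> i) = (\<Sum>j\<in>{1..n} - {i}. \<Sum>l<r. reflection (\<sigma> i) (\<sigma> j) l)"
    unfolding refl_sum_def by (rule sum.reindex_bij_betw[symmetric])
  moreover have "conj_rel \<sigma> (refl_sum i) (\<Sum>j\<in>{1..n} - {i}. \<Sum>l<r. reflection (\<sigma> i) (\<sigma> j) l)"
    unfolding refl_sum_def using i by (intro conj_rel_sum conj_rel_refl) auto
  ultimately show ?thesis by simp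
qed

lemma conj_rel_refl_twist:
  "i \<in> {1..n} \<Longrightarrow> j \<in> {1..n} \<Longrightarrow> conj_rel \<sigma> (refl_twist i j) (refl_twist (\<sigma> i) (\<sigma> j))"
  unfolding refl_twist_def by (intro conj_rel_sum conj_rel_scal conj_rel_refl cst_mem)

lemma conj_rel_eps_sum: "i \<in> {1..n} \<Longrightarrow> conj_rel \<sigma> (eps_sum i) (eps_sum (\<sigma> i))"
  unfolding eps_sum_def eps_def
  by (intro conj_rel_sum conj_rel_scal conj_rel_zpow cst_mem diff_mem dpar_mem)

lemma conj_rel_one: "conj_rel \<sigma> 1 1"
  by (simp add: conj_rel_def H.cls_one)

lemma conj_rel_diff: "conj_rel \<sigma> a b \<Longrightarrow> conj_rel \<sigma> a' b' \<Longrightarrow> conj_rel \<sigma> (a - a') (b - b')"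
  unfolding conj_rel_iff right_diff_distrib left_diff_distrib by (simp add: H.cls_diff B_mem)

end

section \<open>The relations between \<Phi> and \<Psi> inside the Cherednik algebra\<close>

lemma phi_sum_one: "phi_sum r n 1 = 0"
  by (simp add: phi_sum_def)

text \<open>For the last index the condition \<open>j < n\<close> selects all \<open>j\<close> other
  than \<open>n\<close>. Hence \<open>zel r n n\<close> contains the full reflection sum of the
  relation for \<open>y_n x_n\<close>.\<close>

lemma phi_sum_last: "phi_sum r n n = refl_sum n"
proof -
  have "{1..<n} = {1..n} - {n}" by auto
  then show ?thesis by (simp add: phi_sum_def refl_sum_def reflection_def)
qed

lemma zel_mem [simp]: "i \<in> {1..n} \<Longrightarrow> zel r n i \<in> F gens"
  unfolding zel_def by simp

text \<open>The sum in \<open>zel r n 1\<close> is empty, so that element is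
  \<open>yel 1 * xel 1\<close>, and conjugation by the transposition of 1 and \<open>i\<close> gives
  \<open>yel i * xel i\<close>.\<close>

lemma zel_conj:
  assumes i: "i \<in> {1..n}"
  shows "cl (zel r n i) = cl (transpn n 1 i * zel r n 1 * transpn n 1 i + scal c0 * phi_sum r n i)"
proof -
  have "cl (transpn n 1 i * zel r n 1 * transpn n 1 i) = cl (yel i * xel i)"
    using i by (simp add: zel_def phi_sum_one H.cls_mult cl_transpn H.P_move)
  with i show ?thesis by (simp add: zel_def H.cls_add)
qed

definition zeta_twist :: cher_free where
  "zeta_twist = (\<Sum>l<r. scal (cst (zeta r powi (- int l))) * (zpow r n 1 (int l) * zpow r n n (- int l)))"

lemma zeta_twist_B [simp]: "zeta_twist \<in> B"
  unfolding zeta_twist_def by (auto intro!: F_sum F_mult)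

text \<open>Conjugation by the transposition of 1 and \<open>n\<close> turns powers of
  \<zeta>-matrix 1 into powers of \<zeta>-matrix \<open>n\<close>, after which the two
  transpositions cancel.\<close>

lemma cl_twist: "cl (refl_twist 1 n) \<otimes>\<^bsub>cherednik r n\<^esub> H.sw 1 n = cl zeta_twist"
proof -
  have reflection: "cl (reflection 1 n l * transpn n 1 n) = cl (zpow r n 1 (int l) * zpow r n n (- int l))" for l
  proof -
    have "cl (reflection 1 n l * transpn n 1 n) =
      H.zt 1 (int l) \<otimes>\<^bsub>cherednik r n\<^esub> (H.sw 1 n \<otimes>\<^bsub>cherednik r n\<^esub> H.zt 1 (- int l)) \<otimes>\<^bsub>cherednik r n\<^esub> H.sw 1 n"
      by (simp add: H.cls_mult cl_transpn cl_refl H.Q.m_assoc)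
    also have "H.sw 1 n \<otimes>\<^bsub>cherednik r n\<^esub> H.zt 1 (- int l) = H.zt n (- int l) \<otimes>\<^bsub>cherednik r n\<^esub> H.sw 1 n"
      using H.zt_perm[of "Transposition.transpose 1 n" 1 "- int l"] by simp
    also have "H.zt 1 (int l) \<otimes>\<^bsub>cherednik r n\<^esub> \<dots> \<otimes>\<^bsub>cherednik r n\<^esub> H.sw 1 n =
        cl (zpow r n 1 (int l) * zpow r n n (- int l))"
      by (simp add: H.cls_mult cl_zpow H.Q.m_assoc H.P_mult)
    finally show ?thesis .
  qed
  have "cl (refl_twist 1 n * transpn n 1 n) = cl zeta_twist"
    unfolding refl_twist_def zeta_twist_def sum_distrib_right
  proof (rule H.cls_sum_cong)
    fix l
    let ?c = "scal (cst (zeta r powi - int l)) :: cher_free"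
    have "cl (?c * reflection 1 n l * transpn n 1 n) = cl (?c * (reflection 1 n l * transpn n 1 n))"
      by (simp add: mult.assoc)
    also have "\<dots> = cl ?c \<otimes>\<^bsub>cherednik r n\<^esub> cl (zpow r n 1 (int l) * zpow r n n (- int l))"
      by (subst H.cls_mult) (simp_all add: reflection)
    finally show "cl (?c * reflection 1 n l * transpn n 1 n) = cl (?c * (zpow r n 1 (int l) * zpow r n n (- int l)))"
      by (simp add: H.cls_mult)
  qed auto
  then show ?thesis by (simp add: H.cls_mult cl_transpn)
qed

lemma cl_add_right: "cl a = cl b \<Longrightarrow> a \<in> F gens \<Longrightarrow> b \<in> F gens \<Longrightarrow> c \<in> F gens \<Longrightarrow> cl (a + c) = cl (b + c)"
  by (simp add: H.cls_add)

lemma Phi_Psi_H: "H.phi \<otimes>\<^bsub>cherednik r n\<^esub> H.psi = cl (zel r n n - 1 + eps_sum n)"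
proof -
  \<comment> \<open>Added to the relation for \<open>yel n * xel n\<close>, this term completes the
    left side to the required expression in \<open>zel r n n\<close> and reduces the right side to
    \<open>xel n * yel n\<close>.\<close>
  let ?c = "scal c0 * refl_sum n - 1 + eps_sum n"
  have "cl (yel n * xel n + ?c) = cl ((xel n * yel n + 1 - scal c0 * refl_sum n - eps_sum n) + ?c)"
    by (rule cl_add_right[OF H.cls_rel[OF yx_same']]) simp_all
  then show ?thesis
    by (simp add: H.phi_psi zel_def phi_sum_last H.cls_mult algebra_simps)
qed

lemma Psi_s_Phi_H:
  assumes n: "2 \<le> n"
  shows "H.psi \<otimes>\<^bsub>cherednik r n\<^esub> H.sw (n - 1) n \<otimes>\<^bsub>cherednik r n\<^esub> H.phi =
    H.phi \<otimes>\<^bsub>cherednik r n\<^esub> H.sw 1 2 \<otimes>\<^bsub>cherednik r n\<^esub> H.psi \<oplus>\<^bsub>cherednik r n\<^esub>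
      cl (scal c0) \<otimes>\<^bsub>cherednik r n\<^esub> cl zeta_twist"
proof -
  have "cl (yel 1 * xel n) = cl (xel n * yel 1 + scal c0 * refl_twist 1 n)"
    by (rule H.cls_rel[OF yx_diff']) (use n in auto)
  then have YX: "cl (yel 1) \<otimes>\<^bsub>cherednik r n\<^esub> cl (xel n) =
      cl (xel n) \<otimes>\<^bsub>cherednik r n\<^esub> cl (yel 1) \<oplus>\<^bsub>cherednik r n\<^esub> cl (scal c0) \<otimes>\<^bsub>cherednik r n\<^esub> cl (refl_twist 1 n)"
    by (simp add: H.cls_mult H.cls_add)
  show ?thesis
    unfolding H.psi_s_phi[OF n] H.phi_s_psi[OF n] cl_twist[symmetric] YX
    using n by (simp add: H.Q.l_distr H.Q.m_assoc)
qed

section \<open>The subalgebra generated by the Dunkl-Opdam subalgebra and the group\<close>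

abbreviation HG where "HG \<equiv> H_gr r n"

lemma dunkl_opdam_carrier: "dunkl_opdam r n \<subseteq> carrier (cherednik r n)"
  unfolding dunkl_opdam_def subalgebra_generated_def by (rule H.Q.generate_ring_incl) auto

lemma H_gr_gens_carrier: "(\<lambda>c. cl (scal c)) ` R \<union>
    (dunkl_opdam r n \<union> (\<lambda>w. cl (grp w)) ` carrier G) \<subseteq> carrier (cherednik r n)"
  using dunkl_opdam_carrier by auto

lemma HG_carrier: "a \<in> HG \<Longrightarrow> a \<in> carrier (cherednik r n)"
  unfolding H_gr_def subalgebra_generated_def
  using H.Q.generate_ring_incl[OF H_gr_gens_carrier] by blast

lemma HG_add [simp]: "a \<in> HG \<Longrightarrow> b \<in> HG \<Longrightarrow> a \<oplus>\<^bsub>cherednik r n\<^esub> b \<in> HG"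
  and HG_mult [simp]: "a \<in> HG \<Longrightarrow> b \<in> HG \<Longrightarrow> a \<otimes>\<^bsub>cherednik r n\<^esub> b \<in> HG"
  and HG_scal [simp]: "c \<in> R \<Longrightarrow> cl (scal c) \<in> HG"
  and HG_grp [simp]: "w \<in> carrier G \<Longrightarrow> cl (grp w) \<in> HG"
  unfolding H_gr_def subalgebra_generated_def
  by (auto intro: generate_ring.intros)

lemma HG_zel [simp]: "i \<in> {1..n} \<Longrightarrow> cl (zel r n i) \<in> HG"
  unfolding H_gr_def dunkl_opdam_def subalgebra_generated_def
  by (intro generate_ring.incl UnI2 UnI1 imageI)

lemma HG_B [simp]: "b \<in> B \<Longrightarrow> cl b \<in> HG"
proof (induction b rule: F_induct)
  case zero
  show ?case using HG_scal[of 0] by (simp add: scal_simps)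
next
  case (add a b)
  then show ?case by (simp add: H.cls_add B_mem)
next
  case (word c w)
  have "cl (prod_list (map gen w)) \<in> HG \<and> prod_list (map gen w) \<in> B" using word(2)
  proof (induction w)
    case Nil
    show ?case using HG_scal[of 1] by (simp add: scal_simps)
  next
    case (Cons s w)
    then obtain v where "s = Wgen v" "v \<in> carrier G" by auto
    then have "cl (gen s) \<in> HG" "gen s \<in> B" using HG_grp[of v] grp_B[of v] by (simp_all add: grp_def)
    with Cons show ?case by (auto simp: H.cls_mult B_mem)
  qed
  with word show ?case by (simp add: H.cls_mult B_mem)
qed

text \<open>The maps are only assumed compatible with the operations on \<open>HG\<close>, because
  \<open>iota\<close> is a homomorphism there only. Negatives are products with the scalar -1, so
  sums and products suffice.\<close>

lemma HG_eqI:
  assumes T: "ring T"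
    and add: "\<And>a b. a \<in> HG \<Longrightarrow> b \<in> HG \<Longrightarrow> f (a \<oplus>\<^bsub>cherednik r n\<^esub> b) = f a \<oplus>\<^bsub>T\<^esub> f b \<and> g (a \<oplus>\<^bsub>cherednik r n\<^esub> b) = g a \<oplus>\<^bsub>T\<^esub> g b"
    and mult: "\<And>a b. a \<in> HG \<Longrightarrow> b \<in> HG \<Longrightarrow> f (a \<otimes>\<^bsub>cherednik r n\<^esub> b) = f a \<otimes>\<^bsub>T\<^esub> f b \<and> g (a \<otimes>\<^bsub>cherednik r n\<^esub> b) = g a \<otimes>\<^bsub>T\<^esub> g b"
    and scal: "\<And>c. c \<in> R \<Longrightarrow> f (cl (scal c)) = g (cl (scal c))"
    and zel: "\<And>i. i \<in> {1..n} \<Longrightarrow> f (cl (zel r n i)) = g (cl (zel r n i))"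
    and grp: "\<And>w. w \<in> carrier G \<Longrightarrow> f (cl (grp w)) = g (cl (grp w))"
    and a: "a \<in> HG"
  shows "f a = g a"
proof -
  have one: "\<one>\<^bsub>cherednik r n\<^esub> = cl (scal 1)" by (simp add: scal_simps H.cls_one)
  have minus: "\<ominus>\<^bsub>cherednik r n\<^esub> b = cl (scal (- 1)) \<otimes>\<^bsub>cherednik r n\<^esub> b" if "b \<in> carrier (cherednik r n)" for b
    using that H.cls_uminus[of "1"] by (simp add: scal_simps H.cls_one H.Q.l_minus)
  \<comment> \<open>Stated for an arbitrary generating set, since it is applied twice: first to the
    Dunkl-Opdam subalgebra, then to \<open>H_gr\<close>, which has that subalgebra among its
    generators.\<close>
  have gen: "x \<in> HG \<and> f x = g x"
    if "x \<in> subalgebra_generated r n S" "S \<subseteq> HG" and S: "\<And>s. s \<in> S \<Longrightarrow> f s = g s" for x S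
    using that(1) unfolding subalgebra_generated_def
  proof (induction rule: generate_ring.induct)
    case (incl h)
    then show ?case using that(2) S scal by auto
  next
    case (a_inv h)
    then have h: "\<ominus>\<^bsub>cherednik r n\<^esub> h = cl (scal (- 1)) \<otimes>\<^bsub>cherednik r n\<^esub> h"
      by (intro minus HG_carrier) simp
    show ?case unfolding h using a_inv mult[of "cl (scal (- 1))" h] scal[of "- 1"] by simp
  qed (use scal[of 1] add mult one in auto)
  have D: "x \<in> HG \<and> f x = g x" if "x \<in> dunkl_opdam r n" for x
    using that unfolding dunkl_opdam_def
    by (rule gen) (use zel grp in \<open>auto simp: zpow_mono\<close>)
  have "a \<in> HG \<and> f a = g a"
    using a[unfolded H_gr_def] by (rule gen) (use D grp in auto)
  then show ?thesis ..
qed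

section \<open>The algebra on the extended generators\<close>

abbreviation A_gs where "A_gs \<equiv> A_gens r n"

lemma Inc_mem [simp]: "a \<in> HG \<Longrightarrow> gen (Inc a) \<in> F A_gs"
  and Phi_mem [simp]: "\<Phi> \<in> F A_gs"
  and Psi_mem [simp]: "\<Psi> \<in> F A_gs"
  by (auto simp: A_gens_def \<Phi>_def \<Psi>_def intro!: F_gen)

lemma inc_mem [simp]: "cl h \<in> HG \<Longrightarrow> inc r n h \<in> F A_gs"
  by (simp add: inc_def)

lemma phi_zeta_B [simp]: "i \<in> {1..n} \<Longrightarrow> phi_zeta r n i \<in> B"
  and phi_inv_zeta_B [simp]: "i \<in> {1..n} \<Longrightarrow> phi_inv_zeta r n i \<in> B"
  unfolding phi_zeta_def phi_inv_zeta_def by (auto intro!: F_mult)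

definition Phi_Psi_rhs :: cher_free where "Phi_Psi_rhs = zel r n n - 1 + eps_sum n"

lemma Phi_Psi_rhs_mem [simp]: "Phi_Psi_rhs \<in> F gens"
  by (simp add: Phi_Psi_rhs_def)

lemma HG_Phi_Psi_rhs [simp]: "cl Phi_Psi_rhs \<in> HG"
proof -
  have "Phi_Psi_rhs = zel r n n + (eps_sum n - 1)" by (simp add: Phi_Psi_rhs_def)
  moreover have "eps_sum n - 1 \<in> B" by simp
  ultimately show ?thesis by (simp add: H.cls_add)
qed

lemma A_rels_cases:
  assumes "(a, b) \<in> A_rels r n"
  obtains x y where "x \<in> HG" "y \<in> HG" "a = gen (Inc (x \<oplus>\<^bsub>cherednik r n\<^esub> y))" "b = gen (Inc x) + gen (Inc y)"
  | x y where "x \<in> HG" "y \<in> HG" "a = gen (Inc (x \<otimes>\<^bsub>cherednik r n\<^esub> y))" "b = gen (Inc x) * gen (Inc y)"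
  | c where "c \<in> R" "a = inc r n (scal c)" "b = scal c"
  | i where "2 \<le> i" "i + 1 \<le> n" "a = \<Phi> * inc r n (simple n i)" "b = inc r n (simple n (i - 1)) * \<Phi>"
  | "2 \<le> n" "a = \<Phi> * \<Phi> * inc r n (simple n 1)" "b = inc r n (simple n (n - 1)) * (\<Phi> * \<Phi>)"
  | i where "1 \<le> i" "i + 2 \<le> n" "a = \<Psi> * inc r n (simple n i)" "b = inc r n (simple n (i + 1)) * \<Psi>"
  | "2 \<le> n" "a = \<Psi> * \<Psi> * inc r n (simple n (n - 1))" "b = inc r n (simple n 1) * (\<Psi> * \<Psi>)"
  | i where "i \<in> {1..n}" "a = inc r n (zpow r n i 1) * \<Phi>" "b = \<Phi> * inc r n (phi_zeta r n i)"
  | i where "i \<in> {1..n}" "a = inc r n (zpow r n i 1) * \<Psi>" "b = \<Psi> * inc r n (phi_inv_zeta r n i)"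
  | "a = \<Psi> * \<Phi>" "b = inc r n (zel r n 1)"
  | "a = \<Phi> * \<Psi>" "b = inc r n Phi_Psi_rhs"
  | "2 \<le> n" "a = \<Psi> * inc r n (simple n (n - 1)) * \<Phi>"
      "b = \<Phi> * inc r n (simple n 1) * \<Psi> + scal c0 * inc r n zeta_twist"
  using assms
proof (cases rule: A_rels.cases)
  case (inc_add x y)
  then show ?thesis by - (rule that(1)[of x y], assumption+)
next
  case (inc_mult x y)
  then show ?thesis by - (rule that(2)[of x y], assumption+)
next
  case (inc_scal c)
  then show ?thesis by - (rule that(3)[of c], assumption+)
next
  case (Phi_s i)
  then show ?thesis by - (rule that(4)[of i], assumption+)
next
  case Phi2_s
  then show ?thesis by - (rule that(5), simp_all only: power2_eq_square)
next
  case (Psi_s i)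
  then show ?thesis by - (rule that(6)[of i], assumption+)
next
  case Psi2_s
  then show ?thesis by - (rule that(7), simp_all only: power2_eq_square)
next
  case (zeta_Phi i)
  then show ?thesis by - (rule that(8)[of i], assumption+)
next
  case (zeta_Psi i)
  then show ?thesis by - (rule that(9)[of i], assumption+)
next
  case Psi_Phi
  then show ?thesis by - (rule that(10), assumption+)
next
  case Phi_Psi
  then show ?thesis by - (rule that(11), simp_all only: Phi_Psi_rhs_def eps_sum_def)
next
  case Psi_s_Phi
  then show ?thesis by - (rule that(12), simp_all only: zeta_twist_def)
qed

lemma A_presentation: "presentation R A_gs (A_rels r n)"
proof
  fix a b assume "(a, b) \<in> A_rels r n"
  then show "a \<in> F A_gs \<and> b \<in> F A_gs"
    by (cases rule: A_rels_cases) (auto intro!: F_mult F_add Inc_mem inc_mem HG_B)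
qed

sublocale A: presentation R A_gs "A_rels r n"
  rewrites "presented_alg R A_gs (A_rels r n) = A_alg r n"
    and "presented_class R A_gs (A_rels r n) = A_class r n"
  by (rule A_presentation) (simp_all add: A_alg_def A_class_def)

abbreviation Ac where "Ac \<equiv> A_class r n"

text \<open>The structural map from \<open>H_gr\<close> to \<open>A\<close>. The relations
  \<open>inc_add\<close>, \<open>inc_mult\<close> and \<open>inc_scal\<close> make it a
  homomorphism; a left inverse is obtained in \<open>natural_map_exists\<close>.\<close>

definition iota :: "cher_free set \<Rightarrow> A_free set" where "iota a = Ac (gen (Inc a))"

lemma Ac_inc: "Ac (inc r n h) = iota (cl h)"
  by (simp add: inc_def iota_def)

lemma iota_closed [simp]: "a \<in> HG \<Longrightarrow> iota a \<in> carrier (A_alg r n)"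
  by (simp add: iota_def)

lemma iota_add: "a \<in> HG \<Longrightarrow> b \<in> HG \<Longrightarrow> iota (a \<oplus>\<^bsub>cherednik r n\<^esub> b) = iota a \<oplus>\<^bsub>A_alg r n\<^esub> iota b"
  using A.cls_rel[OF A_rels.inc_add] by (simp add: iota_def A.cls_add)

lemma iota_mult: "a \<in> HG \<Longrightarrow> b \<in> HG \<Longrightarrow> iota (a \<otimes>\<^bsub>cherednik r n\<^esub> b) = iota a \<otimes>\<^bsub>A_alg r n\<^esub> iota b"
  using A.cls_rel[OF A_rels.inc_mult] by (simp add: iota_def A.cls_mult)

lemma iota_scal: "c \<in> R \<Longrightarrow> iota (cl (scal c)) = Ac (scal c)"
  using A.cls_rel[OF A_rels.inc_scal] by (simp add: inc_def iota_def)

lemma wt_HG [simp]: "wt k \<in> HG" and zt_HG [simp]: "H.zt i k \<in> HG"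
  and P_HG [simp]: "\<sigma> permutes {1..n} \<Longrightarrow> H.P \<sigma> \<in> HG"
  by (simp_all add: wt_def H.zt_def H.P_def flip: cl_grp_mono)

subsection \<open>The natural map\<close>

text \<open>A generator \<open>Inc a\<close> is labelled by a coset, whereas a substitution needs an
  element of the free algebra. The choice of representative disappears on passing to
  classes.\<close>

fun lift :: "A_gen \<Rightarrow> cher_free" where
  "lift (Inc a) = (SOME x. x \<in> F gens \<and> cl x = a)"
| "lift PhiGen = Phi_img"
| "lift PsiGen = Psi_img"

lemma lift_Inc [simp]:
  assumes "a \<in> HG"
  shows "lift (Inc a) \<in> F gens" "cl (lift (Inc a)) = a"
proof -
  have "\<exists>x. x \<in> F gens \<and> cl x = a" using HG_carrier[OF assms] by (auto simp: H.Q_carrier)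
  from someI_ex[OF this] show "lift (Inc a) \<in> F gens" "cl (lift (Inc a)) = a" by auto
qed

declare lift.simps(1) [simp del]

lemma lift_mem: "g \<in> A_gs \<Longrightarrow> lift g \<in> F gens"
  by (auto simp: A_gens_def)

lemma subst_lift [simp]: "subst lift \<Phi> = Phi_img" "subst lift \<Psi> = Psi_img"
    "subst lift (inc r n h) = lift (Inc (cl h))"
  by (simp_all add: \<Phi>_def \<Psi>_def inc_def)

lemma cl_phi_zeta: "i \<in> {1..n} \<Longrightarrow> cl (phi_zeta r n i) =
    (if i < n then H.zt (i + 1) 1 else wt (- 1) \<otimes>\<^bsub>cherednik r n\<^esub> H.zt 1 1)"
  by (simp add: phi_zeta_def cl_zpow H.cls_mult wt_def power_int_minus)

lemma cl_phi_inv_zeta: "i \<in> {1..n} \<Longrightarrow> cl (phi_inv_zeta r n i) =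
    (if 1 < i then H.zt (i - 1) 1 else wt 1 \<otimes>\<^bsub>cherednik r n\<^esub> H.zt n 1)"
  by (simp add: phi_inv_zeta_def cl_zpow H.cls_mult wt_def)

text \<open>The \<open>Inc\<close> relations hold because \<open>lift\<close> picks representatives;
  the others are the identities for \<open>phi\<close> and \<open>psi\<close> in the instance
  \<open>H\<close> of \<open>mono_act\<close>, with the commutation relations of \<open>H\<close>
  supplying the last three.\<close>

lemma lift_rels:
  assumes "(a, b) \<in> A_rels r n"
  shows "cl (subst lift a) = cl (subst lift b)"
proof -
  have X: "cl (xel n) \<otimes>\<^bsub>cherednik r n\<^esub> cl (xel (n - 1)) = cl (xel (n - 1)) \<otimes>\<^bsub>cherednik r n\<^esub> cl (xel n)"
    if "2 \<le> n"
    using H.cls_rel[OF cher_rels.xx[of n n "n - 1" r]] that by (simp add: H.cls_mult)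
  have Y: "cl (yel 1) \<otimes>\<^bsub>cherednik r n\<^esub> cl (yel 2) = cl (yel 2) \<otimes>\<^bsub>cherednik r n\<^esub> cl (yel 1)"
    if "2 \<le> n"
    using H.cls_rel[OF cher_rels.yy[of 1 n 2 r]] that by (simp add: H.cls_mult)
  from assms show ?thesis
  proof (cases rule: A_rels_cases)
    case (1 x y)
    then show ?thesis by (simp add: H.cls_add)
  next
    case (2 x y)
    then show ?thesis by (simp add: H.cls_mult)
  next
    case (3 c)
    then show ?thesis by simp
  next
    case (4 i)
    \<comment> \<open>The last equation identifies the class of \<open>simple n (i - 1)\<close> with
      the transposition of \<open>i - 1\<close> and \<open>i\<close>.\<close>
    then have "1 \<le> i - 1" "i - 1 \<le> n" "1 \<le> i" "i \<le> n" "i - 1 + 1 = i" by auto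
    with H.phi_simple[OF 4(1,2)] 4 show ?thesis
      by (simp add: H.cls_mult cl_Phi cl_simple)
  next
    case 5
    then have "1 \<le> n - 1" "n - 1 + 1 = n" by auto
    with H.phi_sq[OF 5(1)] X[OF 5(1)] 5 show ?thesis
      by (simp add: H.cls_mult cl_Phi cl_simple)
  next
    case (6 i)
    have "i + 2 = i + 1 + 1" by simp
    note H.psi_simple[OF 6(1,2), unfolded this]
    moreover have "i \<le> n" "i + 1 \<le> n" "i + 1 + 1 \<le> n" using 6 by auto
    ultimately show ?thesis
      using 6 by (simp add: H.cls_mult cl_Psi cl_simple)
  next
    case 7
    then have "1 \<le> n - 1" "n - 1 + 1 = n" by auto
    with H.psi_sq[OF 7(1)] Y[OF 7(1)] 7 show ?thesis
      by (simp add: H.cls_mult cl_Psi cl_simple)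
  next
    case (8 i)
    with H.zeta_phi[OF 8(1)] show ?thesis
      by (simp add: H.cls_mult cl_Phi cl_zpow cl_phi_zeta)
  next
    case (9 i)
    with H.zeta_psi[OF 9(1)] show ?thesis
      by (simp add: H.cls_mult cl_Psi cl_zpow cl_phi_inv_zeta)
  next
    case 10
    then show ?thesis
      by (simp add: H.cls_mult cl_Psi cl_Phi H.psi_phi) (simp add: zel_def phi_sum_one H.cls_mult)
  next
    case 11
    then show ?thesis
      by (simp add: H.cls_mult cl_Psi cl_Phi Phi_Psi_H) (simp add: Phi_Psi_rhs_def)
  next
    case 12
    then have "1 \<le> n - 1" "n - 1 + 1 = n" by auto
    with Psi_s_Phi_H[OF 12(1)] 12 show ?thesis
      by (simp add: H.cls_mult H.cls_add cl_Psi cl_Phi cl_simple)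
  qed
qed

subsection \<open>The inverse map\<close>

definition wtA :: "int \<Rightarrow> A_free set" where "wtA m = Ac (scal (cst (zeta r powi m)))"

lemma scal_central_A: "c \<in> R \<Longrightarrow> x \<in> carrier (A_alg r n) \<Longrightarrow>
    x \<otimes>\<^bsub>A_alg r n\<^esub> Ac (scal c) = Ac (scal c) \<otimes>\<^bsub>A_alg r n\<^esub> x"
  by (auto simp: A.Q_carrier scal_commute simp flip: A.cls_mult)

sublocale A: mono_rep "A_alg r n" r n "\<lambda>w. iota (cl (grp w))" wtA
proof
  show "iota (cl (grp v)) \<otimes>\<^bsub>A_alg r n\<^esub> iota (cl (grp w)) = iota (cl (grp (v * w)))"
    if "v \<in> carrier G" "w \<in> carrier G" for v w
    using that by (simp add: H.g_mult flip: iota_mult)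
  show "iota (cl (grp (1\<^sub>m n))) = \<one>\<^bsub>A_alg r n\<^esub>"
    using iota_scal[of 1] H.g_one by (simp add: scal_simps H.cls_one A.cls_one)
  show "wtA (a + b) = wtA a \<otimes>\<^bsub>A_alg r n\<^esub> wtA b" for a b
    by (simp add: wtA_def power_int_add cst_simps scal_simps A.cls_mult)
qed (simp_all add: wtA_def cst_simps scal_simps A.cls_one scal_central_A)

lemma iota_M: "iota (H.M \<sigma> k) = A.M \<sigma> k"
  by (simp add: H.M_def A.M_def)

lemma iota_P: "iota (H.P \<sigma>) = A.P \<sigma>"
  by (simp add: H.P_def A.P_def iota_M)

lemma iota_zt: "iota (H.zt i k) = A.zt i k"
  by (simp add: H.zt_def A.zt_def iota_M)

lemma iota_wt: "iota (wt k) = wtA k"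
  by (simp add: wt_def wtA_def iota_scal)

abbreviation PhiA where "PhiA \<equiv> Ac \<Phi>"
abbreviation PsiA where "PsiA \<equiv> Ac \<Psi>"

text \<open>The intended images of the generators \<open>xel j\<close>: the base element at
  coordinate \<open>n\<close> is \<Phi> followed by the cycle.\<close>

definition XA where "XA = A.spread (PhiA \<otimes>\<^bsub>A_alg r n\<^esub> A.P (cyc n)) n"
definition YA where "YA = A.spread (PsiA \<otimes>\<^bsub>A_alg r n\<^esub> A.P (cyc_inv n)) 1"

sublocale A: mono_act "A_alg r n" r n "\<lambda>w. iota (cl (grp w))" wtA XA YA
proof
  show "A.act (- 1) XA"
    unfolding XA_def
  proof (rule A.act_of_Phi)
    fix i assume i: "2 \<le> i" "i + 1 \<le> n"
    then have "1 \<le> i - 1" "i - 1 \<le> n" "1 \<le> i" "i \<le> n" "i - 1 + 1 = i" by auto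
    with i A.cls_rel[OF A_rels.Phi_s[OF i]]
    show "PhiA \<otimes>\<^bsub>A_alg r n\<^esub> A.sw i (i + 1) = A.sw (i - 1) i \<otimes>\<^bsub>A_alg r n\<^esub> PhiA"
      by (simp add: A.cls_mult Ac_inc cl_simple iota_P)
  next
    fix i assume i: "i \<in> {1..n}"
    show "A.zt i 1 \<otimes>\<^bsub>A_alg r n\<^esub> PhiA = PhiA \<otimes>\<^bsub>A_alg r n\<^esub>
        (if i < n then A.zt (i + 1) 1 else wtA (- 1) \<otimes>\<^bsub>A_alg r n\<^esub> A.zt 1 1)"
      using A.cls_rel[OF A_rels.zeta_Phi[OF i]] i
      by (simp add: A.cls_mult Ac_inc cl_zpow cl_phi_zeta iota_zt iota_wt iota_mult if_distrib[of iota])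
  qed simp
  show "A.act 1 YA"
    unfolding YA_def
  proof (rule A.act_of_Psi)
    fix i assume i: "1 \<le> i" "i + 2 \<le> n"
    then have "i \<le> n" "i + 1 \<le> n" "i + 1 + 1 = i + 2" by auto
    with i A.cls_rel[OF A_rels.Psi_s[OF i]]
    show "PsiA \<otimes>\<^bsub>A_alg r n\<^esub> A.sw i (i + 1) = A.sw (i + 1) (i + 2) \<otimes>\<^bsub>A_alg r n\<^esub> PsiA"
      by (simp add: A.cls_mult Ac_inc cl_simple iota_P)
  next
    fix i assume i: "i \<in> {1..n}"
    show "A.zt i 1 \<otimes>\<^bsub>A_alg r n\<^esub> PsiA = PsiA \<otimes>\<^bsub>A_alg r n\<^esub>
        (if 1 < i then A.zt (i - 1) 1 else wtA 1 \<otimes>\<^bsub>A_alg r n\<^esub> A.zt n 1)"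
      using A.cls_rel[OF A_rels.zeta_Psi[OF i]] i
      by (simp add: A.cls_mult Ac_inc cl_zpow cl_phi_inv_zeta iota_zt iota_wt iota_mult if_distrib[of iota])
  qed simp
qed

lemma A_phi: "A.phi = PhiA" and A_psi: "A.psi = PsiA"
proof -
  have "XA n = PhiA \<otimes>\<^bsub>A_alg r n\<^esub> A.P (cyc n)" "YA 1 = PsiA \<otimes>\<^bsub>A_alg r n\<^esub> A.P (cyc_inv n)"
    unfolding XA_def YA_def by (simp_all add: A.spread_base)
  then show "A.phi = PhiA" "A.psi = PsiA"
    by (simp_all add: A.phi_def A.psi_def A.Q.m_assoc A.P_mult)
qed

text \<open>Representatives in the free algebra of \<open>XA j\<close>, \<open>YA j\<close> and the
  group elements, as \<open>presentation_hom\<close> requires.\<close>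

fun colift :: "cher_gen \<Rightarrow> A_free" where
  "colift (Xgen j) = inc r n (transpn n j n) * (\<Phi> * inc r n (grp (mono_mat r n (cyc n) (\<lambda>_. 0)))) * inc r n (transpn n j n)"
| "colift (Ygen j) = inc r n (transpn n j 1) * (\<Psi> * inc r n (grp (mono_mat r n (cyc_inv n) (\<lambda>_. 0)))) * inc r n (transpn n j 1)"
| "colift (Wgen w) = inc r n (grp w)"

lemma colift_mem: "g \<in> gens \<Longrightarrow> colift g \<in> F A_gs"
  by (auto simp: cher_gens_def intro!: F_mult inc_mem HG_B)

lemma subst_colift_mem: "a \<in> F gens \<Longrightarrow> subst colift a \<in> F A_gs"
  by (rule subst_mem) (rule colift_mem)

lemma subst_colift [simp]: "subst colift (xel j) = colift (Xgen j)" "subst colift (yel j) = colift (Ygen j)"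
    "subst colift (grp w) = inc r n (grp w)"
  by (simp_all only: xel_def yel_def grp_def subst_gen colift.simps)

lemma Ac_colift:
  assumes j: "j \<in> {1..n}"
  shows "Ac (colift (Xgen j)) = XA j" "Ac (colift (Ygen j)) = YA j"
  using j unfolding XA_def YA_def
  by (simp_all add: A.spread_def A.cls_mult Ac_inc cl_transpn iota_P cl_grp_mono flip: H.P_def)

lemma colift_X_mem [simp]: "j \<in> {1..n} \<Longrightarrow> colift (Xgen j) \<in> F A_gs"
  and colift_Y_mem [simp]: "j \<in> {1..n} \<Longrightarrow> colift (Ygen j) \<in> F A_gs"
  by (rule colift_mem, simp add: cher_gens_def)+

declare colift.simps [simp del]

text \<open>Both sides are additive, multiplicative and compatible with scalars on group
  expressions, and they agree on each group letter.\<close>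

lemma Ac_colift_B:
  assumes "b \<in> B"
  shows "Ac (subst colift b) = iota (cl b)"
  using assms
proof (induction b rule: F_induct)
  case zero
  show ?case using iota_scal[of 0] by (simp add: scal_simps)
next
  case (add a b)
  then show ?case
    by (simp add: A.cls_add H.cls_add B_mem iota_add subst_colift_mem)
next
  case (word c w)
  have w: "Ac (subst colift (prod_list (map gen w))) = iota (cl (prod_list (map gen w))) \<and> prod_list (map gen w) \<in> B"
    using word(2)
  proof (induction w)
    case Nil
    show ?case using iota_scal[of 1] by (simp add: scal_simps)
  next
    case (Cons s w)
    then obtain v where v: "s = Wgen v" "v \<in> carrier G" by auto
    have IH: "Ac (subst colift (prod_list (map gen w))) = iota (cl (prod_list (map gen w)))"
      "prod_list (map gen w) \<in> B"
      using Cons by auto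
    have "prod_list (map gen (s # w)) = grp v * prod_list (map gen w)" by (simp add: v(1) grp_def)
    moreover have "Ac (subst colift (grp v * prod_list (map gen w))) = iota (cl (grp v * prod_list (map gen w)))"
      unfolding subst_mult using IH v(2) subst_colift_mem[of "prod_list (map gen w)"]
      by (simp add: A.cls_mult H.cls_mult B_mem Ac_inc iota_mult del: subst_prod_list)
    moreover have "grp v * prod_list (map gen w) \<in> B" using IH(2) v(2) by simp
    ultimately show ?case by simp
  qed
  then show ?case
    unfolding subst_mult using word(1) subst_colift_mem[of "prod_list (map gen w)"]
    by (simp add: A.cls_mult H.cls_mult B_mem iota_mult iota_scal del: subst_prod_list)
qed

lemma iota_conj:
  assumes "conj_rel \<sigma> a b" "\<sigma> permutes {1..n}"
  shows "A.P \<sigma> \<otimes>\<^bsub>A_alg r n\<^esub> iota (cl a) = iota (cl b) \<otimes>\<^bsub>A_alg r n\<^esub> A.P \<sigma>"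
  using assms by (simp add: conj_rel_def iota_mult[symmetric] flip: iota_P)

text \<open>The relation for \<open>\<Psi> * \<Phi>\<close> gives the case \<open>i = 1\<close>;
  \<open>zel_conj\<close> and equivariance of \<open>XA\<close> and \<open>YA\<close> give the
  others.\<close>

lemma iota_zel:
  assumes i: "i \<in> {1..n}"
  shows "iota (cl (zel r n i)) = YA i \<otimes>\<^bsub>A_alg r n\<^esub> XA i \<oplus>\<^bsub>A_alg r n\<^esub> iota (cl (scal c0 * phi_sum r n i))"
proof -
  have "PsiA \<otimes>\<^bsub>A_alg r n\<^esub> PhiA = iota (cl (zel r n 1))"
    using A.cls_rel[OF A_rels.Psi_Phi] by (simp add: A.cls_mult Ac_inc)
  then have z1: "iota (cl (zel r n 1)) = YA 1 \<otimes>\<^bsub>A_alg r n\<^esub> XA 1"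
    using A.psi_phi by (simp add: A_phi A_psi)
  have "cl (transpn n 1 i * zel r n 1 * transpn n 1 i) \<in> HG"
    using i by (simp add: H.cls_mult)
  then have "iota (cl (zel r n i)) = A.sw 1 i \<otimes>\<^bsub>A_alg r n\<^esub> (YA 1 \<otimes>\<^bsub>A_alg r n\<^esub> XA 1) \<otimes>\<^bsub>A_alg r n\<^esub> A.sw 1 i
      \<oplus>\<^bsub>A_alg r n\<^esub> iota (cl (scal c0 * phi_sum r n i))"
    unfolding zel_conj[OF i] using i
    by (simp add: H.cls_add iota_add) (simp add: H.cls_mult iota_mult cl_transpn iota_P z1)
  then show ?thesis using i by (simp add: A.P_move)
qed

definition yx_const :: "nat \<Rightarrow> cher_free" where
  "yx_const i = 1 - scal c0 * refl_sum i - eps_sum i"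

lemma yx_const_B [simp]: "i \<in> {1..n} \<Longrightarrow> yx_const i \<in> B"
  by (simp add: yx_const_def)

lemma YX_same_A:
  assumes i: "i \<in> {1..n}"
  shows "YA i \<otimes>\<^bsub>A_alg r n\<^esub> XA i = XA i \<otimes>\<^bsub>A_alg r n\<^esub> YA i \<oplus>\<^bsub>A_alg r n\<^esub> iota (cl (yx_const i))"
proof -
  let ?s = "scal c0 * refl_sum n"
  have XY: "XA n \<otimes>\<^bsub>A_alg r n\<^esub> YA n = iota (cl Phi_Psi_rhs)"
    using A.cls_rel[OF A_rels.Phi_Psi[of r n, folded eps_sum_def Phi_Psi_rhs_def]] A.phi_psi
    by (simp add: A.cls_mult Ac_inc A_phi A_psi)
  \<comment> \<open>This computes the image of \<open>zel r n n\<close> a second time, through the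
    relation for \<open>\<Phi> * \<Psi>\<close>. Comparison with \<open>iota_zel\<close> and
    cancellation of \<open>?s\<close> leave the relation at index \<open>n\<close>, which a
    transposition then moves to \<open>i\<close>.\<close>
  have "zel r n n = Phi_Psi_rhs + (yx_const n + ?s)"
    by (simp add: Phi_Psi_rhs_def yx_const_def)
  then have "iota (cl (zel r n n)) = iota (cl Phi_Psi_rhs) \<oplus>\<^bsub>A_alg r n\<^esub> (iota (cl (yx_const n)) \<oplus>\<^bsub>A_alg r n\<^esub> iota (cl ?s))"
    by (simp add: H.cls_add iota_add B_mem)
  then have "YA n \<otimes>\<^bsub>A_alg r n\<^esub> XA n \<oplus>\<^bsub>A_alg r n\<^esub> iota (cl ?s) =
      XA n \<otimes>\<^bsub>A_alg r n\<^esub> YA n \<oplus>\<^bsub>A_alg r n\<^esub> iota (cl (yx_const n)) \<oplus>\<^bsub>A_alg r n\<^esub> iota (cl ?s)"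
    using iota_zel[of n] by (simp add: XY phi_sum_last A.Q.a_assoc)
  then have base: "YA n \<otimes>\<^bsub>A_alg r n\<^esub> XA n = XA n \<otimes>\<^bsub>A_alg r n\<^esub> YA n \<oplus>\<^bsub>A_alg r n\<^esub> iota (cl (yx_const n))"
    by (simp add: B_mem)
  let ?t = "Transposition.transpose n i"
  have t: "?t permutes {1..n}" using i by (intro permutes_swap_id) auto
  have "conj_rel ?t (yx_const n) (yx_const (?t n))"
    unfolding yx_const_def
    using t by (intro conj_rel_diff conj_rel_one conj_rel_scal conj_rel_refl_sum conj_rel_eps_sum) auto
  from A.YX_conj[OF t _ _ _ _ iota_conj[OF this t] base] i show ?thesis by simp
qed

lemma YX_diff_A:
  assumes ij: "i \<in> {1..n}" "j \<in> {1..n}" "i \<noteq> j"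
  shows "YA i \<otimes>\<^bsub>A_alg r n\<^esub> XA j = XA j \<otimes>\<^bsub>A_alg r n\<^esub> YA i \<oplus>\<^bsub>A_alg r n\<^esub> iota (cl (scal c0 * refl_twist i j))"
proof -
  from ij have n: "2 \<le> n" by auto
  let ?D = "scal c0 * refl_twist 1 n"
  have s: "1 \<le> n - 1" "n - 1 + 1 = n" using n by auto
  have D: "Ac (scal c0) \<otimes>\<^bsub>A_alg r n\<^esub> iota (cl zeta_twist) = iota (cl ?D) \<otimes>\<^bsub>A_alg r n\<^esub> A.sw 1 n"
    by (simp add: H.cls_mult iota_mult iota_scal iota_P A.Q.m_assoc flip: cl_twist)
  have "PsiA \<otimes>\<^bsub>A_alg r n\<^esub> A.sw (n - 1) n \<otimes>\<^bsub>A_alg r n\<^esub> PhiA =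
      PhiA \<otimes>\<^bsub>A_alg r n\<^esub> A.sw 1 2 \<otimes>\<^bsub>A_alg r n\<^esub> PsiA \<oplus>\<^bsub>A_alg r n\<^esub> Ac (scal c0) \<otimes>\<^bsub>A_alg r n\<^esub> iota (cl zeta_twist)"
    using A.cls_rel[OF A_rels.Psi_s_Phi[OF n, of r, folded zeta_twist_def]] s n
    by (simp add: A.cls_mult A.cls_add Ac_inc cl_simple iota_P)
  then have "YA 1 \<otimes>\<^bsub>A_alg r n\<^esub> XA n \<otimes>\<^bsub>A_alg r n\<^esub> A.sw 1 n =
      (XA n \<otimes>\<^bsub>A_alg r n\<^esub> YA 1 \<oplus>\<^bsub>A_alg r n\<^esub> iota (cl ?D)) \<otimes>\<^bsub>A_alg r n\<^esub> A.sw 1 n"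
    unfolding D A_phi[symmetric] A_psi[symmetric] A.psi_s_phi[OF n] A.phi_s_psi[OF n]
    by (simp add: A.Q.l_distr B_mem)
  \<comment> \<open>The transposition of 1 and \<open>n\<close> is invertible and is cancelled on
    the right; conjugation by \<sigma> then reaches every pair of distinct indices.\<close>
  then have base: "YA 1 \<otimes>\<^bsub>A_alg r n\<^esub> XA n = XA n \<otimes>\<^bsub>A_alg r n\<^esub> YA 1 \<oplus>\<^bsub>A_alg r n\<^esub> iota (cl ?D)"
    by (subst (asm) A.P_cancel) (simp_all add: B_mem)
  obtain \<sigma> where \<sigma>: "\<sigma> permutes {1..n}" "\<sigma> 1 = i" "\<sigma> n = j"
    by (rule ex_permutation_two[of 1 "{1..n}" n i j]) (use n ij in auto)
  have "conj_rel \<sigma> ?D (scal c0 * refl_twist (\<sigma> 1) (\<sigma> n))"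
    using \<sigma>(1) by (intro conj_rel_scal conj_rel_refl_twist) auto
  from A.YX_conj[OF \<sigma>(1) _ _ _ _ iota_conj[OF this \<sigma>(1)] base] ij show ?thesis by (simp add: \<sigma>)
qed

lemma A_conj_inv:
  assumes w: "w \<in> carrier G" and [simp]: "x \<in> carrier (A_alg r n)" "y \<in> carrier (A_alg r n)"
    and "iota (cl (grp w)) \<otimes>\<^bsub>A_alg r n\<^esub> x = y \<otimes>\<^bsub>A_alg r n\<^esub> iota (cl (grp w))"
  shows "iota (cl (grp w)) \<otimes>\<^bsub>A_alg r n\<^esub> x \<otimes>\<^bsub>A_alg r n\<^esub> iota (cl (grp (inv\<^bsub>G\<^esub> w))) = y"
proof -
  have w': "inv\<^bsub>G\<^esub> w \<in> carrier G" "w * inv\<^bsub>G\<^esub> w = 1\<^sub>m n" using w r_inv[OF w] by (simp_all add: G_sel)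
  have "iota (cl (grp w)) \<otimes>\<^bsub>A_alg r n\<^esub> iota (cl (grp (inv\<^bsub>G\<^esub> w))) = \<one>\<^bsub>A_alg r n\<^esub>"
    using A.g_mult[OF w w'(1)] w'(2) A.g_one by simp
  with w w' show ?thesis by (simp add: assms(4) A.Q.m_assoc)
qed

lemma colift_rels:
  assumes "(a, b) \<in> cher_rels r n"
  shows "Ac (subst colift a) = Ac (subst colift b)"
proof -
  have X: "XA n \<otimes>\<^bsub>A_alg r n\<^esub> XA (n - 1) = XA (n - 1) \<otimes>\<^bsub>A_alg r n\<^esub> XA n" if n: "2 \<le> n"
  proof -
    have s: "1 \<le> n - 1" "n - 1 + 1 = n" using n by auto
    with n A.cls_rel[OF A_rels.Phi2_s[OF n, of r]] A.phi_sq[OF n] show ?thesis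
      by (simp add: power2_eq_square A.cls_mult Ac_inc cl_simple iota_P A_phi)
  qed
  have Y: "YA 1 \<otimes>\<^bsub>A_alg r n\<^esub> YA 2 = YA 2 \<otimes>\<^bsub>A_alg r n\<^esub> YA 1" if n: "2 \<le> n"
  proof -
    have s: "1 \<le> n - 1" "n - 1 + 1 = n" using n by auto
    with n A.cls_rel[OF A_rels.Psi2_s[OF n, of r]] A.psi_sq[OF n] show ?thesis
      by (simp add: power2_eq_square A.cls_mult Ac_inc cl_simple iota_P A_psi)
  qed
  from assms show ?thesis
  proof (cases rule: cher_rels_cases)
    case (1 i j)
    with A.X_commute_all[OF X] show ?thesis by (simp add: A.cls_mult Ac_colift)
  next
    case (2 i j)
    with A.Y_commute_all[OF Y] show ?thesis by (simp add: A.cls_mult Ac_colift)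
  next
    case 3
    then show ?thesis using A.g_one by (simp add: G_sel Ac_inc A.cls_one)
  next
    case (4 v w)
    then show ?thesis using A.g_mult[of v w] by (simp add: G_sel A.cls_mult Ac_inc)
  next
    case (5 w j)
    then obtain \<sigma> k where \<sigma>: "\<sigma> permutes {1..n}" and w: "w = mono_mat r n \<sigma> k"
      by (auto simp: G_carrier)
    have \<sigma>j: "\<sigma> j \<in> {1..n}" using A.perm_range[OF \<sigma> 5(2)] .
    have b: "subst colift b = scal (cst (zeta r powi (- k j))) * colift (Xgen (\<sigma> j))"
      unfolding 5(4) w subst_sum subst_mult subst_scal subst_colift using wx_sum[OF \<sigma> 5(2)] .
    have "iota (cl (grp w)) \<otimes>\<^bsub>A_alg r n\<^esub> XA j \<otimes>\<^bsub>A_alg r n\<^esub> iota (cl (grp (inv\<^bsub>G\<^esub> w))) =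
        wtA (- k j) \<otimes>\<^bsub>A_alg r n\<^esub> XA (\<sigma> j)"
      using A.M_X[OF 5(2) \<sigma>, of k] 5(1,2) \<sigma>j
      by (intro A_conj_inv) (simp_all add: w A.M_def A.Q.m_assoc)
    then show ?thesis
      unfolding b using 5 \<sigma>j by (simp add: A.cls_mult Ac_inc Ac_colift wtA_def)
  next
    case (6 w j)
    then obtain \<sigma> k where \<sigma>: "\<sigma> permutes {1..n}" and w: "w = mono_mat r n \<sigma> k"
      by (auto simp: G_carrier)
    have \<sigma>j: "\<sigma> j \<in> {1..n}" using A.perm_range[OF \<sigma> 6(2)] .
    have b: "subst colift b = scal (cst (zeta r powi k j)) * colift (Ygen (\<sigma> j))"
      unfolding 6(4) w subst_sum subst_mult subst_scal subst_colift using wy_sum[OF \<sigma> 6(2)] .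
    have "iota (cl (grp w)) \<otimes>\<^bsub>A_alg r n\<^esub> YA j \<otimes>\<^bsub>A_alg r n\<^esub> iota (cl (grp (inv\<^bsub>G\<^esub> w))) =
        wtA (k j) \<otimes>\<^bsub>A_alg r n\<^esub> YA (\<sigma> j)"
      using A.M_Y[OF 6(2) \<sigma>, of k] 6(1,2) \<sigma>j
      by (intro A_conj_inv) (simp_all add: w A.M_def A.Q.m_assoc)
    then show ?thesis
      unfolding b using 6 \<sigma>j by (simp add: A.cls_mult Ac_inc Ac_colift wtA_def)
  next
    case (7 i)
    \<comment> \<open>Collecting the group terms in \<open>yx_const i\<close> allows
      \<open>Ac_colift_B\<close> to evaluate them together.\<close>
    have "b = xel i * yel i + yx_const i" by (simp add: 7 yx_const_def)
    then have "subst colift b = colift (Xgen i) * colift (Ygen i) + subst colift (yx_const i)"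
      by simp
    then show ?thesis
      using YX_same_A[OF 7(1)] 7(1,2) subst_colift_mem[OF B_mem[OF yx_const_B[OF 7(1)]]]
      by (simp add: A.cls_mult A.cls_add Ac_colift Ac_colift_B)
  next
    case (8 i j)
    have c: "scal c0 * refl_twist i j \<in> B" using 8 by simp
    have "subst colift b = colift (Xgen j) * colift (Ygen i) + subst colift (scal c0 * refl_twist i j)"
      by (simp add: 8)
    then show ?thesis
      using YX_diff_A[OF 8(1-3)] 8(1-4) subst_colift_mem[OF B_mem[OF c]] Ac_colift_B[OF c]
      by (simp add: A.cls_mult A.cls_add Ac_colift del: subst_mult)
         (simp add: A.cls_mult Ac_colift)
  qed
qed

subsection \<open>The isomorphism\<close>

lemma natural_map_exists:
  obtains f b where "f \<in> Ring.ring_hom (A_alg r n) (cherednik r n)"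
    and "b \<in> Ring.ring_hom (cherednik r n) (A_alg r n)"
    and "\<And>c. c \<in> R \<Longrightarrow> f (Ac (scal c)) = cl (scal c)"
    and "\<And>a. a \<in> HG \<Longrightarrow> f (iota a) = a"
    and "f PhiA = cl Phi_img" "f PsiA = cl Psi_img"
    and "\<And>q. q \<in> carrier (cherednik r n) \<Longrightarrow> f (b q) = q"
    and "\<And>q. q \<in> carrier (A_alg r n) \<Longrightarrow> b (f q) = q"
proof -
  obtain f where f: "f \<in> Ring.ring_hom (A_alg r n) (cherednik r n)"
    and f_Ac: "\<And>a. a \<in> F A_gs \<Longrightarrow> f (Ac a) = cl (subst lift a)"
    by (rule presentation_hom[OF A_presentation cher_presentation, of lift,
          folded A_alg_def cherednik_def A_class_def cher_class_def])
       (use lift_mem lift_rels in auto)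
  obtain b where b: "b \<in> Ring.ring_hom (cherednik r n) (A_alg r n)"
    and b_cl: "\<And>a. a \<in> F gens \<Longrightarrow> b (cl a) = Ac (subst colift a)"
    by (rule presentation_hom[OF cher_presentation A_presentation, of colift,
          folded A_alg_def cherednik_def A_class_def cher_class_def])
       (use colift_mem colift_rels in auto)
  have f_iota: "f (iota a) = a" if "a \<in> HG" for a
    using that by (simp add: iota_def f_Ac)
  have fP: "f (A.P \<sigma>) = H.P \<sigma>" if "\<sigma> permutes {1..n}" for \<sigma>
    using that by (simp add: f_iota flip: iota_P)
  have fPhi: "f PhiA = H.phi" "f PsiA = H.psi"
    by (simp_all add: f_Ac cl_Phi cl_Psi)
  note f_mult = ring_hom_mult[OF f]
  have fX: "f (XA j) = cl (xel j)" if j: "j \<in> {1..n}" for j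
  proof -
    have "f (XA j) = H.sw j n \<otimes>\<^bsub>cherednik r n\<^esub> (H.phi \<otimes>\<^bsub>cherednik r n\<^esub> H.P (cyc n)) \<otimes>\<^bsub>cherednik r n\<^esub> H.sw j n"
      using j by (simp add: XA_def A.spread_def f_mult fP fPhi)
    also have "\<dots> = cl (xel j)"
      using j by (simp add: H.phi_def H.P_move)
    finally show ?thesis .
  qed
  have fY: "f (YA j) = cl (yel j)" if j: "j \<in> {1..n}" for j
  proof -
    have "f (YA j) = H.sw j 1 \<otimes>\<^bsub>cherednik r n\<^esub> (H.psi \<otimes>\<^bsub>cherednik r n\<^esub> H.P (cyc_inv n)) \<otimes>\<^bsub>cherednik r n\<^esub> H.sw j 1"
      using j by (simp add: YA_def A.spread_def f_mult fP fPhi)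
    also have "\<dots> = cl (yel j)"
      using j by (simp add: H.psi_def H.P_move)
    finally show ?thesis .
  qed
  have fb: "f (b q) = q" if "q \<in> carrier (cherednik r n)" for q
  proof -
    have "(f \<circ> b) q = (\<lambda>q. q) q"
    proof (rule H.hom_eqI[OF H.Q.ring_axioms _ _ _ _ that])
      show "f \<circ> b \<in> Ring.ring_hom (cherednik r n) (cherednik r n)"
        by (rule ring_hom_trans[OF b f])
      show "(\<lambda>q. q) \<in> Ring.ring_hom (cherednik r n) (cherednik r n)"
        by (rule ring_hom_memI) auto
      show "(f \<circ> b) (cl (scal c)) = cl (scal c)" if "c \<in> R" for c
        using that by (simp add: b_cl f_Ac)
      show "(f \<circ> b) (cl (gen s)) = cl (gen s)" if s: "s \<in> gens" for s
      proof -
        consider j where "j \<in> {1..n}" "s = Xgen j" | j where "j \<in> {1..n}" "s = Ygen j"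
          | w where "w \<in> carrier G" "s = Wgen w"
          using s by (auto simp: cher_gens_def)
        then show ?thesis
        proof cases
          case 1
          then show ?thesis using fX b_cl[OF xel_mem] by (simp add: Ac_colift xel_def)
        next
          case 2
          then show ?thesis using fY b_cl[OF yel_mem] by (simp add: Ac_colift yel_def)
        next
          case 3
          then show ?thesis using f_iota b_cl[OF grp_mem] by (simp add: Ac_inc flip: grp_def)
        qed
      qed
    qed
    then show ?thesis by simp
  qed
  \<comment> \<open>On \<open>H_gr\<close> the inverse map has to coincide with \<open>iota\<close>.
    Group expressions come first; \<open>HG_eqI\<close> then leaves the elements
    \<open>zel r n i\<close>, where \<open>iota_zel\<close> gives the same value as
    \<open>b\<close>.\<close>
  have b_B: "b (cl h) = iota (cl h)" if "h \<in> B" for h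
    using that by (simp add: b_cl B_mem Ac_colift_B)
  have b_HG: "b a = iota a" if "a \<in> HG" for a
  proof (rule HG_eqI[OF A.Q.ring_axioms _ _ _ _ _ that])
    show "b (x \<oplus>\<^bsub>cherednik r n\<^esub> y) = b x \<oplus>\<^bsub>A_alg r n\<^esub> b y \<and> iota (x \<oplus>\<^bsub>cherednik r n\<^esub> y) = iota x \<oplus>\<^bsub>A_alg r n\<^esub> iota y"
      if "x \<in> HG" "y \<in> HG" for x y
      using that by (simp add: iota_add ring_hom_add[OF b] HG_carrier)
    show "b (x \<otimes>\<^bsub>cherednik r n\<^esub> y) = b x \<otimes>\<^bsub>A_alg r n\<^esub> b y \<and> iota (x \<otimes>\<^bsub>cherednik r n\<^esub> y) = iota x \<otimes>\<^bsub>A_alg r n\<^esub> iota y"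
      if "x \<in> HG" "y \<in> HG" for x y
      using that by (simp add: iota_mult ring_hom_mult[OF b] HG_carrier)
    show "b (cl (zel r n i)) = iota (cl (zel r n i))" if i: "i \<in> {1..n}" for i
    proof -
      define h where "h = scal c0 * phi_sum r n i"
      have h: "h \<in> B" using i by (simp add: h_def)
      have "b (cl (zel r n i)) = b (cl (yel i)) \<otimes>\<^bsub>A_alg r n\<^esub> b (cl (xel i)) \<oplus>\<^bsub>A_alg r n\<^esub> b (cl h)"
        unfolding zel_def h_def[symmetric] using i h
        by (simp add: H.cls_add H.cls_mult ring_hom_add[OF b] ring_hom_mult[OF b] B_mem)
      then show ?thesis using i unfolding iota_zel[OF i] h_def[symmetric] b_B[OF h] by (simp add: b_cl Ac_colift)
    qed
  qed (simp_all add: b_B)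
  have bf: "b (f q) = q" if "q \<in> carrier (A_alg r n)" for q
  proof -
    have "(b \<circ> f) q = (\<lambda>q. q) q"
    proof (rule A.hom_eqI[OF A.Q.ring_axioms _ _ _ _ that])
      show "b \<circ> f \<in> Ring.ring_hom (A_alg r n) (A_alg r n)"
        by (rule ring_hom_trans[OF f b])
      show "(\<lambda>q. q) \<in> Ring.ring_hom (A_alg r n) (A_alg r n)"
        by (rule ring_hom_memI) auto
      show "(b \<circ> f) (Ac (scal c)) = Ac (scal c)" if "c \<in> R" for c
        using that by (simp add: b_cl f_Ac)
      have bP: "b (H.P \<sigma>) = A.P \<sigma>" if "\<sigma> permutes {1..n}" for \<sigma>
        using that by (simp add: b_HG iota_P)
      \<comment> \<open>\<open>H.phi\<close> is the class of \<open>xel n\<close> times a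
        permutation, and \<open>H.psi\<close> that of \<open>yel 1\<close> times a permutation;
        \<open>b\<close> is known on all these factors.\<close>
      have "b H.phi = A.phi" "b H.psi = A.psi"
        by (simp_all add: H.phi_def H.psi_def A.phi_def A.psi_def ring_hom_mult[OF b] bP b_cl Ac_colift)
      then have *: "b (f PhiA) = PhiA" "b (f PsiA) = PsiA"
        by (simp_all add: fPhi A_phi A_psi)
      show "(b \<circ> f) (Ac (gen s)) = Ac (gen s)" if s: "s \<in> A_gs" for s
      proof -
        consider a where "a \<in> HG" "s = Inc a" | "s = PhiGen" | "s = PsiGen"
          using s by (auto simp: A_gens_def)
        then show ?thesis
        proof cases
          case 1
          then show ?thesis using f_iota b_HG by (simp add: iota_def)
        qed (use * in \<open>simp_all add: \<Phi>_def \<Psi>_def\<close>)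
      qed
    qed
    then show ?thesis by simp
  qed
  show ?thesis
    by (rule that[OF f b]) (use f_iota fb bf in \<open>simp_all add: f_Ac\<close>)
qed

text \<open>The prescribed values cover the scalars and all generators of \<open>A\<close>, so
  \<open>hom_eqI\<close> settles the carrier and extensionality the rest.\<close>

lemma natural_map_unique:
  assumes "natural_map r n f" "natural_map r n g"
  shows "f = g"
proof (rule extensionalityI)
  show "f \<in> extensional (carrier (A_alg r n))" "g \<in> extensional (carrier (A_alg r n))"
    using assms by (auto simp: natural_map_def)
  fix q assume "q \<in> carrier (A_alg r n)"
  then show "f q = g q"
  proof (rule A.hom_eqI[OF H.Q.ring_axioms, rotated -1])
    fix s assume "s \<in> A_gs"
    then show "f (Ac (gen s)) = g (Ac (gen s))"
      using assms by (auto simp: A_gens_def natural_map_def \<Phi>_def \<Psi>_def)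
  qed (use assms in \<open>auto simp: natural_map_def\<close>)
qed

lemma natural_map_iso: "\<exists>f. natural_map r n f \<and> f \<in> ring_iso (A_alg r n) (cherednik r n)"
proof -
  obtain f b where f: "f \<in> Ring.ring_hom (A_alg r n) (cherednik r n)"
    and b: "b \<in> Ring.ring_hom (cherednik r n) (A_alg r n)"
    and f_vals: "\<And>c. c \<in> R \<Longrightarrow> f (Ac (scal c)) = cl (scal c)" "\<And>a. a \<in> HG \<Longrightarrow> f (iota a) = a"
      "f PhiA = cl Phi_img" "f PsiA = cl Psi_img"
    and fb: "\<And>q. q \<in> carrier (cherednik r n) \<Longrightarrow> f (b q) = q"
    and bf: "\<And>q. q \<in> carrier (A_alg r n) \<Longrightarrow> b (f q) = q"
    by (rule natural_map_exists) blast
  let ?f = "restrict f (carrier (A_alg r n))"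
  have hom: "?f \<in> Ring.ring_hom (A_alg r n) (cherednik r n)"
    by (rule ring_hom_memI)
       (use f in \<open>auto simp: ring_hom_closed ring_hom_mult ring_hom_add ring_hom_one\<close>)
  have "bij_betw f (carrier (A_alg r n)) (carrier (cherednik r n))"
    by (rule bij_betw_byWitness[where f' = b])
       (use fb bf ring_hom_closed[OF f] ring_hom_closed[OF b] in auto)
  then have "bij_betw ?f (carrier (A_alg r n)) (carrier (cherednik r n))"
    by (subst bij_betw_restrict_eq)
  with hom have "?f \<in> ring_iso (A_alg r n) (cherednik r n)"
    by (simp add: ring_iso_def)
  moreover have "natural_map r n ?f"
    unfolding natural_map_def using hom f_vals
    by (auto simp: Phi_img_def Psi_img_def iota_def)
  ultimately show ?thesis by blast
qed

end

theorem theorem3p1: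
  fixes r n :: nat
  assumes "r \<ge> 1" and "n \<ge> 1"
  shows "(\<exists>!f. natural_map r n f) \<and>
    (\<forall>f. natural_map r n f \<longrightarrow> f \<in> ring_iso (A_alg r n) (cherednik r n))"
proof -
  interpret cherednik_params r n by standard (fact assms)+
  \<comment> \<open>By uniqueness every natural map is the one already known to be an
    isomorphism.\<close>
  from natural_map_iso natural_map_unique show ?thesis by metis
qed

end
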